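(* Let $1\le M<N$ and let $\mathbf{X}=\mathbf{S}+\mathbf{N}$, where $\mathbf{S}$ and $\mathbf{N}$ are independent $\mathbb{R}^N$-valued random vectors with finite second moments, $\mathbf{N}$ having a probability density and finite differential entropy. Assume that the covariance matrix $C_{\mathbf S}$ of $\mathbf{S}$ has rank at most $M$ and that the covariance matrix $C_{\mathbf N}$ of $\mathbf{N}$ has full rank. Let $\mathbf{Y}=W^T\mathbf{X}$ and let $\mathbf{Y}_M$ consist of the first $M$ components of $\mathbf{Y}$, where $W$ is an orthogonal matrix whose columns are eigenvectors of the covariance matrix $C_{\mathbf X}$ of $\mathbf{X}$ ordered by decreasing eigenvalue (PCA). Suppose that $\mathbf{N}$ is more Gaussian than $\mathbf{Y}$ in the sense that $$J(\tilde{\mathbf N}_c|\tilde{\mathbf N}_M)\le J(\mathbf{Y}_c|\mathbf{Y}_M).$$ Then $$L_{\mathbf S}(\mathbf{X}\to\mathbf{Y}_M)\le\frac12\ln\left(\prod_{i=M+1}^{N}\frac{\mu_1}{\mu_i}\right),$$ where $\mu_1\ge\mu_2\ge\dots\ge\mu_N$ are the eigenvalues of $C_{\mathbf N}$ in decreasing order.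
   Context: Relevant information loss: for a random variable $\mathbf{X}$, a (measurable) function $\mathbf{Y}'=g(\mathbf{X})$ and a relevant random variable $\mathbf{S}$, $L_{\mathbf S}(\mathbf{X}\to\mathbf{Y}')=\sup_{\mathcal P}\big(I(\hat{\mathbf S};\mathbf X)-I(\hat{\mathbf S};\mathbf Y')\big)=I(\mathbf{X};\mathbf{S}|\mathbf{Y}')$, the supremum being over finite measurable partitions $\mathcal P$ of the sample space of $\mathbf S$ and $\hat{\mathbf S}$ being $\mathbf S$ quantized according to $\mathcal P$. Information is measured with the natural logarithm. Notation: $\tilde{\mathbf N}=W^T\mathbf{N}$. The subscript $M$ denotes the vector of the first $M$ components and the subscript $c$ the vector of the last $N-M$ components; e.g. $\mathbf{Y}_M,\mathbf{Y}_c,\tilde{\mathbf N}_M,\tilde{\mathbf N}_c$. $h(\cdot|\cdot)$ denotes conditional differential entropy. For continuous random vectors $(A,B)$ with a joint density and finite second moments, $(A_G,B_G)$ denotes a jointly Gaussian pair with the same joint first and second moments as $(A,B)$, and the conditional divergence is $J(A|B)=h(A_G|B_G)-h(A|B)$. *)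

theory Defs
  imports "HOL-Probability.Probability"
begin

text \<open>
  Random vectors take values in \<open>real ^ 'n\<close>, where the finite well-ordered index type \<open>'n\<close> plays
  the role of \<open>{1, ..., N}\<close> with \<open>N = CARD('n)\<close>. A subvector indexed by a set \<open>I\<close> is an element of
  the product space over \<open>I\<close>, whose reference measure is the Lebesgue measure on that space.
  Logarithms are natural: the base is \<open>exp 1\<close> throughout.
\<close>

definition first_indices :: "nat \<Rightarrow> 'n::{finite,wellorder} set" where
  "first_indices m = {i. card {j. j < i} < m}"

definition subvector :: "'n set \<Rightarrow> real ^ 'n \<Rightarrow> 'n \<Rightarrow> real" where
  "subvector I x = (\<lambda>i\<in>I. x $ i)"

abbreviation subvector_lborel :: "'n set \<Rightarrow> ('n \<Rightarrow> real) measure" where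
  "subvector_lborel I \<equiv> Pi\<^sub>M I (\<lambda>_. lborel)"


definition (in prob_space) covariance_matrix :: "('a \<Rightarrow> real ^ 'n) \<Rightarrow> real ^ 'n ^ 'n" where
  "covariance_matrix Z =
     (\<chi> i j. expectation (\<lambda>\<omega>. (Z \<omega> $ i - expectation Z $ i) * (Z \<omega> $ j - expectation Z $ j)))"

definition pca_matrix ::
    "real ^ 'n::{finite,wellorder} ^ 'n::_ \<Rightarrow> real ^ 'n::_ ^ 'n::_ \<Rightarrow> bool" where
  "pca_matrix C W \<longleftrightarrow> orthogonal_matrix W \<and>
     (\<exists>l. antimono l \<and> (\<forall>i. C *v column i W = l i *\<^sub>R column i W))"

text \<open>
  The eigenvalues with multiplicity, numbered \<open>1, ..., N\<close>, are the roots of the characteristic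
  polynomial.
\<close>

definition eigenvalues_decreasing :: "real ^ 'n ^ 'n \<Rightarrow> (nat \<Rightarrow> real) \<Rightarrow> bool" where
  "eigenvalues_decreasing C \<mu> \<longleftrightarrow>
     (\<forall>i j. 1 \<le> i \<longrightarrow> i \<le> j \<longrightarrow> j \<le> CARD('n) \<longrightarrow> \<mu> j \<le> \<mu> i) \<and>
     (\<forall>x. det (x *\<^sub>R mat 1 - C) = (\<Prod>i = 1..CARD('n). x - \<mu> i))"


definition gaussian_density :: "real ^ 'n \<Rightarrow> real ^ 'n ^ 'n \<Rightarrow> real ^ 'n \<Rightarrow> real" where
  "gaussian_density m C x =
     exp (- ((x - m) \<bullet> (matrix_inv C *v (x - m))) / 2) / sqrt ((2 * pi) ^ CARD('n) * det C)"

definition gaussian_measure :: "real ^ 'n \<Rightarrow> real ^ 'n ^ 'n \<Rightarrow> (real ^ 'n) measure" where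
  "gaussian_measure m C = density lborel (\<lambda>x. ennreal (gaussian_density m C x))"

text \<open>
  The divergence \<open>J(A|B) = h(A\<^sub>G|B\<^sub>G) - h(A|B)\<close> of the subvectors \<open>A = Z\<^sub>I\<close> and \<open>B = Z\<^sub>J\<close>, for
  \<open>I\<close> and \<open>J\<close> complementary. The pair \<open>(A\<^sub>G, B\<^sub>G)\<close> consists of the same coordinate projections, viewed as random
  vectors on the probability space given by the Gaussian law with the mean and the covariance of
  \<open>Z\<close>; that covariance is nonsingular whenever \<open>Z\<close> has a density and finite second moments.
\<close>

definition (in prob_space) conditional_divergence ::
    "'n set \<Rightarrow> 'n set \<Rightarrow> ('a \<Rightarrow> real ^ 'n) \<Rightarrow> real" where
  "conditional_divergence I J Z =
     prob_space.conditional_entropy (gaussian_measure (expectation Z) (covariance_matrix Z)) (exp 1)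
       (subvector_lborel I) (subvector_lborel J) (subvector I) (subvector J) -
     conditional_entropy (exp 1)
       (subvector_lborel I) (subvector_lborel J)
       (\<lambda>\<omega>. subvector I (Z \<omega>)) (\<lambda>\<omega>. subvector J (Z \<omega>))"


definition quantize :: "'b set set \<Rightarrow> ('a \<Rightarrow> 'b) \<Rightarrow> 'a \<Rightarrow> 'b set" where
  "quantize \<P> S \<omega> = (THE A. A \<in> \<P> \<and> S \<omega> \<in> A)"

text \<open>
  For a finite partition both mutual informations are finite, bounded by \<open>ln (card \<P>)\<close>, so the
  library's real-valued notion applies; the supremum may be infinite.
\<close>

definition (in prob_space) relevant_information_loss ::
    "'s measure \<Rightarrow> 'x measure \<Rightarrow> 'y measure \<Rightarrow> ('a \<Rightarrow> 's) \<Rightarrow> ('a \<Rightarrow> 'x) \<Rightarrow> ('a \<Rightarrow> 'y) \<Rightarrow> ereal" where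
  "relevant_information_loss S' X' Y' S X Y =
     (SUP \<P> \<in> {\<P>. finite \<P> \<and> partition_on (space S') \<P> \<and> \<P> \<subseteq> sets S'}.
        ereal (mutual_information (exp 1) (count_space \<P>) X' (quantize \<P> S) X -
               mutual_information (exp 1) (count_space \<P>) Y' (quantize \<P> S) Y))"

end

theory Submission
  imports Defs
begin

text \<open>
  For a finite quantization of \<open>S\<close>, the difference of the two mutual informations is at most
  \<open>h(Y\<^sub>c|Y\<^sub>M) - h(Y\<^sub>c|Y\<^sub>M, S)\<close>, and by independence the subtracted term equals the conditional entropy of
  the rotated noise. Since \<open>N\<close> is more Gaussian than \<open>Y\<close>, this is bounded by the same difference for the Gaussian
  vectors with the given covariances. There \<open>Y\<close> has independent components of variance at most
  \<open>\<mu>\<^sub>1\<close> outside the first \<open>M\<close> (Weyl's inequality, as \<open>C\<^sub>S\<close> has rank at most \<open>M\<close>), while the conditional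
  entropy of the noise is at least that of independent components with variances
  \<open>\<mu>\<^sub>M\<^sub>+\<^sub>1, \<dots>, \<mu>\<^sub>N\<close> (Cauchy interlacing).

  All entropy comparisons reduce to Gibbs' inequality in the form \<open>E[ln U] \<le> E[ln V]\<close> if
  \<open>E[U / V] \<le> 1\<close>, applied with \<open>V\<close> a density evaluated at its random variable and \<open>U\<close> a subdensity; the same
  ratio bounds yield the integrability of all logarithms involved.
\<close>

section \<open>Self-adjoint maps and eigenvalue inequalities\<close>

text \<open>The obstacle is the signal: its covariance is singular, so \<open>S\<close> is almost
  surely confined to a proper affine subspace and has no density. The pair of \<open>S\<close> and
  \<open>N\<close> is therefore given a density relative to the product of the law of
  \<open>S\<close> with Lebesgue measure. That density is the one of \<open>N\<close> alone, and
  conditioning on \<open>S\<close> becomes an estimate at every fixed value s.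

  Entropies and informations are Bochner integrals, with value 0 where they diverge, so splitting
  them into expectations of single logarithms presupposes integrability of each. The upper
  comparison comes from the finite entropy of \<open>N\<close>, the lower one from a Gaussian
  density, whose logarithm is integrable by the second moments.

  The constant has this origin: for Gaussian noise the conditional entropy is the joint entropy
  minus that of the first M components. The joint entropy depends on all \<mu> and survives
  rotation, while the subtracted entropy is at most that of independent components with the M
  largest \<mu> as variances. The last N - M numbers remain, and the factors 2 pi e cancel against
  those of \<open>Y\<close>.\<close>

lemma selfadjoint_max_eigenvector:
  fixes f :: "'a::euclidean_space \<Rightarrow> 'a"
  assumes lin: "linear f" and sa: "\<And>x y. f x \<bullet> y = x \<bullet> f y"
    and U: "subspace U" and inv: "\<And>x. x \<in> U \<Longrightarrow> f x \<in> U" and d: "dim U \<noteq> 0"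
  obtains x m where "x \<in> U" "norm x = 1" "f x = m *\<^sub>R x" "\<And>y. y \<in> U \<Longrightarrow> f y \<bullet> y \<le> m * (y \<bullet> y)"
proof -
  interpret f: linear f by fact
  define K where "K = sphere 0 1 \<inter> U"
  have cK: "compact K"
    unfolding K_def using closed_subspace[OF U] by (intro compact_Int_closed) auto
  obtain z where z: "z \<in> U" "z \<noteq> 0"
    using d dim_eq_0[of U] by auto
  have "(1 / norm z) *\<^sub>R z \<in> K"
    using z U by (auto simp: K_def subspace_scale)
  then have ne: "K \<noteq> {}" by auto
  have "continuous_on K (\<lambda>x. f x \<bullet> x)"
    using linear_continuous_on[of f K] lin linear_conv_bounded_linear
    by (intro continuous_intros) auto
  from continuous_attains_sup[OF cK ne this] obtain x where x: "x \<in> K" and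
    max: "\<And>y. y \<in> K \<Longrightarrow> f y \<bullet> y \<le> f x \<bullet> x" by blast
  define m where "m = f x \<bullet> x"
  have xU: "x \<in> U" and nx: "norm x = 1" using x by (auto simp: K_def)
  have bound: "f y \<bullet> y \<le> m * (y \<bullet> y)" if "y \<in> U" for y
  proof (cases "y = 0")
    case True then show ?thesis by (simp add: f.zero)
  next
    case False
    have "(1 / norm y) *\<^sub>R y \<in> K" using that False U by (auto simp: K_def subspace_scale)
    from max[OF this] have "(f y \<bullet> y) / (norm y)\<^sup>2 \<le> m"
      by (simp add: f.scaleR m_def power2_eq_square)
    then show ?thesis using False
      by (simp add: divide_le_eq dot_square_norm)
  qed
  \<comment> \<open>\<open>w\<close> is half the gradient at \<open>x\<close> of m (y . y) - f y .
    y. It lies in \<open>U\<close> because \<open>U\<close> is invariant, so \<open>x\<close> can be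
    moved along it within the set where \<open>bound\<close> holds.\<close>
  define w where "w = m *\<^sub>R x - f x"
  have wU: "w \<in> U" unfolding w_def using xU inv[OF xU] U by (intro subspace_diff subspace_scale) auto
  have xx: "x \<bullet> x = 1" using nx by (simp add: dot_square_norm)
  \<comment> \<open>\<open>y \<mapsto> m (y \<bullet> y) - f y \<bullet> y\<close> is nonnegative on \<open>U\<close> and vanishes at \<open>x\<close>, so its derivative in direction \<open>w\<close> vanishes.\<close>
  have quad: "0 \<le> t * (2 * (w \<bullet> w)) + t\<^sup>2 * (m * (w \<bullet> w) - f w \<bullet> w)" for t
  proof -
    have "x + t *\<^sub>R w \<in> U" using xU wU U by (intro subspace_add subspace_scale)
    from bound[OF this] have "f (x + t *\<^sub>R w) \<bullet> (x + t *\<^sub>R w) \<le> m * ((x + t *\<^sub>R w) \<bullet> (x + t *\<^sub>R w))" .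
    moreover have "f (x + t *\<^sub>R w) \<bullet> (x + t *\<^sub>R w) = m + 2 * t * (f x \<bullet> w) + t\<^sup>2 * (f w \<bullet> w)"
      using sa[of x w] by (simp add: f.add f.scaleR inner_add_left inner_add_right m_def algebra_simps power2_eq_square inner_commute)
    moreover have "(x + t *\<^sub>R w) \<bullet> (x + t *\<^sub>R w) = 1 + 2 * t * (x \<bullet> w) + t\<^sup>2 * (w \<bullet> w)"
      using xx by (simp add: inner_add_left inner_add_right algebra_simps power2_eq_square inner_commute)
    ultimately have "m + 2 * t * (f x \<bullet> w) + t\<^sup>2 * (f w \<bullet> w) \<le> m * (1 + 2 * t * (x \<bullet> w) + t\<^sup>2 * (w \<bullet> w))"
      by simp
    then have "0 \<le> t * (2 * (m * (x \<bullet> w) - f x \<bullet> w)) + t\<^sup>2 * (m * (w \<bullet> w) - f w \<bullet> w)"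
      by (simp add: algebra_simps)
    moreover have "w \<bullet> w = m * (x \<bullet> w) - f x \<bullet> w" by (subst (1) w_def) (simp add: inner_diff_left)
    ultimately show ?thesis by simp
  qed
  have "w \<bullet> w = 0"
  proof (rule ccontr)
    assume "w \<bullet> w \<noteq> 0"
    then have a: "w \<bullet> w > 0" by (simp add: less_le)
    define c where "c = m * (w \<bullet> w) - f w \<bullet> w"
    have c: "c \<ge> 0" using bound[OF wU] by (simp add: c_def)
    \<comment> \<open>The minimiser of the quadratic in \<open>quad\<close> would be - (w . w) / c;
      the extra 1 covers c = 0 and still gives a negative value.\<close>
    define t where "t = - (w \<bullet> w) / (c + 1)"
    have "t * (2 * (w \<bullet> w)) + t\<^sup>2 * c = (w \<bullet> w)\<^sup>2 / (c+1)\<^sup>2 * (c - 2 * (c + 1))"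
    proof -
      have "(c + 1) \<noteq> 0" using c by simp
      then have "t * (c + 1) = - (w \<bullet> w)" by (simp add: t_def)
      then have *: "w \<bullet> w = - t * (c + 1)" by simp
      show ?thesis unfolding * using \<open>c + 1 \<noteq> 0\<close> by (simp add: power_mult_distrib) (simp add: algebra_simps power2_eq_square)
    qed
    also have "\<dots> < 0" using a c by (intro mult_pos_neg) auto
    finally show False using quad[of t] by (simp add: c_def)
  qed
  then have "f x = m *\<^sub>R x" by (simp add: w_def)
  with that[of x m] xU nx bound show ?thesis by blast
qed

text \<open>Spectral theorem by splitting off a maximising eigenvector and passing to its orthogonal
  complement in \<open>U\<close>, which is invariant because \<open>f\<close> is self-adjoint;
  maximality makes the eigenvalues decrease. The form with an invariant subspace serves the
  induction and also the compression to a coordinate subspace below.\<close>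

lemma selfadjoint_eigenbasis:
  fixes f :: "'a::euclidean_space \<Rightarrow> 'a"
  assumes lin: "linear f" and sa: "\<And>x y. f x \<bullet> y = x \<bullet> f y"
    and "subspace U" "\<And>x. x \<in> U \<Longrightarrow> f x \<in> U" "dim U = d"
  shows "\<exists>b l. (\<forall>i<d. b i \<in> U \<and> f (b i) = l i *\<^sub>R b i) \<and>
           (\<forall>i<d. \<forall>j<d. b i \<bullet> b j = (if i = j then 1 else 0)) \<and>
           (\<forall>i j. i \<le> j \<longrightarrow> j < d \<longrightarrow> l j \<le> (l i :: real))"
  using assms(3-)
proof (induction d arbitrary: U)
  case 0
  then show ?case by auto
next
  case (Suc d)
  obtain x m where x: "x \<in> U" "norm x = 1" "f x = m *\<^sub>R x" and m: "\<And>y. y \<in> U \<Longrightarrow> f y \<bullet> y \<le> m * (y \<bullet> y)"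
    using selfadjoint_max_eigenvector[OF lin sa Suc.prems(1,2)] Suc.prems(3) by (metis nat.distinct(1))
  define V where "V = {y \<in> U. \<forall>z \<in> span {x}. orthogonal z y}"
  have V_iff: "y \<in> V \<longleftrightarrow> y \<in> U \<and> x \<bullet> y = 0" for y
    by (auto simp: V_def orthogonal_def span_singleton)
  have xU: "span {x} \<subseteq> U" using x Suc.prems(1) by (intro span_minimal) auto
  have "x \<noteq> 0" using x by auto
  have "dim V + dim (span {x}) = dim U"
    unfolding V_def by (rule dim_subspace_orthogonal_to_vectors) (use xU Suc.prems in auto)
  then have dV: "dim V = d" using Suc.prems(3) \<open>x \<noteq> 0\<close> by simp
  have sV: "subspace V"
    using Suc.prems(1) by (auto simp: subspace_def V_iff inner_simps)
  have iV: "f y \<in> V" if "y \<in> V" for y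
    using that Suc.prems(2) sa[of x y] x by (auto simp: V_iff)
  have "\<exists>b l. (\<forall>i<d. b i \<in> V \<and> f (b i) = l i *\<^sub>R b i) \<and>
           (\<forall>i<d. \<forall>j<d. b i \<bullet> b j = (if i = j then 1 else 0)) \<and>
           (\<forall>i j. i \<le> j \<longrightarrow> j < d \<longrightarrow> l j \<le> (l i :: real))"
    by (rule Suc.IH[OF sV _ dV]) (rule iV)
  then obtain b l where bl: "(\<forall>i<d. b i \<in> V \<and> f (b i) = l i *\<^sub>R b i) \<and>
           (\<forall>i<d. \<forall>j<d. b i \<bullet> b j = (if i = j then 1 else 0)) \<and>
           (\<forall>i j. i \<le> j \<longrightarrow> j < d \<longrightarrow> l j \<le> (l i :: real))" by (elim exE)
  then have b: "\<And>i. i < d \<Longrightarrow> b i \<in> V" "\<And>i. i < d \<Longrightarrow> f (b i) = l i *\<^sub>R b i"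
    and on: "\<And>i j. i < d \<Longrightarrow> j < d \<Longrightarrow> b i \<bullet> b j = (if i = j then 1 else 0)"
    and dec: "\<And>i j. i \<le> j \<Longrightarrow> j < d \<Longrightarrow> l j \<le> l i" by auto
  define b' where "b' = case_nat x b"
  define l' where "l' = case_nat m l"
  have lm: "l j \<le> m" if "j < d" for j
    using m[of "b j"] b[OF that] on[OF that that] by (auto simp: V_iff)
  have "b' i \<in> U \<and> f (b' i) = l' i *\<^sub>R b' i" if "i < Suc d" for i
    using that x b by (cases i) (auto simp: b'_def l'_def V_iff)
  moreover have "b' i \<bullet> b' j = (if i = j then 1 else 0)" if "i < Suc d" "j < Suc d" for i j
    using that x b on by (cases i; cases j) (auto simp: b'_def V_iff dot_square_norm inner_commute)
  moreover have "l' j \<le> l' i" if "i \<le> j" "j < Suc d" for i j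
    using that lm dec by (cases i; cases j) (auto simp: l'_def)
  ultimately show ?case by blast
qed

text \<open>The dimension count forces a nonzero common vector of \<open>V\<close> and
  \<open>V'\<close>, where the two bounds meet. Cauchy interlacing and Weyl's inequality both arise
  from a choice of the two subspaces.\<close>

lemma courant_fischer_le:
  fixes V V' :: "'a::euclidean_space set"
  assumes "subspace V" "subspace V'" "DIM('a) < dim V + dim V'"
    and lo: "\<And>x. x \<in> V \<Longrightarrow> \<alpha> * (x \<bullet> x) \<le> q x" and hi: "\<And>x. x \<in> V' \<Longrightarrow> q x \<le> \<beta> * (x \<bullet> x)"
  shows "\<alpha> \<le> \<beta>"
proof -
  have "dim {x + y |x y. x \<in> V \<and> y \<in> V'} \<le> DIM('a)" by (rule dim_subset_UNIV)
  then have "dim (V \<inter> V') \<noteq> 0" using dim_sums_Int[OF assms(1,2)] assms(3) by linarith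
  then obtain x where x: "x \<in> V" "x \<in> V'" "x \<noteq> 0" using dim_eq_0[of "V \<inter> V'"] by auto
  have "\<alpha> * (x \<bullet> x) \<le> \<beta> * (x \<bullet> x)" using lo[OF x(1)] hi[OF x(2)] by simp
  with x(3) show ?thesis by simp
qed

lemma orthonormal_span:
  fixes b :: "'i \<Rightarrow> 'a::euclidean_space"
  assumes "finite I" and on: "\<And>i j. i \<in> I \<Longrightarrow> j \<in> I \<Longrightarrow> b i \<bullet> b j = (if i = j then 1 else 0)"
  shows "dim (span (b ` I)) = card I"
    and "x \<in> span (b ` I) \<Longrightarrow> \<exists>c. x = (\<Sum>i\<in>I. c i *\<^sub>R b i)"
proof -
  have inj: "inj_on b I" using on by (metis inj_onI zero_neq_one)
  have "0 \<notin> b ` I" using on by fastforce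
  moreover have "pairwise orthogonal (b ` I)" using on by (auto simp: pairwise_def orthogonal_def)
  ultimately have "independent (b ` I)" by (intro pairwise_orthogonal_independent)
  then show "dim (span (b ` I)) = card I"
    using inj by (simp add: dim_eq_card_independent card_image)
  show "\<exists>c. x = (\<Sum>i\<in>I. c i *\<^sub>R b i)" if "x \<in> span (b ` I)"
  proof -
    from that assms(1) obtain u where "x = (\<Sum>v\<in>b ` I. u v *\<^sub>R v)"
      by (auto simp: span_finite)
    then have "x = (\<Sum>i\<in>I. u (b i) *\<^sub>R b i)" using inj by (simp add: sum.reindex)
    then show ?thesis by (rule exI[of _ "\<lambda>i. u (b i)"])
  qed
qed

lemma orthonormal_quadratic:
  fixes b :: "'i \<Rightarrow> 'a::euclidean_space"
  assumes "finite I" and on: "\<And>i j. i \<in> I \<Longrightarrow> j \<in> I \<Longrightarrow> b i \<bullet> b j = (if i = j then 1 else 0)"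
  shows "(\<Sum>i\<in>I. (l i * c i) *\<^sub>R b i) \<bullet> (\<Sum>i\<in>I. c i *\<^sub>R b i) = (\<Sum>i\<in>I. l i * (c i)\<^sup>2)"
proof -
  have "(\<Sum>i\<in>I. (l i * c i) *\<^sub>R b i) \<bullet> (\<Sum>i\<in>I. c i *\<^sub>R b i) = (\<Sum>i\<in>I. \<Sum>j\<in>I. l j * c j * (c i * (if j = i then 1 else 0)))"
    by (simp add: inner_sum_left inner_sum_right on mult_ac sum_distrib_left)
  also have "\<dots> = (\<Sum>i\<in>I. l i * (c i)\<^sup>2)"
    using assms(1) by (simp add: power2_eq_square if_distrib mult.assoc cong: if_cong)
  finally show ?thesis .
qed

text \<open>In the coordinates \<open>c\<close> the form is the sum of the squared coordinates
  weighted by the eigenvalues, so the extreme eigenvalues on the span control it.\<close>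

lemma eigen_span_bounds:
  fixes b :: "'i \<Rightarrow> 'a::euclidean_space"
  assumes "linear f" "finite I" and on: "\<And>i j. i \<in> I \<Longrightarrow> j \<in> I \<Longrightarrow> b i \<bullet> b j = (if i = j then 1 else 0)"
    and ev: "\<And>i. i \<in> I \<Longrightarrow> f (b i) = l i *\<^sub>R b i" and x: "x \<in> span (b ` I)"
  shows "(\<And>i. i \<in> I \<Longrightarrow> \<alpha> \<le> l i) \<Longrightarrow> \<alpha> * (x \<bullet> x) \<le> f x \<bullet> x"
    and "(\<And>i. i \<in> I \<Longrightarrow> l i \<le> \<beta>) \<Longrightarrow> f x \<bullet> x \<le> \<beta> * (x \<bullet> x)"
proof -
  interpret f: linear f by fact
  obtain c where c: "x = (\<Sum>i\<in>I. c i *\<^sub>R b i)" using orthonormal_span(2)[OF assms(2) on x] by auto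
  have "f x = (\<Sum>i\<in>I. (l i * c i) *\<^sub>R b i)"
    unfolding c by (simp add: f.sum f.scaleR ev mult.commute)
  with c have 1: "f x \<bullet> x = (\<Sum>i\<in>I. l i * (c i)\<^sup>2)" using orthonormal_quadratic[OF assms(2) on, of l c] by simp
  have 2: "x \<bullet> x = (\<Sum>i\<in>I. (c i)\<^sup>2)" using orthonormal_quadratic[OF assms(2) on, of "\<lambda>_. 1" c] c by simp
  show "(\<And>i. i \<in> I \<Longrightarrow> \<alpha> \<le> l i) \<Longrightarrow> \<alpha> * (x \<bullet> x) \<le> f x \<bullet> x"
    unfolding 1 2 sum_distrib_left by (intro sum_mono mult_right_mono) auto
  show "(\<And>i. i \<in> I \<Longrightarrow> l i \<le> \<beta>) \<Longrightarrow> f x \<bullet> x \<le> \<beta> * (x \<bullet> x)"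
    unfolding 1 2 sum_distrib_left by (intro sum_mono mult_right_mono) auto
qed

section \<open>Positions in the index type, counted from 0\<close>

definition idx :: "'n::{finite,wellorder} \<Rightarrow> nat" where
  "idx i = card {j. j < i}"

lemma first_indices_idx: "first_indices m = {i. idx i < m}"
  by (simp add: first_indices_def idx_def)

lemma idx_less: "i < j \<Longrightarrow> idx i < idx (j :: 'n::{finite,wellorder})"
  unfolding idx_def by (rule psubset_card_mono) auto

lemma idx_le_iff: "idx i \<le> idx j \<longleftrightarrow> i \<le> (j :: 'n::{finite,wellorder})"
  using idx_less by (metis linorder_not_less nle_le order_le_less)

lemma bij_betw_idx: "bij_betw idx (UNIV :: 'n::{finite,wellorder} set) {..<CARD('n)}"
proof -
  have inj: "inj (idx :: 'n \<Rightarrow> nat)"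
    by (rule injI) (metis idx_le_iff order_antisym order_refl)
  have "idx ` (UNIV :: 'n set) \<subseteq> {..<CARD('n)}"
    unfolding idx_def by (auto intro!: psubset_card_mono)
  then have "idx ` (UNIV :: 'n set) = {..<CARD('n)}"
    using inj by (intro card_subset_eq) (auto simp: card_image)
  with inj show ?thesis by (simp add: bij_betw_def)
qed

lemma idx_less_card [simp]: "idx (i :: 'n::{finite,wellorder}) < CARD('n)"
  using bij_betw_idx[where ?'n = 'n] by (auto simp: bij_betw_def)

lemma idx_eq_iff [simp]: "idx i = idx j \<longleftrightarrow> i = (j :: 'n::{finite,wellorder})"
  by (metis idx_le_iff order_antisym order_refl)

lemma bij_betw_idx_less: "m \<le> CARD('n) \<Longrightarrow> bij_betw idx {i :: 'n::{finite,wellorder}. idx i < m} {..<m}"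
  unfolding bij_betw_def
proof
  assume m: "m \<le> CARD('n)"
  show "inj_on idx {i :: 'n. idx i < m}" by (auto simp: inj_on_def)
  show "idx ` {i :: 'n. idx i < m} = {..<m}"
  proof (intro equalityI subsetI)
    fix k assume "k \<in> {..<m}"
    then have "k \<in> idx ` (UNIV :: 'n set)"
      using m bij_betw_idx[where ?'n = 'n] by (simp add: bij_betw_def)
    then show "k \<in> idx ` {i :: 'n. idx i < m}" using \<open>k \<in> {..<m}\<close> by auto
  qed auto
qed

lemma card_idx_less: "m \<le> CARD('n) \<Longrightarrow> card {i :: 'n::{finite,wellorder}. idx i < m} = m"
  using bij_betw_same_card[OF bij_betw_idx_less] by auto

text \<open>As a rewrite rule this would turn \<open>transpose W *v x\<close>, the shape in which
  the rotation is written throughout, into \<open>x v* W\<close>.\<close>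

declare transpose_matrix_vector [simp del]

section \<open>Orthonormal bases as orthogonal matrices\<close>

abbreviation orthonormal :: "('n \<Rightarrow> real ^ 'n) \<Rightarrow> bool" where
  "orthonormal q \<equiv> \<forall>i j. q i \<bullet> q j = (if i = j then 1 else 0)"

definition matrix_of_columns :: "('n \<Rightarrow> real ^ 'n) \<Rightarrow> real ^ 'n ^ 'n" where
  "matrix_of_columns q = (\<chi> r i. q i $ r)"

lemma column_matrix_of_columns [simp]: "column i (matrix_of_columns q) = q i"
  by (simp add: column_def matrix_of_columns_def vec_eq_iff)

lemma orthogonal_matrix_of_columns:
  "orthonormal q \<Longrightarrow> orthogonal_matrix (matrix_of_columns q)"
  unfolding orthogonal_matrix_orthonormal_columns
  by (auto simp: orthogonal_def norm_eq_1)

lemma orthonormal_columns: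
  "orthogonal_matrix W \<Longrightarrow> orthonormal (\<lambda>i. column i W)"
  unfolding orthogonal_matrix_orthonormal_columns
  by (auto simp: orthogonal_def norm_eq_1)

lemma transpose_matrix_of_columns_mult: "(transpose (matrix_of_columns q) *v x) $ i = q i \<bullet> x"
  by (simp add: matrix_of_columns_def transpose_def matrix_vector_mult_def inner_vec_def mult.commute)

lemma transpose_mult_nth: "(transpose W *v x) $ i = column i W \<bullet> (x :: real ^ 'n)"
  by (simp add: column_def transpose_def matrix_vector_mult_def inner_vec_def mult.commute)

lemma matrix_of_columns_mult: "matrix_of_columns q *v x = (\<Sum>i\<in>UNIV. x $ i *\<^sub>R q i)"
  by (simp add: matrix_of_columns_def matrix_vector_mult_def vec_eq_iff mult.commute)

lemma orthonormal_expansion: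
  assumes "orthonormal q"
  shows "(\<Sum>i\<in>UNIV. (q i \<bullet> x) *\<^sub>R q i) = x"
proof -
  have "matrix_of_columns q ** transpose (matrix_of_columns q) = mat 1"
    using orthogonal_matrix_of_columns[OF assms] by (simp add: orthogonal_matrix_def)
  then have "matrix_of_columns q *v (transpose (matrix_of_columns q) *v x) = x"
    by (simp add: matrix_vector_mul_assoc)
  then show ?thesis by (simp add: matrix_of_columns_mult transpose_matrix_of_columns_mult)
qed

lemma orthonormal_parseval:
  assumes "orthonormal q"
  shows "x \<bullet> y = (\<Sum>i\<in>UNIV. (q i \<bullet> x) * (q i \<bullet> y))"
  by (subst (1) orthonormal_expansion[OF assms, of x, symmetric]) (simp add: inner_sum_left)

lemma symmetric_matrix_inner:
  fixes C :: "real ^ 'n ^ 'n"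
  assumes "transpose C = C"
  shows "(C *v x) \<bullet> y = x \<bullet> (C *v y)"
  by (metis assms dot_lmul_matrix vector_transpose_matrix)

section \<open>Determinants and the numbering of eigenvalues\<close>

lemma matrix_eq_orthonormal:
  assumes on: "orthonormal q" and eq: "\<And>i. A *v q i = B *v q i"
  shows "A = (B :: real ^ 'n ^ 'n)"
proof -
  have "A *v x = B *v x" for x
  proof -
    have "A *v (\<Sum>i\<in>UNIV. (q i \<bullet> x) *\<^sub>R q i) = B *v (\<Sum>i\<in>UNIV. (q i \<bullet> x) *\<^sub>R q i)"
      by (simp add: eq linear_sum[OF matrix_vector_mul_linear] linear_scale[OF matrix_vector_mul_linear])
    then show ?thesis by (simp add: orthonormal_expansion[OF on])
  qed
  then show ?thesis by (simp add: matrix_eq)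
qed

lemma det_eigenbasis:
  fixes C :: "real ^ 'n ^ 'n"
  assumes on: "orthonormal q" and ev: "\<And>i. C *v q i = l i *\<^sub>R q i"
  shows "det C = (\<Prod>i\<in>UNIV. l i)"
proof -
  let ?Q = "matrix_of_columns q" and ?D = "(\<chi> i j. if i = j then l i else 0) :: real ^ 'n ^ 'n"
  have o: "orthogonal_matrix ?Q" using on by (rule orthogonal_matrix_of_columns)
  have "C = ?Q ** ?D ** transpose ?Q"
  proof (rule matrix_eq_orthonormal[OF on])
    fix i
    have 1: "transpose ?Q *v q i = axis i 1"
      using on by (simp add: vec_eq_iff transpose_matrix_of_columns_mult axis_def)
    have 2: "?D *v axis i 1 = axis i (l i)"
      by (simp only: matrix_vector_mult_basis) (simp add: column_def axis_def vec_eq_iff)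
    have 3: "?Q *v axis i (l i) = l i *\<^sub>R q i"
      by (simp add: matrix_of_columns_mult axis_def if_distrib[of "\<lambda>x. x *\<^sub>R _"] cong: if_cong)
    show "C *v q i = (?Q ** ?D ** transpose ?Q) *v q i"
      by (simp add: matrix_vector_mul_assoc[symmetric] 1 2 3 ev)
  qed
  moreover have "det ?Q * det (transpose ?Q) = 1"
    using o by (metis det_I det_mul orthogonal_matrix_def)
  ultimately have "det C = det ?D"
    by (simp add: det_mul mult.commute mult.left_commute)
  also have "\<dots> = (\<Prod>i\<in>UNIV. l i)"
    by (subst det_diagonal) auto
  finally show ?thesis .
qed

text \<open>The largest number of each list is a root of the other product, so the heads agree;
  cancelling that linear factor leaves the tails.\<close>

lemma antimono_roots_unique:
  fixes l m :: "nat \<Rightarrow> real"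
  assumes "(\<Prod>k<n. [:- l k, 1:]) = (\<Prod>k<n. [:- m k, 1:])"
    and "\<And>i j. i \<le> j \<Longrightarrow> j < n \<Longrightarrow> l j \<le> l i" "\<And>i j. i \<le> j \<Longrightarrow> j < n \<Longrightarrow> m j \<le> m i"
    and "k < n"
  shows "l k = m k"
  using assms
proof (induction n arbitrary: l m k)
  case (Suc n)
  have root: "\<exists>j<Suc n. l 0 = m j" if e: "(\<Prod>k<Suc n. [:- l k, 1:]) = (\<Prod>k<Suc n. [:- m k, 1:])" for l m :: "nat \<Rightarrow> real"
  proof -
    have "poly (\<Prod>k<Suc n. [:- l k, 1:]) (l 0) = 0" by (simp add: poly_prod del: prod.lessThan_Suc) (rule bexI[of _ 0], auto)
    then have "poly (\<Prod>k<Suc n. [:- m k, 1:]) (l 0) = 0" by (simp only: e)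
    then show ?thesis by (auto simp: poly_prod simp del: prod.lessThan_Suc)
  qed
  have "l 0 \<le> m 0" using root[OF Suc.prems(1)] Suc.prems(3) by force
  moreover have "m 0 \<le> l 0" using root[OF Suc.prems(1)[symmetric]] Suc.prems(2) by force
  ultimately have 0: "l 0 = m 0" by simp
  have "[:- l 0, 1:] * (\<Prod>k<n. [:- l (Suc k), 1:]) = [:- l 0, 1:] * (\<Prod>k<n. [:- m (Suc k), 1:])"
    using Suc.prems(1) 0 by (simp only: prod.lessThan_Suc_shift)
  then have eq: "(\<Prod>k<n. [:- l (Suc k), 1:]) = (\<Prod>k<n. [:- m (Suc k), 1:])"
    by (simp del: mult_pCons_left mult_pCons_right)
  show ?case
  proof (cases k)
    case 0 with \<open>l 0 = m 0\<close> show ?thesis by simp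
  next
    case (Suc k')
    have "l (Suc k') = m (Suc k')"
      by (rule Suc.IH[OF eq]) (use Suc Suc.prems in auto)
    with Suc show ?thesis by simp
  qed
qed simp

text \<open>\<open>eigenvalues_decreasing\<close> fixes the numbers \<mu> only through the
  characteristic polynomial. Evaluating that determinant in an eigenbasis identifies the decreasing
  eigenvalues of the basis with the list \<mu>. Positions start at 0 and the numbering of \<mu> at
  1, hence \<open>Suc (idx i)\<close>.\<close>

lemma symmetric_eigenbasis:
  fixes C :: "real ^ 'n::{finite,wellorder} ^ 'n::_"
  assumes sym: "transpose C = C" and ev: "eigenvalues_decreasing C \<mu>"
  obtains q where "orthonormal q" "\<And>i. C *v q i = \<mu> (Suc (idx i)) *\<^sub>R q i"
proof -
  have "\<exists>b l. (\<forall>i<CARD('n). b i \<in> UNIV \<and> C *v b i = l i *\<^sub>R b i) \<and>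
           (\<forall>i<CARD('n). \<forall>j<CARD('n). b i \<bullet> b j = (if i = j then 1 else 0)) \<and>
           (\<forall>i j. i \<le> j \<longrightarrow> j < CARD('n) \<longrightarrow> l j \<le> (l i :: real))"
    by (rule selfadjoint_eigenbasis) (auto simp: symmetric_matrix_inner[OF sym])
  then obtain b l where bl: "(\<forall>i<CARD('n). b i \<in> UNIV \<and> C *v b i = l i *\<^sub>R b i) \<and>
           (\<forall>i<CARD('n). \<forall>j<CARD('n). b i \<bullet> b j = (if i = j then 1 else 0)) \<and>
           (\<forall>i j. i \<le> j \<longrightarrow> j < CARD('n) \<longrightarrow> l j \<le> (l i :: real))" by (elim exE)
  define q where "q i = b (idx i)" for i :: 'n
  have on: "orthonormal q" using bl by (auto simp: q_def)
  have q: "C *v q i = l (idx i) *\<^sub>R q i" for i using bl by (simp add: q_def)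
  have "poly (\<Prod>k<CARD('n). [:- l k, 1:]) x = poly (\<Prod>k<CARD('n). [:- \<mu> (Suc k), 1:]) x" for x
  proof -
    have "det (x *\<^sub>R mat 1 - C) = (\<Prod>i\<in>UNIV. x - l (idx (i::'n)))"
      by (rule det_eigenbasis[OF on])
        (simp add: matrix_vector_mult_diff_rdistrib q scaleR_diff_left scaleR_matrix_vector_assoc[symmetric])
    also have "\<dots> = (\<Prod>k<CARD('n). x - l k)"
      by (rule prod.reindex_bij_betw[OF bij_betw_idx])
    finally have "(\<Prod>k<CARD('n). x - l k) = (\<Prod>i = 1..CARD('n). x - \<mu> i)"
      using ev by (simp add: eigenvalues_decreasing_def)
    also have "\<dots> = (\<Prod>k<CARD('n). x - \<mu> (Suc k))"
      by (simp add: prod.atLeast1_atMost_eq)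
    finally show ?thesis by (simp add: poly_prod)
  qed
  then have "(\<Prod>k<CARD('n). [:- l k, 1:]) = (\<Prod>k<CARD('n). [:- \<mu> (Suc k), 1:])"
    by (intro poly_eq_poly_eq_iff[THEN iffD1] ext)
  then have "l k = \<mu> (Suc k)" if "k < CARD('n)" for k
    by (rule antimono_roots_unique) (use bl ev that in \<open>auto simp: eigenvalues_decreasing_def\<close>)
  with on q that[of q] show ?thesis by simp
qed

text \<open>The upper half of Cauchy interlacing. The first \<open>M\<close> vectors diagonalise the
  compression of \<open>C\<close> to the first \<open>M\<close> coordinates; its leading
  eigenvectors are played off against the trailing eigenvectors of \<open>C\<close>. The other
  vectors are coordinate axes, so that a product density in the directions \<open>b\<close> factors
  over the split into first and last coordinates.\<close>

lemma compression_eigenbasis: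
  fixes C :: "real ^ 'n::{finite,wellorder} ^ 'n::_"
  assumes sym: "transpose C = C" and on: "orthonormal q"
    and q: "\<And>i. C *v q i = \<mu> (Suc (idx i)) *\<^sub>R q i"
    and dec: "\<And>i j. i \<le> j \<Longrightarrow> j < CARD('n) \<Longrightarrow> \<mu> (Suc j) \<le> \<mu> (Suc i)"
    and M: "M \<le> CARD('n)"
  obtains b where "orthonormal b" "\<And>i. \<not> idx i < M \<Longrightarrow> b i = axis i 1"
    "\<And>i j. idx i < M \<Longrightarrow> \<not> idx j < M \<Longrightarrow> b i $ j = 0"
    "\<And>i. idx i < M \<Longrightarrow> (C *v b i) \<bullet> b i \<le> \<mu> (Suc (idx i))"
proof -
  define F where "F = {i :: 'n. idx i < M}"
  define pr :: "real ^ 'n::_ \<Rightarrow> real ^ 'n::_" where "pr x = (\<chi> i. if i \<in> F then x $ i else 0)" for x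
  define U where "U = {x :: real ^ 'n::_. \<forall>i. i \<notin> F \<longrightarrow> x $ i = 0}"
  have pr_inner: "pr x \<bullet> y = x \<bullet> y" if "y \<in> U" for x y
    using that by (auto simp: pr_def U_def inner_vec_def intro!: sum.cong)
  have pr_inner': "pr x \<bullet> y = x \<bullet> pr y" for x y
    by (auto simp: pr_def inner_vec_def intro!: sum.cong)
  have prU: "pr x \<in> U" for x by (simp add: pr_def U_def)
  have prU_id: "x \<in> U \<Longrightarrow> pr x = x" for x by (auto simp: pr_def U_def vec_eq_iff)
  have lpr: "linear pr" by (rule linearI) (auto simp: pr_def vec_eq_iff)
  \<comment> \<open>Projecting on both sides makes the compression self-adjoint on the whole space,
    as the spectral theorem requires, while it still preserves \<open>U\<close>.\<close>
  define f where "f x = pr (C *v pr x)" for x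
  have lf: "linear f"
    unfolding f_def[abs_def] using linear_compose[OF linear_compose[OF lpr matrix_vector_mul_linear[of C]] lpr]
    by (simp add: comp_def)
  have sU: "subspace U" by (auto simp: subspace_def U_def)
  have dU: "dim U = M"
  proof -
    have "U = span ((\<lambda>i. axis i (1::real) :: real ^ 'n::_) ` F)"
    proof
      show "U \<subseteq> span ((\<lambda>i. axis i 1 :: real ^ 'n::_) ` F)"
      proof
        fix x assume x: "x \<in> U"
        have "x = (\<Sum>i\<in>F. x $ i *\<^sub>R axis i 1)"
          using x by (auto simp: vec_eq_iff U_def axis_def if_distrib sum.delta cong: if_cong)
        also have "\<dots> \<in> span ((\<lambda>i. axis i 1 :: real ^ 'n::_) ` F)"
          by (intro span_sum span_scale span_base) auto
        finally show "x \<in> span ((\<lambda>i. axis i 1 :: real ^ 'n::_) ` F)" .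
      qed
      show "span ((\<lambda>i. axis i 1 :: real ^ 'n::_) ` F) \<subseteq> U"
        by (rule span_minimal[OF _ sU]) (auto simp: U_def axis_def)
    qed
    moreover have "dim (span ((\<lambda>i. axis i (1::real) :: real ^ 'n::_) ` F)) = card F"
      by (rule orthonormal_span) (auto simp: inner_axis_axis)
    ultimately show ?thesis using card_idx_less[OF M] by (simp add: F_def)
  qed
  have "\<exists>b l. (\<forall>i<M. b i \<in> U \<and> f (b i) = l i *\<^sub>R b i) \<and>
           (\<forall>i<M. \<forall>j<M. b i \<bullet> b j = (if i = j then 1 else 0)) \<and>
           (\<forall>i j. i \<le> j \<longrightarrow> j < M \<longrightarrow> l j \<le> (l i :: real))"
  proof (rule selfadjoint_eigenbasis[OF lf _ sU _ dU])
    show "f x \<bullet> y = x \<bullet> f y" for x y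
      by (simp add: f_def pr_inner' symmetric_matrix_inner[OF sym])
  qed (simp add: f_def prU)
  then obtain c l where cl: "(\<forall>i<M. c i \<in> U \<and> f (c i) = l i *\<^sub>R c i) \<and>
           (\<forall>i<M. \<forall>j<M. c i \<bullet> c j = (if i = j then 1 else 0)) \<and>
           (\<forall>i j. i \<le> j \<longrightarrow> j < M \<longrightarrow> l j \<le> (l i :: real))" by (elim exE)
  have quad: "f x \<bullet> x = (C *v x) \<bullet> x" if "x \<in> U" for x
    using that by (simp add: f_def pr_inner prU_id)
  define b where "b i = (if i \<in> F then c (idx i) else axis i 1)" for i
  have bU: "b i \<in> U" if "i \<in> F" for i using that cl by (simp add: b_def F_def)
  have onb: "orthonormal b"
  proof (intro allI)
    fix i j
    show "b i \<bullet> b j = (if i = j then 1 else 0)"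
      using cl bU[of i] bU[of j]
      by (auto simp: b_def F_def inner_axis_axis inner_axis inner_axis' U_def) (auto simp: axis_def)
  qed
  have le: "l k \<le> \<mu> (Suc k)" if k: "k < M" for k
  proof (rule courant_fischer_le[where q = "\<lambda>x. (C *v x) \<bullet> x"])
    define V where "V = span (c ` {..k})"
    define V' where "V' = span (q ` {i. k \<le> idx i})"
    show "subspace V" "subspace V'" by (simp_all add: V_def V'_def)
    have onc: "\<And>i j. i \<in> {..k} \<Longrightarrow> j \<in> {..k} \<Longrightarrow> c i \<bullet> c j = (if i = j then 1 else 0)" using cl k by auto
    have "dim V = Suc k" unfolding V_def by (subst orthonormal_span(1)) (use onc in auto)
    moreover have "dim V' = CARD('n) - k"
    proof -
      have "dim V' = card {i::'n. k \<le> idx i}" unfolding V'_def by (rule orthonormal_span(1)) (use on in auto)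
      also have "{i::'n. k \<le> idx i} = UNIV - {i. idx i < k}" by auto
      also have "card \<dots> = CARD('n) - k" using card_idx_less[where ?'n = 'n, of k] k M by (subst card_Diff_subset) auto
      finally show ?thesis .
    qed
    \<comment> \<open>k + 1 directions from the compression against N - k from \<open>C\<close>: one
      more than N in total.\<close>
    ultimately show "DIM(real ^ 'n::_) < dim V + dim V'" using k M by simp
    have "V \<subseteq> U" unfolding V_def using cl k by (intro span_minimal[OF _ sU]) auto
    show "l k * (x \<bullet> x) \<le> (C *v x) \<bullet> x" if x: "x \<in> V" for x
    proof -
      have "l k * (x \<bullet> x) \<le> f x \<bullet> x"
        by (rule eigen_span_bounds(1)[OF lf _ onc, where l = l]) (use cl k x in \<open>auto simp: V_def\<close>)
      then show ?thesis using quad x \<open>V \<subseteq> U\<close> by auto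
    qed
    show "(C *v x) \<bullet> x \<le> \<mu> (Suc k) * (x \<bullet> x)" if x: "x \<in> V'" for x
      by (rule eigen_span_bounds(2)[OF matrix_vector_mul_linear _ _ q, where I = "{i. k \<le> idx i}"]) (use x on dec in \<open>auto simp: V'_def\<close>)
  qed
  show ?thesis
  proof (rule that[of b])
    fix i :: 'n assume i: "idx i < M"
    then have "(C *v b i) \<bullet> b i = f (b i) \<bullet> b i" using bU[of i] by (simp add: quad F_def)
    also have "\<dots> = l (idx i)" using cl i by (simp add: b_def F_def)
    finally show "(C *v b i) \<bullet> b i \<le> \<mu> (Suc (idx i))" using le[OF i] by simp
    show "b i $ j = 0" if "\<not> idx j < M" for j using bU[of i] that i by (auto simp: F_def U_def)
  qed (use onb in \<open>auto simp: b_def F_def\<close>)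
qed

text \<open>For a symmetric matrix the kernel is the orthogonal complement of the range.\<close>

lemma dim_kernel_symmetric:
  fixes C :: "real ^ 'n ^ 'n"
  assumes "transpose C = C"
  shows "dim {x. C *v x = 0} + rank C = CARD('n)"
proof -
  have "{y \<in> UNIV. \<forall>x\<in>range ((*v) C). orthogonal x y} = {x. C *v x = 0}"
    by (auto simp: orthogonal_def symmetric_matrix_inner[OF assms]) (metis inner_eq_zero_iff)
  moreover have "subspace (range ((*v) C))"
    using linear_subspace_image[OF matrix_vector_mul_linear subspace_UNIV, of C] by simp
  ultimately show ?thesis
    using dim_subspace_orthogonal_to_vectors[of "range ((*v) C)" UNIV] by (simp add: rank_dim_range)
qed

text \<open>On the kernel of \<open>A\<close>, of dimension at least N - M, the sum acts as
  \<open>B\<close>. The eigenvectors up to position \<open>idx i\<close> span a space of dimension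
  \<open>idx i\<close> + 1 > M, which must meet that kernel.\<close>

lemma weyl_low_rank:
  fixes A B :: "real ^ 'n::{finite,wellorder} ^ 'n::_"
  assumes symA: "transpose A = A" and rA: "rank A \<le> M"
    and on: "orthonormal w" and w: "\<And>i. (A + B) *v w i = l i *\<^sub>R w i" and "antimono l"
    and hi: "\<And>x. (B *v x) \<bullet> x \<le> \<beta> * (x \<bullet> x)" and i: "M \<le> idx i"
  shows "l i \<le> \<beta>"
proof (rule courant_fischer_le[where q = "\<lambda>x. ((A + B) *v x) \<bullet> x"])
  define V where "V = span (w ` {j. j \<le> i})"
  show "subspace V" "subspace {x. A *v x = 0}"
    by (simp_all add: V_def) (auto simp: subspace_def matrix_vector_right_distrib matrix_vector_mult_scaleR)
  have "dim V = card {j. j \<le> i}" unfolding V_def by (rule orthonormal_span(1)) (use on in auto)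
  also have "{j. j \<le> i} = insert i {j. j < i}" by auto
  finally have "dim V = Suc (idx i)" by (simp add: idx_def)
  then show "DIM(real ^ 'n::_) < dim V + dim {x. A *v x = 0}"
    using dim_kernel_symmetric[OF symA] rA i by simp
  show "l i * (x \<bullet> x) \<le> ((A + B) *v x) \<bullet> x" if x: "x \<in> V" for x
    by (rule eigen_span_bounds(1)[OF matrix_vector_mul_linear _ _ w, where I = "{j. j \<le> i}"])
      (use x on \<open>antimono l\<close> in \<open>auto simp: V_def antimono_def\<close>)
  show "((A + B) *v x) \<bullet> x \<le> \<beta> * (x \<bullet> x)" if "x \<in> {x. A *v x = 0}" for x
    using that hi[of x] by (simp add: matrix_vector_mult_add_rdistrib)
qed

section \<open>Coordinate splitting of Lebesgue measure\<close>

lemma sigma_finite_subvector_lborel: "finite I \<Longrightarrow> sigma_finite_measure (subvector_lborel I)"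
proof -
  interpret product_sigma_finite "\<lambda>_. lborel :: real measure" by standard
  show "finite I \<Longrightarrow> sigma_finite_measure (subvector_lborel I)" by (rule sigma_finite)
qed

lemma measurable_vec_lambda_PiM [measurable]:
  "(\<lambda>f. \<chi> i. f i) \<in> borel_measurable (Pi\<^sub>M (UNIV :: 'n::finite set) (\<lambda>_. lborel :: real measure))"
  by (rule borel_measurable_euclidean_space[THEN iffD2])
    (auto simp: Basis_vec_def inner_axis intro!: measurable_component_singleton[THEN measurable_compose])

lemma prod_Basis_vec:
  "(\<Prod>b\<in>Basis. g b) = (\<Prod>i\<in>(UNIV :: 'n::finite set). g (axis i (1::real)))"
  by (rule prod.reindex_cong[of "\<lambda>i. axis i 1"]) (auto simp: inj_on_def axis_eq_axis Basis_vec_def)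

text \<open>Links the reference measure for densities of vectors to the product measures on which
  subvectors live; boxes determine both.\<close>

lemma lborel_vec_eq_PiM:
  "distr (Pi\<^sub>M UNIV (\<lambda>_. lborel)) borel (\<lambda>f. \<chi> i. f i) = (lborel :: (real ^ 'n::finite) measure)"
proof (rule lborel_eqI[symmetric])
  interpret product_sigma_finite "\<lambda>_::'n. lborel :: real measure" by standard
  fix l u :: "real ^ 'n" assume le: "\<And>b. b \<in> Basis \<Longrightarrow> l \<bullet> b \<le> u \<bullet> b"
  have le': "l $ i \<le> u $ i" for i using le[of "axis i 1"] by (simp add: inner_axis)
  have "emeasure (distr (Pi\<^sub>M UNIV (\<lambda>_. lborel)) borel (\<lambda>f. \<chi> i. f i)) (box l u) =
      emeasure (Pi\<^sub>M UNIV (\<lambda>_. lborel)) (\<Pi>\<^sub>E i\<in>UNIV. {l $ i <..< u $ i})"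
    by (subst emeasure_distr) (auto intro!: arg_cong[where f = "emeasure _"] simp: mem_box_cart space_PiM PiE_iff)
  also have "\<dots> = (\<Prod>i\<in>UNIV. ennreal (u $ i - l $ i))"
    by (subst emeasure_PiM) (auto simp: le')
  also have "\<dots> = ennreal (\<Prod>i\<in>UNIV. u $ i - l $ i)"
    by (rule prod_ennreal) (simp add: le')
  also have "\<dots> = (\<Prod>b\<in>Basis. (u - l) \<bullet> b)"
    by (simp add: prod_Basis_vec inner_axis)
  finally show "emeasure (distr (Pi\<^sub>M UNIV (\<lambda>_. lborel)) borel (\<lambda>f. \<chi> i. f i)) (box l u) = ennreal (\<Prod>b\<in>Basis. (u - l) \<bullet> b)" .
qed simp

lemma borel_measurable_matrix_vector_mult [measurable (raw)]:
  fixes A :: "real ^ 'n ^ 'm"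
  shows "f \<in> borel_measurable M \<Longrightarrow> (\<lambda>x. A *v f x) \<in> borel_measurable M"
  by (rule measurable_compose[OF _ borel_measurable_continuous_onI])
    (auto intro!: linear_continuous_on simp: linear_linear)

lemma lborel_distr_orthogonal:
  fixes W :: "real ^ 'n::{finite,wellorder} ^ 'n::_"
  assumes W: "orthogonal_matrix W"
  shows "distr lborel borel ((*v) W) = lborel"
proof (rule lborel_eqI[symmetric])
  fix l u :: "real ^ 'n::_" assume le: "\<And>b. b \<in> Basis \<Longrightarrow> l \<bullet> b \<le> u \<bullet> b"
  have inv: "transpose W *v (W *v x) = x" "W *v (transpose W *v x) = x" for x
    using W by (simp_all add: orthogonal_matrix_def matrix_vector_mul_assoc)
  have eq: "(*v) W -` box l u = (*v) (transpose W) ` box l u"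
    by (auto simp: inv image_iff) (metis inv(1))
  have o: "orthogonal_transformation ((*v) (transpose W))"
    using W by (simp add: orthogonal_transformation_matrix orthogonal_matrix_transpose)
  have s: "(*v) W -` box l u \<in> sets borel"
    using measurable_sets[OF borel_measurable_matrix_vector_mult[OF measurable_ident, of W], of "box l u"] by simp
  have b: "box l u \<in> lmeasurable" by simp
  have "(*v) W -` box l u \<in> lmeasurable"
    unfolding eq by (rule measurable_orthogonal_image[OF o b])
  then have "emeasure lebesgue ((*v) W -` box l u) = measure lebesgue ((*v) W -` box l u)"
    by (simp add: emeasure_eq_measure2 fmeasurableD)
  also have "\<dots> = measure lebesgue (box l u)"
    unfolding eq by (simp add: measure_orthogonal_image[OF o b])
  finally have "emeasure lborel ((*v) W -` box l u) = emeasure lborel (box l u)"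
    using s b by (simp add: emeasure_eq_measure2)
  then show "emeasure (distr lborel borel ((*v) W)) (box l u) = ennreal (\<Prod>b\<in>Basis. (u - l) \<bullet> b)"
    using le s by (simp add: emeasure_distr emeasure_lborel_box)
qed simp

lemma nn_integral_lborel_translate:
  fixes c :: "'a::euclidean_space"
  assumes [measurable]: "g \<in> borel_measurable borel"
  shows "(\<integral>\<^sup>+x. g (c + x) \<partial>lborel) = integral\<^sup>N lborel g"
  by (subst (2) lborel_distr_plus[of c, symmetric]) (simp add: nn_integral_distr)

text \<open>For use at a fixed value s of the signal, where the noise subvector appears shifted by
  the subvector of s.\<close>

lemma nn_integral_subvector_translate:
  assumes "finite I" and [measurable]: "g \<in> borel_measurable (subvector_lborel I)"
  shows "(\<integral>\<^sup>+y. g (\<lambda>i\<in>I. c i + y i) \<partial>subvector_lborel I) = integral\<^sup>N (subvector_lborel I) g"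
proof -
  interpret product_sigma_finite "\<lambda>_. lborel :: real measure" by standard
  let ?t = "\<lambda>y. \<lambda>i\<in>I. c i + y i"
  have [measurable]: "?t \<in> subvector_lborel I \<rightarrow>\<^sub>M subvector_lborel I"
    by (intro measurable_restrict) (auto intro!: borel_measurable_add)
  have "distr (subvector_lborel I) (subvector_lborel I) ?t = subvector_lborel I"
  proof (rule PiM_eqI)
    fix A :: "_ \<Rightarrow> real set" assume A: "\<And>i. i \<in> I \<Longrightarrow> A i \<in> sets lborel"
    have A': "(+) (c i) -` A i \<in> sets lborel" if "i \<in> I" for i
      using A[OF that] measurable_sets[of "(+) (c i)" borel borel "A i"] by simp
    have "emeasure (distr (subvector_lborel I) (subvector_lborel I) ?t) (Pi\<^sub>E I A) =
        emeasure (subvector_lborel I) (\<Pi>\<^sub>E i\<in>I. (+) (c i) -` A i)"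
      using A assms(1) by (subst emeasure_distr)
        (auto intro!: arg_cong[where f = "emeasure _"] sets_PiM_I_finite simp: space_PiM PiE_iff)
    also have "\<dots> = (\<Prod>i\<in>I. emeasure lborel ((+) (c i) -` A i))"
      using assms(1) A' by (subst emeasure_PiM) auto
    also have "\<dots> = (\<Prod>i\<in>I. emeasure lborel (A i))"
    proof (rule prod.cong[OF refl])
      fix i assume "i \<in> I"
      then show "emeasure lborel ((+) (c i) -` A i) = emeasure lborel (A i)"
        using A[of i] by (subst (2) lborel_distr_plus[of "c i", symmetric]) (simp add: emeasure_distr)
    qed
    finally show "emeasure (distr (subvector_lborel I) (subvector_lborel I) ?t) (Pi\<^sub>E I A) = (\<Prod>i\<in>I. emeasure lborel (A i))" .
  qed (use assms(1) in auto)
  then have "integral\<^sup>N (subvector_lborel I) g = integral\<^sup>N (distr (subvector_lborel I) (subvector_lborel I) ?t) g" by simp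
  also have "\<dots> = (\<integral>\<^sup>+y. g (?t y) \<partial>subvector_lborel I)" by (rule nn_integral_distr) auto
  finally show ?thesis by simp
qed

lemma measurable_subvector [measurable (raw)]:
  assumes "f \<in> borel_measurable M"
  shows "(\<lambda>x. subvector I (f x)) \<in> M \<rightarrow>\<^sub>M subvector_lborel I"
  unfolding subvector_def
  by (intro measurable_restrict) (use assms in \<open>auto intro: measurable_compose[OF _ borel_measurable_continuous_onI[OF continuous_on_component[OF continuous_on_id]]]\<close>)

text \<open>
  Splitting \<open>x\<close> into the two subvectors of \<open>W\<^sup>T x\<close> preserves Lebesgue measure, so that densities can
  be kept on \<open>real ^ 'n\<close> and in the original coordinates.
\<close>

locale orthogonal_split =
  fixes I J :: "'n::{finite,wellorder} set" and W :: "real ^ 'n::_ ^ 'n::_"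
  assumes J: "J = - I" and W: "orthogonal_matrix W"
begin

definition "proj K x = subvector K (transpose W *v x)"

text \<open>Inverse of the pair of projections: a density \<open>p\<close> of a vector becomes the
  joint density \<open>p (glue r)\<close> of its two subvectors, with no Jacobian factor.\<close>

definition "glue p = W *v (\<chi> i. merge I J p i)"

abbreviation "TI \<equiv> subvector_lborel I"
abbreviation "TJ \<equiv> subvector_lborel J"

lemma measurable_proj [measurable (raw)]:
  "f \<in> borel_measurable M \<Longrightarrow> (\<lambda>x. proj K (f x)) \<in> M \<rightarrow>\<^sub>M subvector_lborel K"
  unfolding proj_def by measurable

lemma measurable_glue [measurable]: "glue \<in> borel_measurable (TI \<Otimes>\<^sub>M TJ)"
proof -
  have "I \<union> J = UNIV" by (simp add: J)
  then have "merge I J \<in> TI \<Otimes>\<^sub>M TJ \<rightarrow>\<^sub>M Pi\<^sub>M UNIV (\<lambda>_. lborel)"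
    using measurable_merge[of I J "\<lambda>_. lborel :: real measure"] by simp
  then have "(\<lambda>p. \<chi> i. merge I J p i) \<in> borel_measurable (TI \<Otimes>\<^sub>M TJ)"
    by (rule measurable_compose[OF _ measurable_vec_lambda_PiM])
  then show ?thesis unfolding glue_def[abs_def] by measurable
qed

lemma W_inverse: "transpose W *v (W *v x) = x" "W *v (transpose W *v x) = x"
  using W by (simp_all add: orthogonal_matrix_def matrix_vector_mul_assoc)

lemma glue_proj [simp]: "glue (proj I x, proj J x) = x"
proof -
  have "(\<chi> i. merge I J (proj I x, proj J x) i) = transpose W *v x"
    by (auto simp: vec_eq_iff merge_def proj_def subvector_def J)
  then show ?thesis by (simp add: glue_def W_inverse)
qed

lemma J_iff: "i \<in> J \<longleftrightarrow> i \<notin> I"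
  by (simp add: J)

lemma proj_glue: "p \<in> space (TI \<Otimes>\<^sub>M TJ) \<Longrightarrow> (proj I (glue p), proj J (glue p)) = p"
  by (cases p) (auto simp: proj_def glue_def W_inverse subvector_def merge_def J_iff space_pair_measure space_PiM
      PiE_def extensional_def fun_eq_iff)

sublocale TI: sigma_finite_measure TI by (rule sigma_finite_subvector_lborel) simp
sublocale TJ: sigma_finite_measure TJ by (rule sigma_finite_subvector_lborel) simp
sublocale TIJ: pair_sigma_finite TI TJ ..

lemma distr_glue: "distr (TI \<Otimes>\<^sub>M TJ) borel glue = lborel"
proof -
  interpret product_sigma_finite "\<lambda>_. lborel :: real measure" by standard
  have U: "I \<union> J = UNIV" by (simp add: J)
  have m: "merge I J \<in> TI \<Otimes>\<^sub>M TJ \<rightarrow>\<^sub>M Pi\<^sub>M UNIV (\<lambda>_. lborel)"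
    using measurable_merge[of I J "\<lambda>_. lborel :: real measure"] U by simp
  have mg: "distr (TI \<Otimes>\<^sub>M TJ) (Pi\<^sub>M UNIV (\<lambda>_. lborel)) (merge I J) = Pi\<^sub>M UNIV (\<lambda>_. lborel)"
    using distr_merge[of I J] U by (simp add: J)
  have "lborel = distr (distr (distr (TI \<Otimes>\<^sub>M TJ) (Pi\<^sub>M UNIV (\<lambda>_. lborel)) (merge I J)) borel (\<lambda>f. \<chi> i. f i)) borel ((*v) W)"
    unfolding mg lborel_vec_eq_PiM by (rule lborel_distr_orthogonal[OF W, symmetric])
  also have "\<dots> = distr (TI \<Otimes>\<^sub>M TJ) borel glue"
    using m by (simp add: distr_distr comp_def glue_def[abs_def])
  finally show ?thesis ..
qed

lemma nn_integral_split:
  assumes [measurable]: "g \<in> borel_measurable (TI \<Otimes>\<^sub>M TJ)"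
  shows "(\<integral>\<^sup>+x. g (proj I x, proj J x) \<partial>lborel) = integral\<^sup>N (TI \<Otimes>\<^sub>M TJ) g"
proof -
  have "(\<integral>\<^sup>+x. g (proj I x, proj J x) \<partial>lborel) = (\<integral>\<^sup>+x. g (proj I x, proj J x) \<partial>distr (TI \<Otimes>\<^sub>M TJ) borel glue)"
    by (simp add: distr_glue)
  also have "\<dots> = (\<integral>\<^sup>+p. g (proj I (glue p), proj J (glue p)) \<partial>(TI \<Otimes>\<^sub>M TJ))"
    by (subst nn_integral_distr) auto
  also have "\<dots> = integral\<^sup>N (TI \<Otimes>\<^sub>M TJ) g"
    by (intro nn_integral_cong) (simp add: proj_glue)
  finally show ?thesis .
qed

lemma nn_integral_split_prod:
  assumes [measurable]: "g \<in> borel_measurable TI" "h \<in> borel_measurable TJ"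
  shows "(\<integral>\<^sup>+x. g (proj I x) * h (proj J x) \<partial>lborel) = integral\<^sup>N TI g * integral\<^sup>N TJ h"
proof -
  have "(\<integral>\<^sup>+x. g (proj I x) * h (proj J x) \<partial>lborel) = (\<integral>\<^sup>+p. g (fst p) * h (snd p) \<partial>(TI \<Otimes>\<^sub>M TJ))"
    using nn_integral_split[of "\<lambda>p. g (fst p) * h (snd p)"] by simp
  also have "\<dots> = (\<integral>\<^sup>+a. \<integral>\<^sup>+b. g a * h b \<partial>TJ \<partial>TI)"
    by (subst TJ.nn_integral_fst[symmetric]) auto
  also have "\<dots> = integral\<^sup>N TI g * integral\<^sup>N TJ h"
    by (simp add: nn_integral_cmult nn_integral_multc)
  finally show ?thesis .
qed

lemma distr_proj: "distr lborel (TI \<Otimes>\<^sub>M TJ) (\<lambda>x. (proj I x, proj J x)) = TI \<Otimes>\<^sub>M TJ"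
proof (rule measure_eqI)
  fix A assume "A \<in> sets (distr lborel (TI \<Otimes>\<^sub>M TJ) (\<lambda>x. (proj I x, proj J x)))"
  then have [measurable]: "A \<in> sets (TI \<Otimes>\<^sub>M TJ)" by simp
  show "emeasure (distr lborel (TI \<Otimes>\<^sub>M TJ) (\<lambda>x. (proj I x, proj J x))) A = emeasure (TI \<Otimes>\<^sub>M TJ) A"
    using nn_integral_split[of "indicator A"]
    by (subst nn_integral_indicator[symmetric], simp, subst nn_integral_distr) auto
qed simp

end

lemma nn_integral_prod_normal:
  assumes "finite I" "\<And>i. i \<in> I \<Longrightarrow> 0 < s i"
  shows "(\<integral>\<^sup>+y. ennreal (\<Prod>i\<in>I. normal_density (m i) (s i) (y i)) \<partial>subvector_lborel I) = 1"
proof -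
  interpret product_sigma_finite "\<lambda>_. lborel :: real measure" by standard
  have "(\<integral>\<^sup>+y. ennreal (\<Prod>i\<in>I. normal_density (m i) (s i) (y i)) \<partial>subvector_lborel I) =
    (\<integral>\<^sup>+y. (\<Prod>i\<in>I. ennreal (normal_density (m i) (s i) (y i))) \<partial>subvector_lborel I)"
    by (simp add: prod_ennreal)
  also have "\<dots> = (\<Prod>i\<in>I. \<integral>\<^sup>+x. normal_density (m i) (s i) x \<partial>lborel)"
    by (rule product_nn_integral_prod) (use assms in auto)
  also have "\<dots> = (\<Prod>i\<in>I. 1)"
  proof (rule prod.cong[OF refl])
    fix i assume "i \<in> I"
    then show "(\<integral>\<^sup>+x. normal_density (m i) (s i) x \<partial>lborel) = 1"
      using assms(2) by (subst nn_integral_eq_integral) auto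
  qed
  finally show ?thesis by simp
qed

section \<open>Densities and logarithmic moments\<close>

text \<open>By Radon-Nikodym. The densities of sums, subvectors and quantized pairs are obtained
  here and never computed, so that only absolute continuity has to be checked. The version is
  real-valued and nonnegative everywhere, which the logarithms below rely on.\<close>

lemma (in prob_space) distributed_realI:
  assumes "sigma_finite_measure T" and Z[measurable]: "Z \<in> M \<rightarrow>\<^sub>M T"
    and null: "\<And>A. A \<in> null_sets T \<Longrightarrow> AE \<omega> in M. Z \<omega> \<notin> A"
  obtains p :: "'b \<Rightarrow> real" where "distributed M T Z p" "\<And>x. 0 \<le> p x"
proof -
  interpret T: sigma_finite_measure T by fact
  interpret D: prob_space "distr M T Z" by (rule prob_space_distr) fact
  have ac: "absolutely_continuous T (distr M T Z)"
    unfolding absolutely_continuous_def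
  proof
    fix A assume A: "A \<in> null_sets T"
    then have [measurable]: "A \<in> sets T" by auto
    have "AE \<omega> in M. \<omega> \<notin> Z -` A \<inter> space M" using null[OF A] by eventually_elim simp
    then have "Z -` A \<inter> space M \<in> null_sets M" by (subst AE_iff_null_sets) auto
    then show "A \<in> null_sets (distr M T Z)" by (auto simp: null_sets_def emeasure_distr)
  qed
  have "sets (distr M T Z) = sets T" by simp
  from T.real_RN_deriv[OF D.finite_measure_axioms ac this] obtain p where p:
    "p \<in> borel_measurable T" "AE x in T. RN_deriv T (distr M T Z) x = ennreal (p x)"
    "AE x in distr M T Z. 0 < p x" "\<And>x. 0 \<le> p x"
    by this auto
  have "distr M T Z = density T (RN_deriv T (distr M T Z))"
    using ac by (rule T.density_RN_deriv[symmetric]) simp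
  also have "\<dots> = density T p" using p by (intro density_cong) auto
  finally have "distributed M T Z p" using p by (simp add: distributed_def)
  with p(4) that show ?thesis by blast
qed

lemma distributed_AE_null:
  assumes D: "distributed M T Z p" and A: "A \<in> null_sets T"
  shows "AE \<omega> in M. Z \<omega> \<notin> A"
proof -
  have [measurable]: "Z \<in> M \<rightarrow>\<^sub>M T" "A \<in> sets T" using D A by (auto simp: distributed_def)
  have "AE x in distr M T Z. x \<notin> A"
    unfolding distributed_distr_eq_density[OF D]
    using D A by (subst AE_density) (auto simp: distributed_def dest: AE_not_in)
  then show ?thesis by (subst (asm) AE_distr_iff) auto
qed

lemma distributed_AE_pos:
  fixes p :: "'b \<Rightarrow> real"
  assumes D: "distributed M T Z p" and "\<And>x. 0 \<le> p x"
  shows "AE \<omega> in M. 0 < p (Z \<omega>)"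
proof -
  have [measurable]: "Z \<in> M \<rightarrow>\<^sub>M T" "p \<in> borel_measurable T"
    using D assms(2) by (auto simp: distributed_def)
  have "AE x in distr M T Z. 0 < p x"
    unfolding distributed_distr_eq_density[OF D] by (subst AE_density) auto
  then show ?thesis by (subst (asm) AE_distr_iff) auto
qed

text \<open>The expectation is the integral of p (g / p). Where \<open>p\<close> vanishes this
  integrand is 0, hence only an inequality. A subdensity \<open>g\<close> thus meets the hypothesis
  of Gibbs' inequality.\<close>

lemma nn_integral_density_ratio_le:
  fixes p g :: "'b \<Rightarrow> real"
  assumes D: "distributed M T Z p" and nn: "\<And>x. 0 \<le> p x" "\<And>x. 0 \<le> g x" and [measurable]: "g \<in> borel_measurable T"
  shows "(\<integral>\<^sup>+\<omega>. ennreal (g (Z \<omega>) / p (Z \<omega>)) \<partial>M) \<le> (\<integral>\<^sup>+x. ennreal (g x) \<partial>T)"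
proof -
  have [measurable]: "p \<in> borel_measurable T" using D nn by (auto simp: distributed_def)
  have "(\<integral>\<^sup>+\<omega>. ennreal (g (Z \<omega>) / p (Z \<omega>)) \<partial>M) = (\<integral>\<^sup>+x. ennreal (p x) * ennreal (g x / p x) \<partial>T)"
    by (rule distributed_nn_integral[OF D, symmetric]) simp
  also have "\<dots> \<le> (\<integral>\<^sup>+x. ennreal (g x) \<partial>T)"
    using nn by (intro nn_integral_mono) (auto simp: ennreal_mult'[symmetric])
  finally show ?thesis .
qed

text \<open>From ln x <= x - 1 at x = U / V.\<close>

lemma (in prob_space) integral_ln_le:
  assumes [measurable]: "U \<in> borel_measurable M" "V \<in> borel_measurable M"
    and pos: "AE \<omega> in M. 0 < U \<omega>" "AE \<omega> in M. 0 < V \<omega>"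
    and le1: "(\<integral>\<^sup>+\<omega>. ennreal (U \<omega> / V \<omega>) \<partial>M) \<le> 1"
    and int: "integrable M (\<lambda>\<omega>. ln (U \<omega>))" "integrable M (\<lambda>\<omega>. ln (V \<omega>))"
  shows "expectation (\<lambda>\<omega>. ln (U \<omega>)) \<le> expectation (\<lambda>\<omega>. ln (V \<omega>:: real))"
proof -
  have nn: "AE \<omega> in M. 0 \<le> U \<omega> / V \<omega>" using pos by eventually_elim auto
  have "(\<integral>\<^sup>+\<omega>. ennreal (U \<omega> / V \<omega>) \<partial>M) < \<infinity>" using le1 by (auto simp: less_top[symmetric] top_unique)
  then have i: "integrable M (\<lambda>\<omega>. U \<omega> / V \<omega>)" using nn by (intro integrableI_nonneg) auto
  have "ennreal (expectation (\<lambda>\<omega>. U \<omega> / V \<omega>)) \<le> 1"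
    using le1 nn_integral_eq_integral[OF i nn] by simp
  then have "expectation (\<lambda>\<omega>. U \<omega> / V \<omega>) \<le> 1" by simp
  moreover have "expectation (\<lambda>\<omega>. ln (U \<omega>) - ln (V \<omega>)) \<le> expectation (\<lambda>\<omega>. U \<omega> / V \<omega> - 1)"
  proof (rule integral_mono_AE)
    show "AE \<omega> in M. ln (U \<omega>) - ln (V \<omega>) \<le> U \<omega> / V \<omega> - 1"
      using pos by eventually_elim (metis divide_pos_pos ln_divide_pos ln_le_minus_one)
  qed (use int i in auto)
  ultimately show ?thesis using int i by (simp add: prob_space)
qed

text \<open>The inequality ln x <= x - 1 at U / V bounds ln U from above, at G / U from below, and
  both ratios have finite expectation. In the uses \<open>G\<close> is Gaussian and \<open>V\<close>
  is built from densities whose logarithms are already under control.\<close>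

lemma (in prob_space) integrable_ln_between:
  assumes [measurable]: "U \<in> borel_measurable M" "V \<in> borel_measurable M" "G \<in> borel_measurable M"
    and pos: "AE \<omega> in M. 0 < U \<omega>" "AE \<omega> in M. 0 < V \<omega>" "AE \<omega> in M. 0 < G \<omega>"
    and fin: "(\<integral>\<^sup>+\<omega>. ennreal (U \<omega> / V \<omega>) \<partial>M) < \<infinity>" "(\<integral>\<^sup>+\<omega>. ennreal (G \<omega> / U \<omega>) \<partial>M) < \<infinity>"
    and int: "integrable M (\<lambda>\<omega>. ln (V \<omega>))" "integrable M (\<lambda>\<omega>. ln (G \<omega>))"
  shows "integrable M (\<lambda>\<omega>. ln (U \<omega> :: real))"
proof -
  have "AE \<omega> in M. 0 \<le> U \<omega> / V \<omega>" using pos by eventually_elim auto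
  then have i: "integrable M (\<lambda>\<omega>. U \<omega> / V \<omega>)" using fin by (intro integrableI_nonneg) auto
  have "AE \<omega> in M. 0 \<le> G \<omega> / U \<omega>" using pos by eventually_elim auto
  then have j: "integrable M (\<lambda>\<omega>. G \<omega> / U \<omega>)" using fin by (intro integrableI_nonneg) auto
  show ?thesis
  proof (rule Bochner_Integration.integrable_bound)
    show "integrable M (\<lambda>\<omega>. \<bar>ln (V \<omega>)\<bar> + \<bar>ln (G \<omega>)\<bar> + (U \<omega> / V \<omega> + G \<omega> / U \<omega>))"
      using int i j by auto
    show "AE \<omega> in M. norm (ln (U \<omega>)) \<le> norm (\<bar>ln (V \<omega>)\<bar> + \<bar>ln (G \<omega>)\<bar> + (U \<omega> / V \<omega> + G \<omega> / U \<omega>))"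
      using pos
    proof eventually_elim
      fix \<omega> assume p: "0 < U \<omega>" "0 < V \<omega>" "0 < G \<omega>"
      have "ln (U \<omega>) - ln (V \<omega>) \<le> U \<omega> / V \<omega> - 1" "ln (G \<omega>) - ln (U \<omega>) \<le> G \<omega> / U \<omega> - 1"
        using p by (metis divide_pos_pos ln_divide_pos ln_le_minus_one)+
      moreover have "0 < U \<omega> / V \<omega>" "0 < G \<omega> / U \<omega>" using p by auto
      ultimately show "norm (ln (U \<omega>)) \<le> norm (\<bar>ln (V \<omega>)\<bar> + \<bar>ln (G \<omega>)\<bar> + (U \<omega> / V \<omega> + G \<omega> / U \<omega>))"
        by (simp only: real_norm_def)
    qed
  qed measurable
qed

section \<open>Gaussian reference densities and second moments\<close>

lemma ln_normal_density:
  "0 < s \<Longrightarrow> ln (normal_density m s x) = - ln (2 * pi * s\<^sup>2) / 2 - (x - m)\<^sup>2 / (2 * s\<^sup>2)"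
  by (simp add: normal_density_def ln_mult ln_div ln_sqrt field_simps)

text \<open>A reference density that is positive everywhere and has a quadratic logarithm, so that
  finite second moments make this logarithm integrable.\<close>

definition gauss_prod :: "'n set \<Rightarrow> ('n \<Rightarrow> real) \<Rightarrow> real" where
  "gauss_prod K y = (\<Prod>i\<in>K. std_normal_density (y i))"

lemma gauss_prod_pos: "0 < gauss_prod K y"
  unfolding gauss_prod_def by (intro prod_pos ballI normal_density_pos) simp

lemma gauss_prod_nonneg [simp]: "0 \<le> gauss_prod K y" and gauss_prod_neq_0 [simp]: "gauss_prod K y \<noteq> 0"
  using gauss_prod_pos[of K y] by auto

lemma measurable_gauss_prod [measurable]: "gauss_prod K \<in> borel_measurable (subvector_lborel K)"
  unfolding gauss_prod_def[abs_def]
  by (intro borel_measurable_prod measurable_compose[OF measurable_component_singleton, of _ K "\<lambda>_. lborel"]) auto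

lemma nn_integral_gauss_prod: "finite K \<Longrightarrow> (\<integral>\<^sup>+y. ennreal (gauss_prod K y) \<partial>subvector_lborel K) = 1"
  unfolding gauss_prod_def by (rule nn_integral_prod_normal) auto

lemma power2_norm_add_le: "(norm (x + y))\<^sup>2 \<le> 2 * (norm x)\<^sup>2 + 2 * (norm (y :: 'a::real_normed_vector))\<^sup>2"
proof -
  have "(norm (x + y))\<^sup>2 \<le> (norm x + norm y)\<^sup>2" by (rule power_mono) (auto intro: norm_triangle_ineq)
  also have "\<dots> \<le> 2 * (norm x)\<^sup>2 + 2 * (norm y)\<^sup>2"
    using sum_squares_bound[of "norm x" "norm y"] by (simp add: power2_sum)
  finally show ?thesis .
qed

lemma integrable_norm_square_add:
  fixes X Y :: "'a \<Rightarrow> 'b::euclidean_space"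
  assumes [measurable]: "X \<in> borel_measurable M" "Y \<in> borel_measurable M"
    and "integrable M (\<lambda>\<omega>. (norm (X \<omega>))\<^sup>2)" "integrable M (\<lambda>\<omega>. (norm (Y \<omega>))\<^sup>2)"
  shows "integrable M (\<lambda>\<omega>. (norm (X \<omega> + Y \<omega>))\<^sup>2)"
proof (rule Bochner_Integration.integrable_bound)
  show "integrable M (\<lambda>\<omega>. 2 * (norm (X \<omega>))\<^sup>2 + 2 * (norm (Y \<omega>))\<^sup>2)" using assms by simp
  show "AE \<omega> in M. norm ((norm (X \<omega> + Y \<omega>))\<^sup>2) \<le> norm (2 * (norm (X \<omega>))\<^sup>2 + 2 * (norm (Y \<omega>))\<^sup>2)"
    using power2_norm_add_le by (intro AE_I2) simp
qed measurable

lemma integrable_inner_square: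
  fixes Z :: "'a \<Rightarrow> real ^ 'n"
  assumes [measurable]: "Z \<in> borel_measurable M" and "integrable M (\<lambda>\<omega>. (norm (Z \<omega>))\<^sup>2)"
  shows "integrable M (\<lambda>\<omega>. (v \<bullet> Z \<omega>)\<^sup>2)"
proof (rule Bochner_Integration.integrable_bound)
  show "integrable M (\<lambda>\<omega>. (norm v)\<^sup>2 * (norm (Z \<omega>))\<^sup>2)" using assms by simp
  show "AE \<omega> in M. norm ((v \<bullet> Z \<omega>)\<^sup>2) \<le> norm ((norm v)\<^sup>2 * (norm (Z \<omega>))\<^sup>2)"
  proof (rule AE_I2)
    fix \<omega>
    have "\<bar>v \<bullet> Z \<omega>\<bar> \<le> \<bar>norm v * norm (Z \<omega>)\<bar>" using Cauchy_Schwarz_ineq2[of v "Z \<omega>"] by simp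
    then have "(v \<bullet> Z \<omega>)\<^sup>2 \<le> (norm v * norm (Z \<omega>))\<^sup>2" by (simp only: abs_le_square_iff)
    then show "norm ((v \<bullet> Z \<omega>)\<^sup>2) \<le> norm ((norm v)\<^sup>2 * (norm (Z \<omega>))\<^sup>2)" by (simp add: power_mult_distrib)
  qed
qed simp

section \<open>Pairs with one component in a finite set\<close>

lemma count_pair_nn_integral:
  assumes "sigma_finite_measure T" and "finite K" and [measurable]: "F \<in> borel_measurable (count_space K \<Otimes>\<^sub>M T)"
  shows "integral\<^sup>N (count_space K \<Otimes>\<^sub>M T) F = (\<Sum>k\<in>K. \<integral>\<^sup>+x. F (k, x) \<partial>T)"
proof -
  interpret T: sigma_finite_measure T by fact
  show ?thesis
    by (subst T.nn_integral_fst[symmetric]) (simp_all add: nn_integral_count_space_finite assms)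
qed

text \<open>All slices of a null set are null and there are finitely many of them, so absolute
  continuity of \<open>Z\<close> passes to the pair, however \<open>k\<close> depends on
  \<open>Z\<close>.\<close>

lemma AE_count_pair_null:
  assumes T: "sigma_finite_measure T" and K: "finite K"
    and k: "k \<in> M \<rightarrow>\<^sub>M count_space K"
    and null: "\<And>A. A \<in> null_sets T \<Longrightarrow> AE \<omega> in M. Z \<omega> \<notin> A"
    and A: "A \<in> null_sets (count_space K \<Otimes>\<^sub>M T)"
  shows "AE \<omega> in M. (k \<omega>, Z \<omega>) \<notin> A"
proof -
  have [measurable]: "A \<in> sets (count_space K \<Otimes>\<^sub>M T)" using A by auto
  have "0 = emeasure (count_space K \<Otimes>\<^sub>M T) A" using A by auto
  also have "\<dots> = integral\<^sup>N (count_space K \<Otimes>\<^sub>M T) (indicator A)" by simp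
  also have "\<dots> = (\<Sum>j\<in>K. \<integral>\<^sup>+x. indicator A (j, x) \<partial>T)"
    by (rule count_pair_nn_integral[OF T K]) simp
  finally have z: "(\<integral>\<^sup>+x. indicator A (j, x) \<partial>T) = 0" if "j \<in> K" for j
    using that K by (metis (no_types, lifting) sum_eq_0_iff)
  have "Pair j -` A \<in> null_sets T" if j: "j \<in> K" for j
  proof -
    have s: "Pair j -` A \<in> sets T" by (rule sets_Pair1[OF \<open>A \<in> sets (count_space K \<Otimes>\<^sub>M T)\<close>])
    have "emeasure T (Pair j -` A) = (\<integral>\<^sup>+x. indicator (Pair j -` A) x \<partial>T)" using s by simp
    also have "\<dots> = (\<integral>\<^sup>+x. indicator A (j, x) \<partial>T)" by (intro nn_integral_cong) (auto simp: indicator_def)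
    finally show ?thesis using z[OF j] s by auto
  qed
  then have "AE \<omega> in M. \<forall>j\<in>K. (j, Z \<omega>) \<notin> A"
    using null K by (intro AE_finite_allI) force+
  then show ?thesis using AE_space
    by eventually_elim (use measurable_space[OF k] in auto)
qed

text \<open>Splits the information into single expectations; the logarithm of \<open>w\<close> takes
  finitely many values and is therefore integrable. \<open>T'\<close> may differ from
  \<open>T\<close> as a measure, because only its \<sigma>-algebra enters: observations are declared
  over \<open>borel\<close>, their densities over \<open>lborel\<close>.\<close>

lemma (in prob_space) mutual_information_count:
  fixes p :: "'b \<Rightarrow> real" and u :: "'k \<times> 'b \<Rightarrow> real"
  assumes T: "sigma_finite_measure T" and K: "finite K"
    and p: "distributed M T Z p" "\<And>x. 0 \<le> p x"
    and w: "distributed M (count_space K) k w" "\<And>x. 0 \<le> w x"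
    and u: "distributed M (count_space K \<Otimes>\<^sub>M T) (\<lambda>\<omega>. (k \<omega>, Z \<omega>)) u" "\<And>x. 0 \<le> u x"
    and int: "integrable M (\<lambda>\<omega>. ln (u (k \<omega>, Z \<omega>)))" "integrable M (\<lambda>\<omega>. ln (p (Z \<omega>)))"
    and T': "sets T' = sets T"
  shows "mutual_information (exp 1) (count_space K) T' k Z =
    expectation (\<lambda>\<omega>. ln (u (k \<omega>, Z \<omega>))) - expectation (\<lambda>\<omega>. ln (w (k \<omega>))) - expectation (\<lambda>\<omega>. ln (p (Z \<omega>)))"
proof -
  interpret information_space M "exp 1" by unfold_locales simp
  have [measurable]: "p \<in> borel_measurable T" "u \<in> borel_measurable (count_space K \<Otimes>\<^sub>M T)"
    "Z \<in> M \<rightarrow>\<^sub>M T" "k \<in> M \<rightarrow>\<^sub>M count_space K" "w \<in> borel_measurable (count_space K)"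
    using p u w by (auto simp: distributed_def)
  have [measurable]: "(\<lambda>x. w (fst x)) \<in> borel_measurable (count_space K \<Otimes>\<^sub>M T)"
    by (rule measurable_compose[OF measurable_fst]) simp
  have "distr M T' Z = distr M T Z" "distr M (count_space K \<Otimes>\<^sub>M T') (\<lambda>x. (k x, Z x)) = distr M (count_space K \<Otimes>\<^sub>M T) (\<lambda>x. (k x, Z x))"
    using T' by (auto intro!: distr_cong sets_pair_measure_cong)
  then have "mutual_information (exp 1) (count_space K) T' k Z = mutual_information (exp 1) (count_space K) T k Z"
    by (simp add: mutual_information_def)
  also have "\<dots> = (\<integral>x. u x * log (exp 1) (u x / (w (fst x) * p (snd x))) \<partial>(count_space K \<Otimes>\<^sub>M T))"
    by (rule mutual_information_distr) (use T K p w u in \<open>auto simp: sigma_finite_measure_count_space_finite\<close>)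
  also have "\<dots> = expectation (\<lambda>\<omega>. log (exp 1) (u (k \<omega>, Z \<omega>) / (w (fst (k \<omega>, Z \<omega>)) * p (snd (k \<omega>, Z \<omega>)))))"
    by (rule distributed_integral[OF u(1)]) (simp_all add: u(2) del: borel_measurable_count_space)
  also have "\<dots> = expectation (\<lambda>\<omega>. ln (u (k \<omega>, Z \<omega>)) - ln (w (k \<omega>)) - ln (p (Z \<omega>)))"
  proof (rule integral_cong_AE)
    show "AE \<omega> in M. log (exp 1) (u (k \<omega>, Z \<omega>) / (w (fst (k \<omega>, Z \<omega>)) * p (snd (k \<omega>, Z \<omega>)))) =
        ln (u (k \<omega>, Z \<omega>)) - ln (w (k \<omega>)) - ln (p (Z \<omega>))"
      using distributed_AE_pos[OF p] distributed_AE_pos[OF w] distributed_AE_pos[OF u]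
      by eventually_elim (simp add: log_def ln_div ln_mult)
  qed measurable
  also have "\<dots> = expectation (\<lambda>\<omega>. ln (u (k \<omega>, Z \<omega>))) - expectation (\<lambda>\<omega>. ln (w (k \<omega>))) - expectation (\<lambda>\<omega>. ln (p (Z \<omega>)))"
  proof -
    have "integrable M (\<lambda>\<omega>. ln (w (k \<omega>)))"
    proof (rule integrable_const_bound[where B = "\<Sum>j\<in>K. \<bar>ln (w j)\<bar>"])
      show "AE \<omega> in M. norm (ln (w (k \<omega>))) \<le> (\<Sum>j\<in>K. \<bar>ln (w j)\<bar>)"
      proof (rule AE_I2)
        fix \<omega> assume "\<omega> \<in> space M"
        then have "k \<omega> \<in> K" using measurable_space[of k M "count_space K"] by auto
        then show "norm (ln (w (k \<omega>))) \<le> (\<Sum>j\<in>K. \<bar>ln (w j)\<bar>)"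
          using K member_le_sum[of "k \<omega>" K "\<lambda>j. \<bar>ln (w j)\<bar>"] by simp
      qed
    qed measurable
    then show ?thesis using int by simp
  qed
  finally show ?thesis .
qed

section \<open>Densities of subvectors and their logarithms\<close>

context orthogonal_split
begin

lemma null_proj: "A \<in> null_sets TJ \<Longrightarrow> proj J -` A \<in> null_sets lborel"
proof -
  assume A: "A \<in> null_sets TJ"
  then have [measurable]: "A \<in> sets TJ" by auto
  have s: "proj J -` A \<in> sets lborel"
    using measurable_sets[OF measurable_proj[OF measurable_ident, of J] \<open>A \<in> sets TJ\<close>] by simp
  have "emeasure lborel (proj J -` A) = (\<integral>\<^sup>+x. 1 * indicator A (proj J x) \<partial>lborel)"
  proof -
    have "(\<integral>\<^sup>+x. 1 * indicator A (proj J x) \<partial>lborel) = (\<integral>\<^sup>+x. indicator (proj J -` A) x \<partial>lborel)"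
      by (intro nn_integral_cong) (simp add: indicator_def)
    then show ?thesis using s by simp
  qed
  \<comment> \<open>The first factor may be infinite, but its product with 0 is 0 in
    \<open>ennreal\<close>.\<close>
  also have "\<dots> = integral\<^sup>N TI (\<lambda>_. 1) * integral\<^sup>N TJ (indicator A)"
    by (rule nn_integral_split_prod) auto
  also have "\<dots> = 0" using A by auto
  finally show ?thesis using s by auto
qed

lemma AE_proj_null:
  assumes "\<And>A. A \<in> null_sets lborel \<Longrightarrow> AE \<omega> in M. Z \<omega> \<notin> A" and "A \<in> null_sets TJ"
  shows "AE \<omega> in M. proj J (Z \<omega>) \<notin> A"
  using assms(1)[OF null_proj[OF assms(2)]] by simp

lemma distributed_proj:
  assumes "prob_space M" "distributed M lborel Z p"
  obtains q :: "('n \<Rightarrow> real) \<Rightarrow> real" where "distributed M TJ (\<lambda>\<omega>. proj J (Z \<omega>)) q" "\<And>y. 0 \<le> q y"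
proof -
  interpret prob_space M by fact
  have [measurable]: "Z \<in> borel_measurable M" using assms(2) by (auto simp: distributed_def)
  show ?thesis
    by (rule distributed_realI[OF TJ.sigma_finite_measure_axioms, of "\<lambda>\<omega>. proj J (Z \<omega>)"])
      (use that AE_proj_null[OF distributed_AE_null[OF assms(2)]] in auto)
qed

lemma distributed_split:
  fixes p :: "real ^ 'n::_ \<Rightarrow> real"
  assumes D: "distributed M lborel Z p" and nn: "\<And>x. 0 \<le> p x"
  shows "distributed M (TI \<Otimes>\<^sub>M TJ) (\<lambda>\<omega>. (proj I (Z \<omega>), proj J (Z \<omega>))) (\<lambda>r. p (glue r))"
proof -
  have [measurable]: "Z \<in> borel_measurable M" "p \<in> borel_measurable borel" using D nn by (auto simp: distributed_def)
  let ?s = "\<lambda>x. (proj I x, proj J x)"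
  have "distr M (TI \<Otimes>\<^sub>M TJ) (\<lambda>\<omega>. ?s (Z \<omega>)) = distr (distr M lborel Z) (TI \<Otimes>\<^sub>M TJ) ?s"
    by (subst distr_distr) (auto simp: comp_def)
  also have "\<dots> = distr (density lborel (\<lambda>x. ennreal (p (glue (?s x))))) (TI \<Otimes>\<^sub>M TJ) ?s"
    by (simp add: distributed_distr_eq_density[OF D])
  also have "\<dots> = density (distr lborel (TI \<Otimes>\<^sub>M TJ) ?s) (\<lambda>r. ennreal (p (glue r)))"
    by (rule density_distr[symmetric]) auto
  finally show ?thesis by (simp add: distributed_def distr_proj)
qed

text \<open>The quotient stays inside one logarithm: in this form the identity is a change of
  variables, whereas separating the two densities calls for integrability of each logarithm.\<close>

lemma conditional_entropy_split:
  fixes p :: "real ^ 'n::_ \<Rightarrow> real" and q :: "('n \<Rightarrow> real) \<Rightarrow> real"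
  assumes "prob_space M" and p: "distributed M lborel Z p" "\<And>x. 0 \<le> p x"
    and q: "distributed M TJ (\<lambda>\<omega>. proj J (Z \<omega>)) q" "\<And>y. 0 \<le> q y"
  shows "prob_space.conditional_entropy M (exp 1) TI TJ (\<lambda>\<omega>. proj I (Z \<omega>)) (\<lambda>\<omega>. proj J (Z \<omega>)) =
    - (\<integral>\<omega>. ln (p (Z \<omega>) / q (proj J (Z \<omega>))) \<partial>M)"
proof -
  interpret prob_space M by fact
  interpret information_space M "exp 1" by unfold_locales simp
  have [measurable]: "Z \<in> borel_measurable M" "p \<in> borel_measurable borel" "q \<in> borel_measurable TJ"
    using p q by (auto simp: distributed_def)
  note pp = distributed_split[OF p]
  have "conditional_entropy (exp 1) TI TJ (\<lambda>\<omega>. proj I (Z \<omega>)) (\<lambda>\<omega>. proj J (Z \<omega>)) =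
     - (\<integral>(x, y). p (glue (x, y)) * log (exp 1) (p (glue (x, y)) / q y) \<partial>(TI \<Otimes>\<^sub>M TJ))"
    by (rule conditional_entropy_generic_eq[OF TI.sigma_finite_measure_axioms TJ.sigma_finite_measure_axioms q(1) _ pp])
      (use p q in auto)
  also have "(\<integral>(x, y). p (glue (x, y)) * log (exp 1) (p (glue (x, y)) / q y) \<partial>(TI \<Otimes>\<^sub>M TJ)) =
     (\<integral>r. p (glue r) * log (exp 1) (p (glue r) / q (snd r)) \<partial>(TI \<Otimes>\<^sub>M TJ))"
    by (simp add: split_beta')
  also have "\<dots> = (\<integral>\<omega>. log (exp 1) (p (glue (proj I (Z \<omega>), proj J (Z \<omega>))) / q (snd (proj I (Z \<omega>), proj J (Z \<omega>)))) \<partial>M)"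
    by (rule distributed_integral[OF pp]) (use p in auto)
  finally show ?thesis by (simp add: log_def)
qed

lemma ln_gauss_prod_proj:
  "ln (gauss_prod K (proj K x)) = (\<Sum>i\<in>K. - ln (2 * pi) / 2 - (column i W \<bullet> x)\<^sup>2 / 2)"
  unfolding gauss_prod_def
  by (subst ln_prod) (auto simp: ln_normal_density normal_density_pos[THEN less_imp_neq, THEN not_sym] proj_def subvector_def transpose_mult_nth)

lemma integrable_ln_gauss_prod:
  assumes "prob_space M" and [measurable]: "Z \<in> borel_measurable M" and "integrable M (\<lambda>\<omega>. (norm (Z \<omega>))\<^sup>2)"
  shows "integrable M (\<lambda>\<omega>. ln (gauss_prod K (proj K (Z \<omega>))))"
proof -
  interpret prob_space M by fact
  show ?thesis
    unfolding ln_gauss_prod_proj by (intro Bochner_Integration.integrable_sum) (use integrable_inner_square[OF assms(2,3)] in auto)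
qed

text \<open>In the sense of \<open>integrable_ln_between\<close>, the marginal lies below
  \<open>p\<close> divided by a Gaussian density of the \<open>I\<close> part and above a Gaussian
  density of the \<open>J\<close> part. The first ratio is bounded because \<open>q\<close> times
  the Gaussian density on \<open>I\<close> is a density on the whole space.\<close>

lemma integrable_ln_proj_density:
  fixes p :: "real ^ 'n::_ \<Rightarrow> real" and q :: "('n \<Rightarrow> real) \<Rightarrow> real"
  assumes "prob_space M" and p: "distributed M lborel Z p" "\<And>x. 0 \<le> p x"
    and q: "distributed M TJ (\<lambda>\<omega>. proj J (Z \<omega>)) q" "\<And>y. 0 \<le> q y"
    and int: "integrable M (\<lambda>\<omega>. ln (p (Z \<omega>)))" "integrable M (\<lambda>\<omega>. (norm (Z \<omega>))\<^sup>2)"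
  shows "integrable M (\<lambda>\<omega>. ln (q (proj J (Z \<omega>))))"
proof -
  interpret prob_space M by fact
  have [measurable]: "Z \<in> borel_measurable M" "p \<in> borel_measurable borel" "q \<in> borel_measurable TJ"
    using p q by (auto simp: distributed_def)
  let ?g = "\<lambda>K \<omega>. gauss_prod K (proj K (Z \<omega>))"
  note g = integrable_ln_gauss_prod[OF \<open>prob_space M\<close> _ int(2)]
  have pp: "AE \<omega> in M. 0 < p (Z \<omega>)" by (rule distributed_AE_pos[OF p])
  have qp: "AE \<omega> in M. 0 < q (proj J (Z \<omega>))" by (rule distributed_AE_pos[OF q])
  have q1: "(\<integral>\<^sup>+y. ennreal (q y) \<partial>TJ) = 1"
    using distributed_nn_integral[OF q(1), of "\<lambda>_. 1"] by (simp add: emeasure_space_1)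
  show ?thesis
  proof (rule integrable_ln_between[where V = "\<lambda>\<omega>. p (Z \<omega>) / ?g I \<omega>" and G = "?g J"])
    show "AE \<omega> in M. 0 < p (Z \<omega>) / ?g I \<omega>" using pp by eventually_elim (simp add: gauss_prod_pos)
    have "integrable M (\<lambda>\<omega>. ln (p (Z \<omega>)) - ln (?g I \<omega>))" using int g by auto
    then show "integrable M (\<lambda>\<omega>. ln (p (Z \<omega>) / ?g I \<omega>))"
      by (rule integrable_cong_AE_imp) (use pp in \<open>auto simp: ln_div gauss_prod_pos elim!: eventually_mono\<close>)
    have "(\<integral>\<^sup>+\<omega>. ennreal (q (proj J (Z \<omega>)) / (p (Z \<omega>) / ?g I \<omega>)) \<partial>M) =
        (\<integral>\<^sup>+\<omega>. ennreal ((\<lambda>x. gauss_prod I (proj I x) * q (proj J x)) (Z \<omega>) / p (Z \<omega>)) \<partial>M)"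
      by (simp add: field_simps)
    also have "\<dots> \<le> (\<integral>\<^sup>+x. ennreal (gauss_prod I (proj I x) * q (proj J x)) \<partial>lborel)"
      by (rule nn_integral_density_ratio_le[OF p]) (auto simp: q less_imp_le[OF gauss_prod_pos])
    also have "\<dots> = (\<integral>\<^sup>+x. ennreal (gauss_prod I (proj I x)) * ennreal (q (proj J x)) \<partial>lborel)"
      by (simp add: ennreal_mult q less_imp_le[OF gauss_prod_pos])
    also have "\<dots> = 1"
      by (subst nn_integral_split_prod) (auto simp: nn_integral_gauss_prod q1)
    finally show "(\<integral>\<^sup>+\<omega>. ennreal (q (proj J (Z \<omega>)) / (p (Z \<omega>) / ?g I \<omega>)) \<partial>M) < \<infinity>"
      by (rule le_less_trans) simp
    have "(\<integral>\<^sup>+\<omega>. ennreal (?g J \<omega> / q (proj J (Z \<omega>))) \<partial>M) \<le> (\<integral>\<^sup>+y. ennreal (gauss_prod J y) \<partial>TJ)"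
      by (rule nn_integral_density_ratio_le[OF q]) (auto simp: less_imp_le[OF gauss_prod_pos])
    then show "(\<integral>\<^sup>+\<omega>. ennreal (?g J \<omega> / q (proj J (Z \<omega>))) \<partial>M) < \<infinity>"
      by (simp add: nn_integral_gauss_prod le_less_trans)
  qed (use qp g in \<open>auto simp: gauss_prod_pos\<close>)
qed

lemma gauss_prod_lborel: "(\<integral>\<^sup>+x. ennreal (gauss_prod I (proj I x) * gauss_prod J (proj J x)) \<partial>lborel) = 1"
proof -
  have "(\<integral>\<^sup>+x. ennreal (gauss_prod I (proj I x) * gauss_prod J (proj J x)) \<partial>lborel) =
      (\<integral>\<^sup>+x. ennreal (gauss_prod I (proj I x)) * ennreal (gauss_prod J (proj J x)) \<partial>lborel)"
    by (simp add: ennreal_mult less_imp_le[OF gauss_prod_pos])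
  also have "\<dots> = 1"
    by (subst nn_integral_split_prod) (auto simp: nn_integral_gauss_prod)
  finally show ?thesis .
qed

end

section \<open>Information loss and conditional entropy\<close>

context prob_space
begin

text \<open>\<open>S\<close> has density 1 with respect to its own law, so the joint density is that
  of the noise even if the law of \<open>S\<close> is singular.\<close>

lemma distributed_indep_pair:
  fixes f :: "'c::euclidean_space \<Rightarrow> real" and S :: "'a \<Rightarrow> 'c"
  assumes indep: "indep_var borel S borel N" and f: "distributed M lborel N f" "\<And>x. 0 \<le> f x"
  shows "distributed M (distr M borel S \<Otimes>\<^sub>M lborel) (\<lambda>\<omega>. (S \<omega>, N \<omega>)) (\<lambda>p. ennreal (f (snd p)))"
proof -
  have [measurable]: "S \<in> borel_measurable M" "N \<in> borel_measurable M"
    using indep by (auto simp: indep_var_distribution_eq)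
  interpret S: prob_space "distr M borel S" by (rule prob_space_distr) simp
  have S: "distr M (distr M borel S) S = distr M borel S" by (intro distr_cong) auto
  have N: "distr M lborel N = distr M borel N" by (intro distr_cong) auto
  have SN: "distr M (distr M borel S \<Otimes>\<^sub>M lborel) (\<lambda>\<omega>. (S \<omega>, N \<omega>)) = distr M (borel \<Otimes>\<^sub>M borel) (\<lambda>\<omega>. (S \<omega>, N \<omega>))"
    by (intro distr_cong) (auto intro!: sets_pair_measure_cong)
  have 1: "distributed M (distr M borel S) S (\<lambda>_. 1)"
    by (simp add: distributed_def S density_1)
  have "distributed M (distr M borel S \<Otimes>\<^sub>M lborel) (\<lambda>\<omega>. (S \<omega>, N \<omega>)) (\<lambda>(x, y). 1 * ennreal (f y))"
    by (rule distributed_joint_indep'[OF S.sigma_finite_measure_axioms lborel.sigma_finite_measure_axioms 1 f(1)])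
      (use indep in \<open>simp add: S N SN indep_var_distribution_eq\<close>)
  then show ?thesis by (simp add: split_beta')
qed

text \<open>Takes the place of conditioning on \<open>S\<close>: estimates are made at a fixed s by
  Lebesgue integrals, and Tonelli averages them over the law of \<open>S\<close>.\<close>

lemma nn_integral_indep_ratio_le:
  fixes f :: "'c::euclidean_space \<Rightarrow> real" and S :: "'a \<Rightarrow> 'c"
  assumes indep: "indep_var borel S borel N" and f: "distributed M lborel N f" "\<And>x. 0 \<le> f x"
    and [measurable]: "g \<in> borel_measurable (borel \<Otimes>\<^sub>M borel)" and g: "\<And>p. 0 \<le> g p"
    and le: "\<And>s. (\<integral>\<^sup>+n. ennreal (g (s, n)) \<partial>lborel) \<le> c"
  shows "(\<integral>\<^sup>+\<omega>. ennreal (g (S \<omega>, N \<omega>) / f (N \<omega>)) \<partial>M) \<le> c"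
proof -
  have [measurable]: "S \<in> borel_measurable M" using indep by (auto simp: indep_var_distribution_eq)
  interpret S: prob_space "distr M borel S" by (rule prob_space_distr) simp
  have [measurable]: "g \<in> borel_measurable (distr M borel S \<Otimes>\<^sub>M lborel)"
    by (subst measurable_cong_sets[OF sets_pair_measure_cong refl]) (auto intro: assms(4))
  have "(\<integral>\<^sup>+\<omega>. ennreal (g (S \<omega>, N \<omega>) / f (snd (S \<omega>, N \<omega>))) \<partial>M) \<le> (\<integral>\<^sup>+p. ennreal (g p) \<partial>(distr M borel S \<Otimes>\<^sub>M lborel))"
    by (rule nn_integral_density_ratio_le[OF distributed_indep_pair[OF indep f]]) (use f g in auto)
  also have "\<dots> = (\<integral>\<^sup>+s. \<integral>\<^sup>+n. ennreal (g (s, n)) \<partial>lborel \<partial>distr M borel S)"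
    by (rule lborel.nn_integral_fst[symmetric]) measurable
  also have "\<dots> \<le> (\<integral>\<^sup>+s. c \<partial>distr M borel S)" by (intro nn_integral_mono le)
  also have "\<dots> = c" by (simp add: S.emeasure_space_1[simplified])
  finally show ?thesis by simp
qed

text \<open>Translates of null sets are null, so the ratio bound for the indicator of the sum is 0;
  since \<open>f\<close> is almost surely positive at \<open>N\<close>, the indicator itself
  vanishes. Hence the sum is absolutely continuous whatever the law of \<open>S\<close>.\<close>

lemma AE_indep_sum_null:
  fixes f :: "'c::euclidean_space \<Rightarrow> real" and S :: "'a \<Rightarrow> 'c"
  assumes indep: "indep_var borel S borel N" and f: "distributed M lborel N f" "\<And>x. 0 \<le> f x"
    and A: "A \<in> null_sets lborel"
  shows "AE \<omega> in M. S \<omega> + N \<omega> \<notin> A"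
proof -
  have [measurable]: "A \<in> sets borel" using A by auto
  have "N \<in> borel_measurable M" "S \<in> borel_measurable M" using indep by (auto simp: indep_var_distribution_eq)
  note [measurable] = this
  have [measurable]: "f \<in> borel_measurable borel" using f by (auto simp: distributed_def)
  have "(\<integral>\<^sup>+\<omega>. ennreal (indicator A (fst (S \<omega>, N \<omega>) + snd (S \<omega>, N \<omega>)) / f (N \<omega>)) \<partial>M) \<le> 0"
  proof (rule nn_integral_indep_ratio_le[OF indep f])
    fix s
    have "(\<integral>\<^sup>+n. ennreal (indicator A (fst (s, n) + snd (s, n))) \<partial>lborel) = (\<integral>\<^sup>+n. indicator A (s + n) \<partial>lborel)"
      by (simp add: ennreal_indicator)
    also have "\<dots> = 0" using A by (subst nn_integral_lborel_translate) auto
    finally show "(\<integral>\<^sup>+n. ennreal (indicator A (fst (s, n) + snd (s, n))) \<partial>lborel) \<le> 0" by simp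
  qed auto
  then have "AE \<omega> in M. ennreal (indicator A (S \<omega> + N \<omega>) / f (N \<omega>)) = 0"
    by (subst (asm) le_zero_eq, subst (asm) nn_integral_0_iff_AE) auto
  then show ?thesis using distributed_AE_pos[OF f]
    by eventually_elim (auto simp: indicator_def split: if_splits)
qed

end

context orthogonal_split
begin

text \<open>In expectations of logarithms the claim reads E ln u + E ln fJ - E ln v <= E ln f: the
  densities \<open>p\<close> and \<open>q\<close> of the observation contribute equally to both
  sides, and that of the quantized signal cancels. Here u / v is the conditional density of the
  \<open>I\<close> part given the \<open>J\<close> part and the quantized signal, and f / fJ that of
  the noise. One Gibbs inequality compares the two directly, without passing through an entropy
  given \<open>S\<close> itself.\<close>

lemma information_loss_le:
  fixes S N :: "'a \<Rightarrow> real ^ 'n::_" and f :: "real ^ 'n::_ \<Rightarrow> real" and K :: "'k set"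
  assumes M: "prob_space M" and indep: "prob_space.indep_var M borel S borel N"
    and f: "distributed M lborel N f" "\<And>x. 0 \<le> f x"
    and int: "integrable M (\<lambda>\<omega>. ln (f (N \<omega>)))" "integrable M (\<lambda>\<omega>. (norm (N \<omega>))\<^sup>2)" "integrable M (\<lambda>\<omega>. (norm (S \<omega> + N \<omega>))\<^sup>2)"
    and K: "finite K" and h[measurable]: "h \<in> borel \<rightarrow>\<^sub>M count_space K"
  shows "prob_space.mutual_information M (exp 1) (count_space K) borel (\<lambda>\<omega>. h (S \<omega>)) (\<lambda>\<omega>. S \<omega> + N \<omega>) -
     prob_space.mutual_information M (exp 1) (count_space K) TJ (\<lambda>\<omega>. h (S \<omega>)) (\<lambda>\<omega>. proj J (S \<omega> + N \<omega>)) \<le>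
     prob_space.conditional_entropy M (exp 1) TI TJ (\<lambda>\<omega>. proj I (S \<omega> + N \<omega>)) (\<lambda>\<omega>. proj J (S \<omega> + N \<omega>)) -
     prob_space.conditional_entropy M (exp 1) TI TJ (\<lambda>\<omega>. proj I (N \<omega>)) (\<lambda>\<omega>. proj J (N \<omega>))"
proof -
  interpret prob_space M by fact
  have [measurable]: "S \<in> borel_measurable M" "N \<in> borel_measurable M"
    using indep by (auto simp: indep_var_distribution_eq)
  define X where "X \<omega> = S \<omega> + N \<omega>" for \<omega>
  define k where "k \<omega> = h (S \<omega>)" for \<omega>
  have X[measurable]: "X \<in> borel_measurable M" unfolding X_def[abs_def] by measurable
  have k[measurable]: "k \<in> M \<rightarrow>\<^sub>M count_space K" unfolding k_def[abs_def] by measurable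
  have kK: "h s \<in> K" for s using measurable_space[OF h, of s] by simp
  let ?C = "count_space K"
  note sf = sigma_finite_measure_count_space_finite[OF K]
  interpret C: sigma_finite_measure ?C by (rule sf)
  interpret CL: pair_sigma_finite ?C "lborel :: (real ^ 'n::_) measure" ..
  interpret CT: pair_sigma_finite ?C TJ ..
  have Xnull: "AE \<omega> in M. X \<omega> \<notin> A" if "A \<in> null_sets lborel" for A
    unfolding X_def by (rule AE_indep_sum_null[OF indep f that])
  have XJnull: "AE \<omega> in M. proj J (X \<omega>) \<notin> A" if "A \<in> null_sets TJ" for A
    by (rule AE_proj_null[OF Xnull that])
  obtain p :: "real ^ 'n::_ \<Rightarrow> real" where p: "distributed M lborel X p" "\<And>x. 0 \<le> p x"
    using distributed_realI[OF lborel.sigma_finite_measure_axioms _ Xnull] X by auto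
  obtain u :: "'k \<times> (real ^ 'n::_) \<Rightarrow> real" where u: "distributed M (?C \<Otimes>\<^sub>M lborel) (\<lambda>\<omega>. (k \<omega>, X \<omega>)) u" "\<And>x. 0 \<le> u x"
    using distributed_realI[OF CL.sigma_finite_measure_axioms _ AE_count_pair_null[OF lborel.sigma_finite_measure_axioms K k Xnull]]
    by auto
  obtain v :: "'k \<times> ('n \<Rightarrow> real) \<Rightarrow> real" where v: "distributed M (?C \<Otimes>\<^sub>M TJ) (\<lambda>\<omega>. (k \<omega>, proj J (X \<omega>))) v" "\<And>x. 0 \<le> v x"
    using distributed_realI[OF CT.sigma_finite_measure_axioms _ AE_count_pair_null[OF TJ.sigma_finite_measure_axioms K k XJnull]]
    by auto
  obtain q :: "('n \<Rightarrow> real) \<Rightarrow> real" where q: "distributed M TJ (\<lambda>\<omega>. proj J (X \<omega>)) q" "\<And>x. 0 \<le> q x"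
    using distributed_proj[OF M p(1)] by auto
  obtain fJ :: "('n \<Rightarrow> real) \<Rightarrow> real" where fJ: "distributed M TJ (\<lambda>\<omega>. proj J (N \<omega>)) fJ" "\<And>x. 0 \<le> fJ x"
    using distributed_proj[OF M f(1)] by auto
  obtain w :: "'k \<Rightarrow> real" where w: "distributed M ?C k w" "\<And>x. 0 \<le> w x"
    using distributed_realI[OF sf k] by (auto simp: null_sets_count_space)
  have [measurable]: "f \<in> borel_measurable borel" "p \<in> borel_measurable borel" "q \<in> borel_measurable TJ" "fJ \<in> borel_measurable TJ"
    "u \<in> borel_measurable (?C \<Otimes>\<^sub>M lborel)" "v \<in> borel_measurable (?C \<Otimes>\<^sub>M TJ)"
    using f p q u v fJ by (auto simp: distributed_def)
  note pos = distributed_AE_pos[OF f] distributed_AE_pos[OF p] distributed_AE_pos[OF u] distributed_AE_pos[OF v]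
    distributed_AE_pos[OF q] distributed_AE_pos[OF fJ]
  have intX: "integrable M (\<lambda>\<omega>. (norm (X \<omega>))\<^sup>2)" using int(3) by (simp add: X_def)
  note gX = integrable_ln_gauss_prod[OF M X intX]
  let ?g = "\<lambda>x. gauss_prod I (proj I x) * gauss_prod J (proj J x)"
  have ln_g: "integrable M (\<lambda>\<omega>. ln (?g (X \<omega>)))"
  proof -
    have "(\<lambda>\<omega>. ln (?g (X \<omega>))) = (\<lambda>\<omega>. ln (gauss_prod I (proj I (X \<omega>))) + ln (gauss_prod J (proj J (X \<omega>))))"
      by (auto simp: ln_mult gauss_prod_pos)
    then show ?thesis using gX by auto
  qed
  have total1: "(\<Sum>j\<in>K. \<integral>\<^sup>+x. ennreal (u (j, x)) \<partial>lborel) = 1"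
    using distributed_nn_integral[OF u(1), of "\<lambda>_. 1"]
    by (simp add: emeasure_space_1 count_pair_nn_integral[OF lborel.sigma_finite_measure_axioms K])
  have total2: "(\<Sum>j\<in>K. \<integral>\<^sup>+y. ennreal (v (j, y)) \<partial>TJ) = 1"
    using distributed_nn_integral[OF v(1), of "\<lambda>_. 1"]
    by (simp add: emeasure_space_1 count_pair_nn_integral[OF TJ.sigma_finite_measure_axioms K])
  have u_le1: "(\<integral>\<^sup>+x. ennreal (u (j, x)) \<partial>lborel) \<le> 1" if "j \<in> K" for j
    unfolding total1[symmetric] using that K by (intro member_le_sum) auto
  have p1: "(\<integral>\<^sup>+x. ennreal (p x) \<partial>lborel) = 1"
    using distributed_nn_integral[OF p(1), of "\<lambda>_. 1"] by (simp add: emeasure_space_1)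
  have fJ1: "(\<integral>\<^sup>+y. ennreal (fJ y) \<partial>TJ) = 1"
    using distributed_nn_integral[OF fJ(1), of "\<lambda>_. 1"] by (simp add: emeasure_space_1)
  \<comment> \<open>At fixed s the function \<open>p (s + n)\<close> of n is a density by
    translation invariance, so \<open>f\<close> serves as the upper comparison.\<close>
  have ln_p: "integrable M (\<lambda>\<omega>. ln (p (X \<omega>)))"
  proof (rule integrable_ln_between[where V = "\<lambda>\<omega>. f (N \<omega>)" and G = "\<lambda>\<omega>. ?g (X \<omega>)"])
    have "(\<integral>\<^sup>+\<omega>. ennreal ((\<lambda>(s, n). p (s + n)) (S \<omega>, N \<omega>) / f (N \<omega>)) \<partial>M) \<le> 1"
    proof (rule nn_integral_indep_ratio_le[OF indep f])
      show "(\<integral>\<^sup>+n. ennreal (case (s, n) of (s, n) \<Rightarrow> p (s + n)) \<partial>lborel) \<le> 1" for s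
        using nn_integral_lborel_translate[of "\<lambda>x. ennreal (p x)" s] p1 by simp
    qed (auto simp: p split: prod.split)
    then show "(\<integral>\<^sup>+\<omega>. ennreal (p (X \<omega>) / f (N \<omega>)) \<partial>M) < \<infinity>"
      by (simp add: X_def le_less_trans)
    have "(\<integral>\<^sup>+\<omega>. ennreal (?g (X \<omega>) / p (X \<omega>)) \<partial>M) \<le> 1"
      unfolding gauss_prod_lborel[symmetric] by (rule nn_integral_density_ratio_le[OF p]) auto
    then show "(\<integral>\<^sup>+\<omega>. ennreal (?g (X \<omega>) / p (X \<omega>)) \<partial>M) < \<infinity>" by (simp add: le_less_trans)
  qed (use pos ln_g int in \<open>auto simp: gauss_prod_pos\<close>)
  \<comment> \<open>At fixed s the slice of \<open>u\<close> at \<open>h s\<close> has integral at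
    most 1, which gives the upper ratio. Below, the Gaussian density has total mass
    \<open>card K\<close> over the slices, and finiteness suffices.\<close>
  have ln_u: "integrable M (\<lambda>\<omega>. ln (u (k \<omega>, X \<omega>)))"
  proof (rule integrable_ln_between[where V = "\<lambda>\<omega>. f (N \<omega>)" and G = "\<lambda>\<omega>. ?g (X \<omega>)"])
    have "(\<integral>\<^sup>+\<omega>. ennreal ((\<lambda>(s, n). u (h s, s + n)) (S \<omega>, N \<omega>) / f (N \<omega>)) \<partial>M) \<le> 1"
    proof (rule nn_integral_indep_ratio_le[OF indep f])
      show "(\<integral>\<^sup>+n. ennreal (case (s, n) of (s, n) \<Rightarrow> u (h s, s + n)) \<partial>lborel) \<le> 1" for s
        using nn_integral_lborel_translate[of "\<lambda>x. ennreal (u (h s, x))" s] u_le1[OF kK, of s] kK[of s] by simp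
    qed (auto simp: u split: prod.split)
    then show "(\<integral>\<^sup>+\<omega>. ennreal (u (k \<omega>, X \<omega>) / f (N \<omega>)) \<partial>M) < \<infinity>"
      by (simp add: X_def k_def le_less_trans)
    have "(\<integral>\<^sup>+\<omega>. ennreal (?g (snd (k \<omega>, X \<omega>)) / u (k \<omega>, X \<omega>)) \<partial>M) \<le> (\<integral>\<^sup>+r. ennreal (?g (snd r)) \<partial>(?C \<Otimes>\<^sub>M lborel))"
      by (rule nn_integral_density_ratio_le[OF u]) auto
    also have "\<dots> = card K"
      by (subst count_pair_nn_integral[OF lborel.sigma_finite_measure_axioms K]) (auto simp: gauss_prod_lborel)
    finally show "(\<integral>\<^sup>+\<omega>. ennreal (?g (X \<omega>) / u (k \<omega>, X \<omega>)) \<partial>M) < \<infinity>"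
      by (simp add: le_less_trans of_nat_less_top)
  qed (use pos ln_g int in \<open>auto simp: gauss_prod_pos\<close>)
  have ln_v: "integrable M (\<lambda>\<omega>. ln (v (k \<omega>, proj J (X \<omega>))))"
  proof (rule integrable_ln_between[where V = "\<lambda>\<omega>. u (k \<omega>, X \<omega>) / gauss_prod I (proj I (X \<omega>))" and G = "\<lambda>\<omega>. gauss_prod J (proj J (X \<omega>))"])
    show "AE \<omega> in M. 0 < u (k \<omega>, X \<omega>) / gauss_prod I (proj I (X \<omega>))"
      using pos(3) by eventually_elim (simp add: gauss_prod_pos)
    have "integrable M (\<lambda>\<omega>. ln (u (k \<omega>, X \<omega>)) - ln (gauss_prod I (proj I (X \<omega>))))" using ln_u gX by auto
    then show "integrable M (\<lambda>\<omega>. ln (u (k \<omega>, X \<omega>) / gauss_prod I (proj I (X \<omega>))))"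
      by (rule integrable_cong_AE_imp) (use pos(3) in \<open>auto simp: ln_div gauss_prod_pos elim!: eventually_mono\<close>)
    have "(\<integral>\<^sup>+\<omega>. ennreal (v (k \<omega>, proj J (X \<omega>)) / (u (k \<omega>, X \<omega>) / gauss_prod I (proj I (X \<omega>)))) \<partial>M) =
        (\<integral>\<^sup>+\<omega>. ennreal ((\<lambda>(j, x). gauss_prod I (proj I x) * v (j, proj J x)) (k \<omega>, X \<omega>) / u (k \<omega>, X \<omega>)) \<partial>M)"
      by (simp add: field_simps)
    also have "\<dots> \<le> (\<integral>\<^sup>+r. ennreal ((\<lambda>(j, x). gauss_prod I (proj I x) * v (j, proj J x)) r) \<partial>(?C \<Otimes>\<^sub>M lborel))"
      by (rule nn_integral_density_ratio_le[OF u]) (auto simp: v split: prod.split)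
    also have "\<dots> = (\<Sum>j\<in>K. \<integral>\<^sup>+x. ennreal (gauss_prod I (proj I x)) * ennreal (v (j, proj J x)) \<partial>lborel)"
      by (subst count_pair_nn_integral[OF lborel.sigma_finite_measure_axioms K]) (auto simp: ennreal_mult v)
    also have "\<dots> = (\<Sum>j\<in>K. \<integral>\<^sup>+y. ennreal (v (j, y)) \<partial>TJ)"
      by (intro sum.cong refl, subst nn_integral_split_prod) (auto simp: nn_integral_gauss_prod)
    finally show "(\<integral>\<^sup>+\<omega>. ennreal (v (k \<omega>, proj J (X \<omega>)) / (u (k \<omega>, X \<omega>) / gauss_prod I (proj I (X \<omega>)))) \<partial>M) < \<infinity>"
      unfolding total2 by (rule le_less_trans) simp
    have "(\<integral>\<^sup>+\<omega>. ennreal (gauss_prod J (snd (k \<omega>, proj J (X \<omega>))) / v (k \<omega>, proj J (X \<omega>))) \<partial>M) \<le> (\<integral>\<^sup>+r. ennreal (gauss_prod J (snd r)) \<partial>(?C \<Otimes>\<^sub>M TJ))"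
      by (rule nn_integral_density_ratio_le[OF v]) auto
    also have "\<dots> = card K"
      by (subst count_pair_nn_integral[OF TJ.sigma_finite_measure_axioms K]) (auto simp: nn_integral_gauss_prod)
    finally show "(\<integral>\<^sup>+\<omega>. ennreal (gauss_prod J (proj J (X \<omega>)) / v (k \<omega>, proj J (X \<omega>))) \<partial>M) < \<infinity>"
      by (simp add: le_less_trans of_nat_less_top)
  qed (use pos gX in \<open>auto simp: gauss_prod_pos\<close>)
  have ln_q: "integrable M (\<lambda>\<omega>. ln (q (proj J (X \<omega>))))"
    by (rule integrable_ln_proj_density[OF M p q ln_p intX])
  have ln_fJ: "integrable M (\<lambda>\<omega>. ln (fJ (proj J (N \<omega>))))"
    by (rule integrable_ln_proj_density[OF M f fJ int(1,2)])

  \<comment> \<open>\<open>u\<close> and \<open>v\<close> come from separate applications of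
    Radon-Nikodym. That \<open>v\<close> is the \<open>J\<close>-marginal of \<open>u\<close> in
    each slice is recovered by testing both joint laws against the same function; the indicator
    \<open>?i\<close> selects the slice.\<close>
  have marginal: "(\<integral>\<^sup>+x. ennreal (u (j, x)) * H (proj J x) \<partial>lborel) = (\<integral>\<^sup>+y. ennreal (v (j, y)) * H y \<partial>TJ)"
    if [measurable]: "H \<in> borel_measurable TJ" and j: "j \<in> K" for H j
  proof -
    let ?i = "\<lambda>i. indicator {j} i :: ennreal"
    have [measurable]: "(\<lambda>r. ?i (fst r)) \<in> borel_measurable (?C \<Otimes>\<^sub>M T)" for T :: "'t measure"
      by (rule measurable_compose[OF measurable_fst]) simp
    have "(\<integral>\<^sup>+x. ennreal (u (j, x)) * H (proj J x) \<partial>lborel) = (\<Sum>i\<in>K. \<integral>\<^sup>+x. ennreal (u (i, x)) * (?i i * H (proj J x)) \<partial>lborel)"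
      using j K by (subst sum.remove[of K j]) (auto simp: indicator_def intro!: sum.neutral)
    also have "\<dots> = (\<integral>\<^sup>+r. ennreal (u r) * (?i (fst r) * H (proj J (snd r))) \<partial>(?C \<Otimes>\<^sub>M lborel))"
      by (subst count_pair_nn_integral[OF lborel.sigma_finite_measure_axioms K]) auto
    also have "\<dots> = (\<integral>\<^sup>+\<omega>. ?i (fst (k \<omega>, X \<omega>)) * H (proj J (snd (k \<omega>, X \<omega>))) \<partial>M)"
      by (rule distributed_nn_integral[OF u(1)]) measurable
    also have "\<dots> = (\<integral>\<^sup>+\<omega>. ?i (fst (k \<omega>, proj J (X \<omega>))) * H (snd (k \<omega>, proj J (X \<omega>))) \<partial>M)" by simp
    also have "\<dots> = (\<integral>\<^sup>+r. ennreal (v r) * (?i (fst r) * H (snd r)) \<partial>(?C \<Otimes>\<^sub>M TJ))"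
      by (rule distributed_nn_integral[OF v(1), symmetric]) measurable
    also have "\<dots> = (\<Sum>i\<in>K. \<integral>\<^sup>+y. ennreal (v (i, y)) * (?i i * H y) \<partial>TJ)"
      by (subst count_pair_nn_integral[OF TJ.sigma_finite_measure_axioms K]) auto
    also have "\<dots> = (\<integral>\<^sup>+y. ennreal (v (j, y)) * H y \<partial>TJ)"
      using j K by (subst sum.remove[of K j]) (auto simp: indicator_def intro!: sum.neutral)
    finally show ?thesis .
  qed

  \<comment> \<open>Gibbs' inequality: given \<open>S\<close>, the quotient \<open>u / v * fJ\<close> is a subdensity, to be compared with the density \<open>f\<close> of \<open>N\<close>.\<close>
  have gibbs: "expectation (\<lambda>\<omega>. ln (u (k \<omega>, X \<omega>) * fJ (proj J (N \<omega>)) / v (k \<omega>, proj J (X \<omega>)))) \<le> expectation (\<lambda>\<omega>. ln (f (N \<omega>)))"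
  proof (rule integral_ln_le)
    show "AE \<omega> in M. 0 < u (k \<omega>, X \<omega>) * fJ (proj J (N \<omega>)) / v (k \<omega>, proj J (X \<omega>))"
      using pos(3,4,6) by eventually_elim simp
    have i: "integrable M (\<lambda>\<omega>. ln (u (k \<omega>, X \<omega>)) + ln (fJ (proj J (N \<omega>))) - ln (v (k \<omega>, proj J (X \<omega>))))"
      using ln_u ln_v ln_fJ by auto
    have e: "AE \<omega> in M. ln (u (k \<omega>, X \<omega>)) + ln (fJ (proj J (N \<omega>))) - ln (v (k \<omega>, proj J (X \<omega>))) = ln (u (k \<omega>, X \<omega>) * fJ (proj J (N \<omega>)) / v (k \<omega>, proj J (X \<omega>)))"
      using pos(3,4,6) by eventually_elim (simp add: ln_mult ln_div)
    show "integrable M (\<lambda>\<omega>. ln (u (k \<omega>, X \<omega>) * fJ (proj J (N \<omega>)) / v (k \<omega>, proj J (X \<omega>))))"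
      by (rule integrable_cong_AE_imp[OF i _ e]) measurable
    let ?G = "\<lambda>(s, n). u (h s, s + n) * fJ (proj J n) / v (h s, proj J (s + n))"
    have "(\<integral>\<^sup>+\<omega>. ennreal (?G (S \<omega>, N \<omega>) / f (N \<omega>)) \<partial>M) \<le> 1"
    proof (rule nn_integral_indep_ratio_le[OF indep f])
      fix s
      note kK[of s, measurable]
      \<comment> \<open>With x = s + n the noise subvector is that of x shifted by -
        \<open>proj J s\<close>. Apart from \<open>u\<close>, the integrand then depends on x
        through \<open>proj J x\<close> only, so \<open>marginal\<close> trades \<open>u\<close> for
        \<open>v\<close>, which cancels the denominator.\<close>
      let ?t = "\<lambda>y. (\<lambda>i\<in>J. - proj J s i + y i)"
      have shift: "proj J (x - s) = ?t (proj J x)" for x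
        by (auto simp: proj_def subvector_def matrix_vector_mult_diff_distrib fun_eq_iff)
      have [measurable]: "?t \<in> TJ \<rightarrow>\<^sub>M TJ"
        by (intro measurable_restrict) (auto intro!: borel_measurable_add)
      have [measurable]: "(\<lambda>y. v (h s, y)) \<in> borel_measurable TJ" "(\<lambda>x. u (h s, x)) \<in> borel_measurable borel"
        using kK[of s] by measurable
      have "(\<integral>\<^sup>+n. ennreal (?G (s, n)) \<partial>lborel) = (\<integral>\<^sup>+n. (\<lambda>x. ennreal (u (h s, x) * fJ (proj J (x - s)) / v (h s, proj J x))) (s + n) \<partial>lborel)"
        by simp
      also have "\<dots> = (\<integral>\<^sup>+x. ennreal (u (h s, x) * fJ (proj J (x - s)) / v (h s, proj J x)) \<partial>lborel)"
        by (rule nn_integral_lborel_translate) measurable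
      also have "\<dots> = (\<integral>\<^sup>+x. ennreal (u (h s, x)) * (\<lambda>y. ennreal (fJ (?t y) / v (h s, y))) (proj J x) \<partial>lborel)"
        by (simp add: shift ennreal_mult'[symmetric] u)
      also have "\<dots> = (\<integral>\<^sup>+y. ennreal (v (h s, y)) * ennreal (fJ (?t y) / v (h s, y)) \<partial>TJ)"
        by (rule marginal[OF _ kK]) measurable
      also have "\<dots> \<le> (\<integral>\<^sup>+y. ennreal (fJ (?t y)) \<partial>TJ)"
        by (intro nn_integral_mono) (auto simp: ennreal_mult'[symmetric] v fJ)
      also have "\<dots> = 1" using nn_integral_subvector_translate[of J "\<lambda>y. ennreal (fJ y)" "\<lambda>i. - proj J s i"] fJ1 by simp
      finally show "(\<integral>\<^sup>+n. ennreal (?G (s, n)) \<partial>lborel) \<le> 1" .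
    qed (auto simp: u v fJ split: prod.split)
    then show "(\<integral>\<^sup>+\<omega>. ennreal (u (k \<omega>, X \<omega>) * fJ (proj J (N \<omega>)) / v (k \<omega>, proj J (X \<omega>)) / f (N \<omega>)) \<partial>M) \<le> 1"
      by (simp add: X_def k_def)
  qed (use pos int in auto)
  have "expectation (\<lambda>\<omega>. ln (u (k \<omega>, X \<omega>) * fJ (proj J (N \<omega>)) / v (k \<omega>, proj J (X \<omega>)))) =
      expectation (\<lambda>\<omega>. ln (u (k \<omega>, X \<omega>)) + ln (fJ (proj J (N \<omega>))) - ln (v (k \<omega>, proj J (X \<omega>))))"
    by (rule integral_cong_AE) (use pos(3,4,6) in \<open>measurable, eventually_elim, simp add: ln_mult ln_div\<close>)
  also have "\<dots> = expectation (\<lambda>\<omega>. ln (u (k \<omega>, X \<omega>))) + expectation (\<lambda>\<omega>. ln (fJ (proj J (N \<omega>)))) - expectation (\<lambda>\<omega>. ln (v (k \<omega>, proj J (X \<omega>))))"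
    using ln_u ln_v ln_fJ by simp
  finally have main: "expectation (\<lambda>\<omega>. ln (u (k \<omega>, X \<omega>))) + expectation (\<lambda>\<omega>. ln (fJ (proj J (N \<omega>)))) - expectation (\<lambda>\<omega>. ln (v (k \<omega>, proj J (X \<omega>)))) \<le> expectation (\<lambda>\<omega>. ln (f (N \<omega>)))"
    using gibbs by simp

  have ce: "conditional_entropy (exp 1) TI TJ (\<lambda>\<omega>. proj I (Z \<omega>)) (\<lambda>\<omega>. proj J (Z \<omega>)) =
      expectation (\<lambda>\<omega>. ln (q' (proj J (Z \<omega>)))) - expectation (\<lambda>\<omega>. ln (p' (Z \<omega>)))"
    if p': "distributed M lborel Z p'" "\<And>x. 0 \<le> p' x" and q': "distributed M TJ (\<lambda>\<omega>. proj J (Z \<omega>)) q'" "\<And>x. 0 \<le> q' x"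
      and i: "integrable M (\<lambda>\<omega>. ln (p' (Z \<omega>)))" "integrable M (\<lambda>\<omega>. ln (q' (proj J (Z \<omega>))))" for Z and p' :: "real ^ 'n::_ \<Rightarrow> real" and q'
  proof -
    have [measurable]: "Z \<in> borel_measurable M" "p' \<in> borel_measurable borel" "q' \<in> borel_measurable TJ"
      using p' q' by (auto simp: distributed_def)
    have "expectation (\<lambda>\<omega>. ln (p' (Z \<omega>) / q' (proj J (Z \<omega>)))) = expectation (\<lambda>\<omega>. ln (p' (Z \<omega>)) - ln (q' (proj J (Z \<omega>))))"
      by (rule integral_cong_AE)
        (use distributed_AE_pos[OF p'] distributed_AE_pos[OF q'] in \<open>measurable, eventually_elim, simp add: ln_div\<close>)
    then show ?thesis using i by (simp add: conditional_entropy_split[OF M p' q'])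
  qed
  have "mutual_information (exp 1) ?C borel k X =
      expectation (\<lambda>\<omega>. ln (u (k \<omega>, X \<omega>))) - expectation (\<lambda>\<omega>. ln (w (k \<omega>))) - expectation (\<lambda>\<omega>. ln (p (X \<omega>)))"
    by (rule mutual_information_count[OF lborel.sigma_finite_measure_axioms K p w u ln_u ln_p]) simp
  moreover have "mutual_information (exp 1) ?C TJ k (\<lambda>\<omega>. proj J (X \<omega>)) =
      expectation (\<lambda>\<omega>. ln (v (k \<omega>, proj J (X \<omega>)))) - expectation (\<lambda>\<omega>. ln (w (k \<omega>))) - expectation (\<lambda>\<omega>. ln (q (proj J (X \<omega>))))"
    by (rule mutual_information_count[where Z = "\<lambda>\<omega>. proj J (X \<omega>)" and p = q and u = v and w = w and k = k, OF TJ.sigma_finite_measure_axioms K q w v ln_v ln_q]) simp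
  ultimately have "mutual_information (exp 1) ?C borel k X - mutual_information (exp 1) ?C TJ k (\<lambda>\<omega>. proj J (X \<omega>)) \<le>
     conditional_entropy (exp 1) TI TJ (\<lambda>\<omega>. proj I (X \<omega>)) (\<lambda>\<omega>. proj J (X \<omega>)) -
     conditional_entropy (exp 1) TI TJ (\<lambda>\<omega>. proj I (N \<omega>)) (\<lambda>\<omega>. proj J (N \<omega>))"
    using main ce[OF p q ln_p ln_q] ce[OF f fJ int(1) ln_fJ] by simp
  then show ?thesis by (simp add: X_def[abs_def] k_def[abs_def])
qed

end

section \<open>Conditional entropy of Gaussian vectors\<close>

text \<open>An orthonormal eigenbasis with positive eigenvalues encodes symmetry and positive
  definiteness of \<open>C\<close> in the form in which the Gaussian density factors.\<close>

locale gaussian_eigenbasis =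
  fixes C :: "real ^ 'n::{finite,wellorder} ^ 'n::_" and q :: "'n \<Rightarrow> real ^ 'n::_" and l :: "'n \<Rightarrow> real" and m :: "real ^ 'n::_"
  assumes on: "orthonormal q" and ev: "\<And>i. C *v q i = l i *\<^sub>R q i" and l_pos: "\<And>i. 0 < l i"
begin

abbreviation "G \<equiv> gaussian_measure m C"

abbreviation "p \<equiv> gaussian_density m C"

lemma mult_expansion: "C *v x = (\<Sum>i\<in>UNIV. (l i * (q i \<bullet> x)) *\<^sub>R q i)"
proof -
  have "C *v (\<Sum>i\<in>UNIV. (q i \<bullet> x) *\<^sub>R q i) = (\<Sum>i\<in>UNIV. (l i * (q i \<bullet> x)) *\<^sub>R q i)"
    by (simp add: linear_sum[OF matrix_vector_mul_linear] linear_scale[OF matrix_vector_mul_linear] ev mult.commute)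
  then show ?thesis by (simp add: orthonormal_expansion[OF on])
qed

lemma quadratic: "(C *v u) \<bullet> u = (\<Sum>i\<in>UNIV. l i * (q i \<bullet> u)\<^sup>2)"
  by (simp add: mult_expansion inner_sum_left power2_eq_square mult.assoc)

lemma quadratic_pos: "u \<noteq> 0 \<Longrightarrow> 0 < (C *v u) \<bullet> u"
proof -
  assume "u \<noteq> 0"
  then have "0 < u \<bullet> u" by simp
  then have "0 < (\<Sum>i\<in>UNIV. (q i \<bullet> u) * (q i \<bullet> u))" using orthonormal_parseval[OF on, of u u] by simp
  then obtain i where "(q i \<bullet> u) * (q i \<bullet> u) \<noteq> 0" by (metis (no_types, lifting) less_irrefl sum.neutral)
  then have "0 < l i * (q i \<bullet> u)\<^sup>2" using l_pos by simp
  then show ?thesis unfolding quadratic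
    by (intro sum_pos2[of UNIV i]) (auto simp: l_pos less_imp_le)
qed

lemma quadratic_le: "(\<And>i. l i \<le> \<beta>) \<Longrightarrow> (C *v u) \<bullet> u \<le> \<beta> * (u \<bullet> u)"
  unfolding quadratic orthonormal_parseval[OF on, of u u] sum_distrib_left power2_eq_square[symmetric]
  by (intro sum_mono mult_right_mono) auto

lemma density_eq: "p x = (\<Prod>i\<in>UNIV. normal_density 0 (sqrt (l i)) (q i \<bullet> (x - m)))"
proof -
  have det: "det C = (\<Prod>i\<in>UNIV. l i)" by (rule det_eigenbasis[OF on ev])
  have "invertible C" using l_pos by (simp add: invertible_det_nz det less_imp_neq[THEN not_sym])
  then have inv: "matrix_inv C ** C = mat 1" 
    unfolding invertible_def matrix_inv_def by (rule someI2_ex) blast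
  define y where "y = x - m"
  \<comment> \<open>Chosen as the solution of \<open>C *v z = y\<close>, which gives the action of
    the inverse matrix on y in the eigenbasis.\<close>
  define z where "z = (\<Sum>i\<in>UNIV. (q i \<bullet> y / l i) *\<^sub>R q i)"
  have "C *v z = (\<Sum>i\<in>UNIV. (q i \<bullet> y) *\<^sub>R q i)"
    unfolding z_def using l_pos[THEN less_imp_neq, THEN not_sym]
    by (simp add: linear_sum[OF matrix_vector_mul_linear] linear_scale[OF matrix_vector_mul_linear] ev)
  then have "C *v z = y" by (simp add: orthonormal_expansion[OF on])
  then have "matrix_inv C *v y = z" using inv by (metis matrix_vector_mul_assoc matrix_vector_mul_lid)
  then have 1: "y \<bullet> (matrix_inv C *v y) = (\<Sum>i\<in>UNIV. (q i \<bullet> y)\<^sup>2 / l i)"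
    by (simp add: z_def inner_sum_right inner_commute power2_eq_square)
  have 2: "(2 * pi) ^ CARD('n) * det C = (\<Prod>i\<in>UNIV. 2 * pi * l i)"
    by (simp add: det prod.distrib power_mult_distrib)
  have "(\<Prod>i\<in>UNIV. normal_density 0 (sqrt (l i)) (q i \<bullet> y)) =
      (\<Prod>i\<in>UNIV. exp (- (q i \<bullet> y)\<^sup>2 / (2 * l i))) / (\<Prod>i\<in>UNIV. sqrt (2 * pi * l i))"
    using less_imp_le[OF l_pos] by (simp add: normal_density_def prod_dividef[symmetric])
  also have "(\<Prod>i\<in>UNIV. exp (- (q i \<bullet> y)\<^sup>2 / (2 * l i))) = exp (\<Sum>i\<in>UNIV. - (q i \<bullet> y)\<^sup>2 / (2 * l i))"
    by (simp add: exp_sum)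
  also have "(\<Sum>i\<in>UNIV. - (q i \<bullet> y)\<^sup>2 / (2 * l i)) = - (\<Sum>i\<in>UNIV. (q i \<bullet> y)\<^sup>2 / l i) / 2"
    by (simp add: sum_negf sum_divide_distrib mult.commute)
  also have "(\<Prod>i\<in>UNIV. sqrt (2 * pi * l i)) = sqrt (\<Prod>i\<in>UNIV. 2 * pi * l i)"
    by (induct rule: finite_induct[OF finite]) (simp_all add: real_sqrt_mult)
  finally show ?thesis unfolding gaussian_density_def y_def[symmetric] 1 2 by simp
qed

lemma density_pos: "0 < p x"
  unfolding density_eq by (intro prod_pos ballI normal_density_pos) (simp add: l_pos)

lemma measurable_density [measurable]: "p \<in> borel_measurable borel"
  unfolding density_eq[abs_def] by measurable

text \<open>In the eigenbasis the Gaussian law is a product of normal laws, which reduces total mass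
  and moments to one-dimensional integrals.\<close>

lemma distributed_eigen_coordinates:
  "distributed G (subvector_lborel UNIV) (\<lambda>x. \<lambda>i\<in>UNIV. q i \<bullet> (x - m))
     (\<lambda>z. ennreal (\<Prod>i\<in>UNIV. normal_density 0 (sqrt (l i)) (z i)))"
proof -
  let ?T = "subvector_lborel (UNIV :: 'n set)"
  let ?Q = "matrix_of_columns q"
  let ?s = "\<lambda>x. \<lambda>i\<in>UNIV. q i \<bullet> (x - m)"
  let ?t = "\<lambda>z. m + ?Q *v (\<chi> i. z i)"
  let ?r = "\<lambda>z. ennreal (\<Prod>i\<in>UNIV. normal_density 0 (sqrt (l i)) (z i))"
  have [measurable]: "?s \<in> borel \<rightarrow>\<^sub>M ?T" by (intro measurable_restrict) measurable
  have [measurable]: "?t \<in> borel_measurable ?T" by measurable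
  have r[measurable]: "?r \<in> borel_measurable ?T"
    by (intro measurable_compose[OF _ measurable_ennreal] borel_measurable_prod
        measurable_compose[OF measurable_component_singleton, of _ UNIV "\<lambda>_. lborel"]) auto
  have "lborel = distr (distr (distr ?T borel (\<lambda>f. \<chi> i. f i)) borel ((*v) ?Q)) borel ((+) m)"
    unfolding lborel_vec_eq_PiM lborel_distr_orthogonal[OF orthogonal_matrix_of_columns[OF on]]
    by (rule lborel_distr_plus[symmetric])
  also have "\<dots> = distr ?T borel ?t"
    by (simp add: distr_distr comp_def)
  finally have lb: "lborel = distr ?T borel ?t" .
  have qz: "q i \<bullet> (?Q *v (\<chi> i. z i)) = z i" for i z
    by (simp add: matrix_of_columns_mult inner_sum_right on[rule_format] if_distrib cong: if_cong)
  have st: "?s (?t z) = z" if "z \<in> space ?T" for z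
    using that by (auto simp: qz)
  have "distr G ?T ?s = distr (density (distr ?T borel ?t) (\<lambda>x. ennreal (p x))) ?T ?s"
    by (simp add: gaussian_measure_def lb[symmetric])
  also have "\<dots> = distr (distr (density ?T (\<lambda>z. ennreal (p (?t z)))) borel ?t) ?T ?s"
    by (subst density_distr) auto
  also have "\<dots> = distr (density ?T (\<lambda>z. ennreal (p (?t z)))) ?T (\<lambda>z. ?s (?t z))"
    by (subst distr_distr) (auto simp: comp_def)
  also have "\<dots> = distr (density ?T (\<lambda>z. ennreal (p (?t z)))) ?T (\<lambda>z. z)"
    by (rule distr_cong) (use st in auto)
  also have "\<dots> = density ?T (\<lambda>z. ennreal (p (?t z)))" by (simp add: distr_id2)
  also have "\<dots> = density ?T ?r"
  proof (rule density_cong)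
    show "AE z in ?T. ennreal (p (?t z)) = ?r z" by (intro AE_I2) (simp add: density_eq qz)
  qed auto
  finally show ?thesis by (simp add: distributed_def gaussian_measure_def)
qed

lemma prob_space_G: "prob_space G"
proof
  have "(\<integral>\<^sup>+x. 1 \<partial>G) = (\<integral>\<^sup>+z. ennreal (\<Prod>i\<in>UNIV. normal_density 0 (sqrt (l i)) (z i)) * 1 \<partial>subvector_lborel UNIV)"
    by (rule distributed_nn_integral[OF distributed_eigen_coordinates, symmetric]) simp
  also have "\<dots> = 1" using l_pos by (simp add: nn_integral_prod_normal)
  finally show "emeasure G (space G) = 1" by simp
qed

sublocale G: prob_space G by (rule prob_space_G)

lemma distributed_G: "distributed G lborel (\<lambda>x. x) (\<lambda>x. ennreal (p x))"
  by (simp add: distributed_def gaussian_measure_def distr_id2)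

lemma nn_integral_density: "(\<integral>\<^sup>+x. ennreal (p x) \<partial>lborel) = 1"
  using distributed_nn_integral[OF distributed_G, of "\<lambda>_. 1"] G.emeasure_space_1 by simp

lemma eigen_moments:
  "integrable G (\<lambda>x. (q i \<bullet> (x - m)) * (q j \<bullet> (x - m)))"
  "G.expectation (\<lambda>x. (q i \<bullet> (x - m)) * (q j \<bullet> (x - m))) = (if i = j then l i else 0)"
proof -
  interpret product_sigma_finite "\<lambda>_::'n. lborel :: real measure" by standard
  let ?T = "subvector_lborel (UNIV :: 'n set)"
  \<comment> \<open>Exponent of coordinate k in the monomial z_i z_j, so that variances and mixed
    moments are both products of one-dimensional moments.\<close>
  define e :: "'n \<Rightarrow> nat" where "e k = (if k = i then 1 else 0) + (if k = j then 1 else 0)" for k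
  let ?f = "\<lambda>k x. normal_density 0 (sqrt (l k)) x * x ^ e k"
  have s: "0 < sqrt (l k)" for k by (simp add: l_pos)
  have int: "integrable lborel (?f k)" for k
    using integrable_normal_moment[OF s[of k], where \<mu> = 0 and k = "e k"] by simp
  have eq: "(\<Prod>k\<in>UNIV. ?f k (z k)) = (\<Prod>k\<in>UNIV. normal_density 0 (sqrt (l k)) (z k)) * (z i * z j)" for z
  proof -
    have "(\<Prod>k\<in>UNIV. z k ^ e k) = z i * z j"
      by (simp add: e_def power_add prod.distrib if_distrib[of "\<lambda>n. _ ^ n"] prod.delta cong: if_cong)
    then show ?thesis by (simp add: prod.distrib)
  qed
  have [measurable]: "(\<lambda>z. z i * z j) \<in> borel_measurable ?T"
    by (intro borel_measurable_times measurable_compose[OF measurable_component_singleton, of _ UNIV "\<lambda>_. lborel"]) auto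
  have nn: "0 \<le> (\<Prod>k\<in>UNIV. normal_density 0 (sqrt (l k)) (z k))" for z by (intro prod_nonneg) simp
  have "integrable ?T (\<lambda>z. \<Prod>k\<in>UNIV. ?f k (z k))" by (rule product_integrable_prod) (use int in auto)
  then show "integrable G (\<lambda>x. (q i \<bullet> (x - m)) * (q j \<bullet> (x - m)))"
    unfolding eq using distributed_integrable[OF distributed_eigen_coordinates, of "\<lambda>z. z i * z j"] nn by simp
  have "G.expectation (\<lambda>x. (q i \<bullet> (x - m)) * (q j \<bullet> (x - m))) = (\<integral>z. (\<Prod>k\<in>UNIV. ?f k (z k)) \<partial>?T)"
    unfolding eq using distributed_integral[OF distributed_eigen_coordinates, of "\<lambda>z. z i * z j"] nn by simp
  also have "\<dots> = (\<Prod>k\<in>UNIV. \<integral>x. ?f k x \<partial>lborel)" by (rule product_integral_prod) (use int in auto)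
  also have "\<dots> = (if i = j then l i else 0)"
  proof (cases "i = j")
    case True
    have "(\<integral>x. ?f k x \<partial>lborel) = (if k = i then l i else 1)" for k
    proof (cases "k = i")
      case True
      then have "e k = 2" using \<open>i = j\<close> by (simp add: e_def)
      then show ?thesis
        using integral_normal_moment_even[OF s[of i], where \<mu> = 0 and k = 1] l_pos[of i] True by simp
    next
      case False
      then show ?thesis using \<open>i = j\<close> s by (simp add: e_def)
    qed
    then show ?thesis using True by (simp add: prod.delta)
  next
    case False
    have "(\<integral>x. ?f i x \<partial>lborel) = 0"
      using integral_normal_moment_odd[OF s[of i], where \<mu> = 0 and k = 0] False by (simp add: e_def)
    then have "(\<Prod>k\<in>UNIV. \<integral>x. ?f k x \<partial>lborel) = 0" by (intro prod_zero) auto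
    then show ?thesis using False by simp
  qed
  finally show "G.expectation (\<lambda>x. (q i \<bullet> (x - m)) * (q j \<bullet> (x - m))) = (if i = j then l i else 0)" .
qed

text \<open>The covariance tested along one direction, which is what expected logarithms of normal
  densities involve.\<close>

lemma second_moment:
  "integrable G (\<lambda>x. (u \<bullet> (x - m))\<^sup>2)" "G.expectation (\<lambda>x. (u \<bullet> (x - m))\<^sup>2) = (C *v u) \<bullet> u"
proof -
  have eq: "(u \<bullet> (x - m))\<^sup>2 = (\<Sum>i\<in>UNIV. \<Sum>j\<in>UNIV. (q i \<bullet> u) * (q j \<bullet> u) * ((q i \<bullet> (x - m)) * (q j \<bullet> (x - m))))" for x
    unfolding orthonormal_parseval[OF on, of u] power2_eq_square sum_product by (simp add: mult_ac)
  show "integrable G (\<lambda>x. (u \<bullet> (x - m))\<^sup>2)"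
    unfolding eq by (intro Bochner_Integration.integrable_sum integrable_mult_right eigen_moments)
  have "G.expectation (\<lambda>x. (u \<bullet> (x - m))\<^sup>2) = (\<Sum>i\<in>UNIV. \<Sum>j\<in>UNIV. (q i \<bullet> u) * (q j \<bullet> u) * (if i = j then l i else 0))"
    unfolding eq by (simp add: eigen_moments Bochner_Integration.integral_sum Bochner_Integration.integrable_sum integrable_mult_right)
  also have "\<dots> = (C *v u) \<bullet> u"
    by (simp add: quadratic if_distrib power2_eq_square mult_ac cong: if_cong)
  finally show "G.expectation (\<lambda>x. (u \<bullet> (x - m))\<^sup>2) = (C *v u) \<bullet> u" .
qed

lemma integrable_norm: "integrable G (\<lambda>x. (norm x)\<^sup>2)"
proof -
  have [measurable_cong]: "sets G = sets borel" by (simp add: gaussian_measure_def)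
  have "(norm (x - m))\<^sup>2 = (\<Sum>i\<in>UNIV. (q i \<bullet> (x - m))\<^sup>2)" for x
    unfolding power2_norm_eq_inner by (subst orthonormal_parseval[OF on]) (simp add: power2_eq_square)
  then have "integrable G (\<lambda>x. (norm ((x - m) + m))\<^sup>2)"
    using second_moment(1) by (intro integrable_norm_square_add) simp_all
  then show ?thesis by simp
qed

text \<open>Each logarithm is quadratic in one projection, so only the variances along the
  directions \<open>b i\<close> enter, whether or not the projections are correlated. A direction of
  variance v contributes minus the normal entropy ln (2 pi e v) / 2.\<close>

lemma expectation_ln_normal:
  assumes "finite K" "\<And>i. i \<in> K \<Longrightarrow> 0 < (C *v b i) \<bullet> b i"
  shows "integrable G (\<lambda>x. ln (\<Prod>i\<in>K. normal_density 0 (sqrt ((C *v b i) \<bullet> b i)) (b i \<bullet> (x - m))))" (is ?A)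
    and "G.expectation (\<lambda>x. ln (\<Prod>i\<in>K. normal_density 0 (sqrt ((C *v b i) \<bullet> b i)) (b i \<bullet> (x - m)))) =
      - (\<Sum>i\<in>K. ln (2 * pi * ((C *v b i) \<bullet> b i)) / 2 + 1 / 2)" (is ?B)
proof -
  let ?v = "\<lambda>i. (C *v b i) \<bullet> b i"
  have eq: "ln (\<Prod>i\<in>K. normal_density 0 (sqrt (?v i)) (b i \<bullet> (x - m))) =
     (\<Sum>i\<in>K. - ln (2 * pi * ?v i) / 2 - (b i \<bullet> (x - m))\<^sup>2 / (2 * ?v i))" for x
    using assms by (subst ln_prod) (auto simp: ln_normal_density normal_density_pos[THEN less_imp_neq, THEN not_sym] less_imp_le intro!: sum.cong)
  show ?A unfolding eq using second_moment(1) by (intro Bochner_Integration.integrable_sum) auto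
  have "G.expectation (\<lambda>x. \<Sum>i\<in>K. - ln (2 * pi * ?v i) / 2 - (b i \<bullet> (x - m))\<^sup>2 / (2 * ?v i)) =
      (\<Sum>i\<in>K. - ln (2 * pi * ?v i) / 2 - ?v i / (2 * ?v i))"
    using second_moment by (subst Bochner_Integration.integral_sum) (auto simp: G.prob_space)
  also have "\<dots> = - (\<Sum>i\<in>K. ln (2 * pi * ?v i) / 2 + 1 / 2)"
    unfolding sum_negf[symmetric] by (intro sum.cong) (use assms(2) in \<open>auto simp: less_imp_neq[THEN not_sym]\<close>)
  finally show ?B unfolding eq .
qed

lemma eigen_value: "(C *v q i) \<bullet> q i = l i"
  using on by (simp add: ev)

lemma expectation_ln_density:
  "integrable G (\<lambda>x. ln (p x))" "G.expectation (\<lambda>x. ln (p x)) = - (\<Sum>i\<in>UNIV. ln (2 * pi * l i) / 2 + 1 / 2)"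
  using expectation_ln_normal[of UNIV q] by (simp_all add: eigen_value l_pos density_eq)

end

text \<open>The product is the Gaussian density of the matrix with eigenbasis \<open>b\<close> and
  eigenvalues \<open>(s i)\<^sup>2\<close>, so its mass is already known.\<close>

lemma nn_integral_orthonormal_normal:
  fixes b :: "'n::{finite,wellorder} \<Rightarrow> real ^ 'n::_"
  assumes "orthonormal b" "\<And>i. 0 < s i"
  shows "(\<integral>\<^sup>+x. ennreal (\<Prod>i\<in>UNIV. normal_density 0 (s i) (b i \<bullet> (x - m))) \<partial>lborel) = 1"
proof -
  let ?Q = "matrix_of_columns b"
  define C where "C = ?Q ** (\<chi> i j. if i = j then (s i)\<^sup>2 else 0) ** transpose ?Q"
  have "C *v b i = (s i)\<^sup>2 *\<^sub>R b i" for i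
  proof -
    have 1: "transpose ?Q *v b i = axis i 1"
      using assms(1) by (simp add: vec_eq_iff transpose_matrix_of_columns_mult axis_def)
    have 2: "(\<chi> i j. if i = j then (s i)\<^sup>2 else 0) *v axis i 1 = axis i ((s i)\<^sup>2)"
      by (simp only: matrix_vector_mult_basis) (simp add: column_def axis_def vec_eq_iff)
    have 3: "?Q *v axis i ((s i)\<^sup>2) = (s i)\<^sup>2 *\<^sub>R b i"
      by (simp add: matrix_of_columns_mult axis_def if_distrib[of "\<lambda>x. x *\<^sub>R _"] cong: if_cong)
    show ?thesis by (simp add: C_def matrix_vector_mul_assoc[symmetric] 1 2 3)
  qed
  then interpret gaussian_eigenbasis C b "\<lambda>i. (s i)\<^sup>2" m
    by unfold_locales (use assms in \<open>auto simp: less_imp_neq[THEN not_sym]\<close>)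
  show ?thesis using nn_integral_density assms(2) by (simp add: density_eq less_imp_le)
qed

text \<open>The rotation is \<open>mat 1\<close> because \<open>C\<close> is to be the covariance of
  a vector already rotated; the projections are then plain subvectors.\<close>

locale gaussian_split = gaussian_eigenbasis C q l m + orthogonal_split I J "mat 1"
  for C :: "real ^ 'n::{finite,wellorder} ^ 'n::_" and q l m and I J :: "'n set"
begin

lemma proj_eq: "proj K x = subvector K x"
  by (simp add: proj_def transpose_mat)

text \<open>The marginal density \<open>r\<close> stays abstract: estimates of its expected
  logarithm by Gibbs' inequality replace formulas for Gaussian marginals and Schur
  complements.\<close>

lemma conditional_entropy_eq:
  obtains r :: "('n \<Rightarrow> real) \<Rightarrow> real" where "distributed G TJ (subvector J) (\<lambda>y. ennreal (r y))" "\<And>y. 0 \<le> r y"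
    "integrable G (\<lambda>x. ln (r (subvector J x)))"
    "G.conditional_entropy (exp 1) TI TJ (subvector I) (subvector J) =
       G.expectation (\<lambda>x. ln (r (subvector J x))) - G.expectation (\<lambda>x. ln (p x))"
proof -
  obtain r :: "('n \<Rightarrow> real) \<Rightarrow> real" where r: "distributed G TJ (\<lambda>x. proj J x) (\<lambda>y. ennreal (r y))" "\<And>y. 0 \<le> r y"
    using distributed_proj[OF prob_space_G distributed_G] by auto
  have p0: "\<And>x. 0 \<le> p x" using density_pos by (simp add: less_imp_le)
  have int: "integrable G (\<lambda>x. ln (r (proj J x)))"
    by (rule integrable_ln_proj_density[OF prob_space_G distributed_G p0 r expectation_ln_density(1) integrable_norm])
  have [measurable]: "r \<in> borel_measurable TJ" using r by (auto simp: distributed_def)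
  have [measurable_cong]: "sets G = sets borel" by (simp add: gaussian_measure_def)
  have "G.expectation (\<lambda>x. ln (p x / r (proj J x))) = G.expectation (\<lambda>x. ln (p x) - ln (r (proj J x)))"
    by (rule integral_cong_AE)
      (use distributed_AE_pos[OF r] in \<open>measurable, eventually_elim, simp add: ln_divide_pos density_pos\<close>)
  then have "G.conditional_entropy (exp 1) TI TJ (\<lambda>x. proj I x) (\<lambda>x. proj J x) =
       G.expectation (\<lambda>x. ln (r (proj J x))) - G.expectation (\<lambda>x. ln (p x))"
    using conditional_entropy_split[OF prob_space_G distributed_G p0 r] int expectation_ln_density(1) by simp
  with r int that[of r] show ?thesis by (simp add: proj_eq)
qed

text \<open>The joint entropy is known from the eigenvalues of \<open>C\<close>, so a lower bound
  amounts to an upper bound for the entropy of the \<open>J\<close> part. Gibbs' inequality supplies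
  it by comparing \<open>r\<close> with the product \<open>g\<close> of normal densities along the
  directions \<open>b i\<close> for i in \<open>J\<close>, with the true variances.\<close>

lemma conditional_entropy_ge:
  assumes b: "orthonormal b" and bI: "\<And>i. i \<in> I \<Longrightarrow> b i = axis i 1" and bJ: "\<And>i j. i \<in> J \<Longrightarrow> j \<in> I \<Longrightarrow> b i $ j = 0"
    and pos: "\<And>i. i \<in> J \<Longrightarrow> 0 < (C *v b i) \<bullet> b i"
  shows "(\<Sum>i\<in>UNIV. ln (2 * pi * l i) / 2 + 1 / 2) - (\<Sum>i\<in>J. ln (2 * pi * ((C *v b i) \<bullet> b i)) / 2 + 1 / 2)
    \<le> G.conditional_entropy (exp 1) TI TJ (subvector I) (subvector J)"
proof -
  obtain r :: "('n \<Rightarrow> real) \<Rightarrow> real" where r: "distributed G TJ (subvector J) (\<lambda>y. ennreal (r y))" "\<And>y. 0 \<le> r y"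
    "integrable G (\<lambda>x. ln (r (subvector J x)))"
    "G.conditional_entropy (exp 1) TI TJ (subvector I) (subvector J) =
       G.expectation (\<lambda>x. ln (r (subvector J x))) - G.expectation (\<lambda>x. ln (p x))"
    by (rule conditional_entropy_eq) (rule that)
  let ?\<beta> = "\<lambda>i. (C *v b i) \<bullet> b i"
  define g where "g y = (\<Prod>i\<in>J. normal_density 0 (sqrt (?\<beta> i)) (\<Sum>j\<in>J. b i $ j * (y j - m $ j)))" for y :: "'n \<Rightarrow> real"
  define h where "h y = (\<Prod>i\<in>I. normal_density (m $ i) 1 (y i))" for y :: "'n \<Rightarrow> real"
  have comp: "(\<lambda>y. y j) \<in> borel_measurable (subvector_lborel K)" if "j \<in> K" for j K
    using measurable_component_singleton[OF that, of "\<lambda>_. lborel :: real measure"] by simp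
  have [measurable]: "g \<in> borel_measurable TJ"
    unfolding g_def[abs_def] by (intro borel_measurable_prod measurable_compose[OF _ borel_measurable_normal_density] borel_measurable_sum borel_measurable_times borel_measurable_diff comp) auto
  have [measurable]: "h \<in> borel_measurable TI"
    unfolding h_def[abs_def] by (intro borel_measurable_prod measurable_compose[OF comp borel_measurable_normal_density]) auto
  have g_eq: "g (subvector J x) = (\<Prod>i\<in>J. normal_density 0 (sqrt (?\<beta> i)) (b i \<bullet> (x - m)))" for x
    unfolding g_def
  proof (intro prod.cong refl arg_cong[where f = "normal_density _ _"])
    fix i assume i: "i \<in> J"
    have "b i \<bullet> (x - m) = (\<Sum>j\<in>UNIV. b i $ j * (x $ j - m $ j))" by (simp add: inner_vec_def)
    also have "\<dots> = (\<Sum>j\<in>J. b i $ j * (x $ j - m $ j))"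
      using bJ[OF i] by (intro sum.mono_neutral_right) (auto simp: J_iff)
    finally show "(\<Sum>j\<in>J. b i $ j * (subvector J x j - m $ j)) = b i \<bullet> (x - m)" by (simp add: subvector_def)
  qed
  have g_nn: "0 \<le> g y" for y unfolding g_def by (intro prod_nonneg) simp
  have h_nn: "0 \<le> h y" for y unfolding h_def by (intro prod_nonneg) simp
  have g1: "(\<integral>\<^sup>+y. ennreal (g y) \<partial>TJ) = 1"
  proof -
    \<comment> \<open>Unit variances on \<open>I\<close> complete \<open>g\<close> to a Gaussian
      density on the whole space. By the shape of \<open>b\<close> this factors into
      \<open>h\<close> and \<open>g\<close>, and \<open>h\<close> has mass 1.\<close>
    define s where "s i = (if i \<in> J then sqrt (?\<beta> i) else 1)" for i
    have "1 = (\<integral>\<^sup>+x. ennreal (\<Prod>i\<in>UNIV. normal_density 0 (s i) (b i \<bullet> (x - m))) \<partial>lborel)"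
      by (rule nn_integral_orthonormal_normal[OF b, symmetric]) (simp add: s_def pos)
    also have "\<dots> = (\<integral>\<^sup>+x. ennreal (h (proj I x)) * ennreal (g (proj J x)) \<partial>lborel)"
    proof (intro nn_integral_cong)
      fix x
      have "(\<Prod>i\<in>UNIV. normal_density 0 (s i) (b i \<bullet> (x - m))) =
        (\<Prod>i\<in>I. normal_density 0 (s i) (b i \<bullet> (x - m))) * (\<Prod>i\<in>J. normal_density 0 (s i) (b i \<bullet> (x - m)))"
        by (subst prod.union_disjoint[symmetric]) (auto simp: J)
      also have "(\<Prod>i\<in>I. normal_density 0 (s i) (b i \<bullet> (x - m))) = h (subvector I x)"
        unfolding h_def by (intro prod.cong) (auto simp: s_def J_iff bI inner_axis' subvector_def normal_density_def)
      also have "(\<Prod>i\<in>J. normal_density 0 (s i) (b i \<bullet> (x - m))) = g (subvector J x)"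
        unfolding g_eq by (intro prod.cong) (auto simp: s_def)
      finally show "ennreal (\<Prod>i\<in>UNIV. normal_density 0 (s i) (b i \<bullet> (x - m))) = ennreal (h (proj I x)) * ennreal (g (proj J x))"
        by (simp add: proj_eq ennreal_mult h_nn g_nn)
    qed
    also have "\<dots> = (\<integral>\<^sup>+y. ennreal (h y) \<partial>TI) * (\<integral>\<^sup>+y. ennreal (g y) \<partial>TJ)"
      by (rule nn_integral_split_prod) auto
    also have "(\<integral>\<^sup>+y. ennreal (h y) \<partial>TI) = 1" unfolding h_def by (rule nn_integral_prod_normal) auto
    finally show ?thesis by simp
  qed
  have [measurable]: "r \<in> borel_measurable TJ" using r by (auto simp: distributed_def)
  have [measurable_cong]: "sets G = sets borel" by (simp add: gaussian_measure_def)
  note E = expectation_ln_normal[of J b, OF _ pos]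
  have "G.expectation (\<lambda>x. ln (g (subvector J x))) \<le> G.expectation (\<lambda>x. ln (r (subvector J x)))"
  proof (rule G.integral_ln_le)
    show "AE x in G. 0 < r (subvector J x)" by (rule distributed_AE_pos[OF r(1,2)])
    show "AE x in G. 0 < g (subvector J x)"
      unfolding g_eq by (intro AE_I2 prod_pos ballI normal_density_pos) (simp add: pos)
    show "(\<integral>\<^sup>+x. ennreal (g (subvector J x) / r (subvector J x)) \<partial>G) \<le> 1"
      unfolding g1[symmetric] by (rule nn_integral_density_ratio_le[OF r(1,2) g_nn]) auto
    show "integrable G (\<lambda>x. ln (g (subvector J x)))" unfolding g_eq by (rule E) auto
  qed (simp_all add: r)
  also note r(4)[symmetric, THEN eq_refl]
  finally show ?thesis using E(2) r(4) expectation_ln_density(2) by (simp add: g_eq)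
qed

text \<open>The marginal \<open>r\<close> times independent normal densities on \<open>I\<close>
  with variances \<open>l i\<close> is a density on the whole space. By Gibbs' inequality its
  expected logarithm is at most that of \<open>p\<close>, and the terms with \<open>r\<close>
  cancel.\<close>

lemma conditional_entropy_le:
  assumes q_axis: "\<And>i. q i = axis i 1"
  shows "G.conditional_entropy (exp 1) TI TJ (subvector I) (subvector J) \<le> (\<Sum>i\<in>I. ln (2 * pi * l i) / 2 + 1 / 2)"
proof -
  obtain r :: "('n \<Rightarrow> real) \<Rightarrow> real" where r: "distributed G TJ (subvector J) (\<lambda>y. ennreal (r y))" "\<And>y. 0 \<le> r y"
    "integrable G (\<lambda>x. ln (r (subvector J x)))"
    "G.conditional_entropy (exp 1) TI TJ (subvector I) (subvector J) =
       G.expectation (\<lambda>x. ln (r (subvector J x))) - G.expectation (\<lambda>x. ln (p x))"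
    by (rule conditional_entropy_eq) (rule that)
  define h where "h y = (\<Prod>i\<in>I. normal_density (m $ i) (sqrt (l i)) (y i))" for y :: "'n \<Rightarrow> real"
  have comp: "(\<lambda>y. y j) \<in> borel_measurable (subvector_lborel K)" if "j \<in> K" for j K
    using measurable_component_singleton[OF that, of "\<lambda>_. lborel :: real measure"] by simp
  have [measurable]: "h \<in> borel_measurable TI"
    unfolding h_def[abs_def] by (intro borel_measurable_prod measurable_compose[OF comp borel_measurable_normal_density]) auto
  have h_pos: "0 < h y" for y unfolding h_def by (intro prod_pos ballI normal_density_pos) (simp add: l_pos)
  have h_eq: "h (subvector I x) = (\<Prod>i\<in>I. normal_density 0 (sqrt ((C *v q i) \<bullet> q i)) (q i \<bullet> (x - m)))" for x
    unfolding h_def eigen_value by (intro prod.cong) (auto simp: q_axis inner_axis' subvector_def normal_density_def)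
  have [measurable]: "r \<in> borel_measurable TJ" using r by (auto simp: distributed_def)
  have [measurable_cong]: "sets G = sets borel" by (simp add: gaussian_measure_def)
  have r1: "(\<integral>\<^sup>+y. ennreal (r y) \<partial>TJ) = 1"
    using distributed_nn_integral[OF r(1), of "\<lambda>_. 1"] by (simp add: G.emeasure_space_1)
  note rp = distributed_AE_pos[OF r(1,2)]
  have E: "integrable G (\<lambda>x. ln (h (subvector I x)))"
    "G.expectation (\<lambda>x. ln (h (subvector I x))) = - (\<Sum>i\<in>I. ln (2 * pi * l i) / 2 + 1 / 2)"
    unfolding h_eq using expectation_ln_normal[of I q] by (simp_all add: eigen_value l_pos)
  have ae: "AE x in G. ln (r (subvector J x)) + ln (h (subvector I x)) = ln (r (subvector J x) * h (subvector I x))"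
    using rp by eventually_elim (simp add: ln_mult_pos h_pos)
  have "G.expectation (\<lambda>x. ln (r (subvector J x) * h (subvector I x))) \<le> G.expectation (\<lambda>x. ln (p x))"
  proof (rule G.integral_ln_le)
    show "AE x in G. 0 < r (subvector J x) * h (subvector I x)" using rp by eventually_elim (simp add: h_pos)
    have "(\<integral>\<^sup>+x. ennreal (r (subvector J x) * h (subvector I x) / p x) \<partial>G) \<le>
        (\<integral>\<^sup>+x. ennreal (r (subvector J x) * h (subvector I x)) \<partial>lborel)"
      by (rule nn_integral_density_ratio_le[OF distributed_G]) (auto simp: density_pos less_imp_le h_pos r)
    also have "\<dots> = (\<integral>\<^sup>+x. ennreal (h (proj I x)) * ennreal (r (proj J x)) \<partial>lborel)"
      by (simp add: proj_eq ennreal_mult r h_pos less_imp_le mult.commute)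
    also have "\<dots> = (\<integral>\<^sup>+y. ennreal (h y) \<partial>TI) * (\<integral>\<^sup>+y. ennreal (r y) \<partial>TJ)"
      by (rule nn_integral_split_prod) auto
    also have "(\<integral>\<^sup>+y. ennreal (h y) \<partial>TI) = 1" unfolding h_def by (rule nn_integral_prod_normal) (auto simp: l_pos)
    finally show "(\<integral>\<^sup>+x. ennreal (r (subvector J x) * h (subvector I x) / p x) \<partial>G) \<le> 1" using r1 by simp
    have i: "integrable G (\<lambda>x. ln (r (subvector J x)) + ln (h (subvector I x)))" using E r(3) by simp
    show "integrable G (\<lambda>x. ln (r (subvector J x) * h (subvector I x)))"
      by (rule integrable_cong_AE_imp[OF i _ ae]) measurable
  qed (use expectation_ln_density density_pos in auto)
  moreover have "G.expectation (\<lambda>x. ln (r (subvector J x) * h (subvector I x))) =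
     G.expectation (\<lambda>x. ln (r (subvector J x)) + ln (h (subvector I x)))"
    by (rule integral_cong_AE[symmetric]) (use ae in measurable)
  ultimately show ?thesis using r(3,4) E by simp
qed

end

section \<open>Covariance matrices\<close>

context prob_space
begin

lemma square_integrable_vec:
  fixes Z :: "'a \<Rightarrow> real ^ 'n"
  assumes [measurable]: "Z \<in> borel_measurable M" and Z: "integrable M (\<lambda>\<omega>. (norm (Z \<omega>))\<^sup>2)"
  shows "integrable M Z" and "integrable M (\<lambda>\<omega>. (u \<bullet> (Z \<omega> - expectation Z)) * (v \<bullet> (Z \<omega> - expectation Z)))"
proof -
  have "integrable M (\<lambda>\<omega>. norm (Z \<omega>))" by (rule square_integrable_imp_integrable) (use Z in auto)
  then show "integrable M Z" by (subst (asm) integrable_norm_iff) auto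
  define D where "D \<omega> = Z \<omega> + (- expectation Z)" for \<omega>
  have D: "D \<in> borel_measurable M" unfolding D_def[abs_def] by measurable
  have "integrable M (\<lambda>\<omega>. (norm (D \<omega>))\<^sup>2)"
    unfolding D_def by (rule integrable_norm_square_add) (use Z in auto)
  note sq = integrable_inner_square[OF D this]
  have "integrable M (\<lambda>\<omega>. (u \<bullet> D \<omega>) * (v \<bullet> D \<omega>))"
  proof (rule Bochner_Integration.integrable_bound)
    show "integrable M (\<lambda>\<omega>. (u \<bullet> D \<omega>)\<^sup>2 + (v \<bullet> D \<omega>)\<^sup>2)" using sq by simp
    show "AE \<omega> in M. norm ((u \<bullet> D \<omega>) * (v \<bullet> D \<omega>)) \<le> norm ((u \<bullet> D \<omega>)\<^sup>2 + (v \<bullet> D \<omega>)\<^sup>2)"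
    proof (rule AE_I2)
      fix \<omega>
      have "2 * (\<bar>u \<bullet> D \<omega>\<bar> * \<bar>v \<bullet> D \<omega>\<bar>) \<le> (u \<bullet> D \<omega>)\<^sup>2 + (v \<bullet> D \<omega>)\<^sup>2"
        using sum_squares_bound[of "\<bar>u \<bullet> D \<omega>\<bar>" "\<bar>v \<bullet> D \<omega>\<bar>"] by (simp add: mult.assoc)
      moreover have "0 \<le> \<bar>u \<bullet> D \<omega>\<bar> * \<bar>v \<bullet> D \<omega>\<bar>" by simp
      ultimately have "\<bar>u \<bullet> D \<omega>\<bar> * \<bar>v \<bullet> D \<omega>\<bar> \<le> (u \<bullet> D \<omega>)\<^sup>2 + (v \<bullet> D \<omega>)\<^sup>2" by linarith
      then show "norm ((u \<bullet> D \<omega>) * (v \<bullet> D \<omega>)) \<le> norm ((u \<bullet> D \<omega>)\<^sup>2 + (v \<bullet> D \<omega>)\<^sup>2)"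
        by (simp add: abs_mult)
    qed
  qed (use D in measurable)
  then show "integrable M (\<lambda>\<omega>. (u \<bullet> (Z \<omega> - expectation Z)) * (v \<bullet> (Z \<omega> - expectation Z)))"
    by (simp add: D_def)
qed

text \<open>The bilinear form determines the matrix, so nonnegativity, behaviour under linear maps
  and additivity can be proved by testing against vectors.\<close>

lemma covariance_inner:
  fixes Z :: "'a \<Rightarrow> real ^ 'n"
  assumes "Z \<in> borel_measurable M" "integrable M (\<lambda>\<omega>. (norm (Z \<omega>))\<^sup>2)"
  shows "(covariance_matrix Z *v u) \<bullet> v = expectation (\<lambda>\<omega>. (u \<bullet> (Z \<omega> - expectation Z)) * (v \<bullet> (Z \<omega> - expectation Z)))"
proof -
  let ?D = "\<lambda>\<omega>. Z \<omega> - expectation Z"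
  have "integrable M (\<lambda>\<omega>. (axis i 1 \<bullet> ?D \<omega>) * (axis j 1 \<bullet> ?D \<omega>))" for i j
    by (rule square_integrable_vec[OF assms])
  then have int: "integrable M (\<lambda>\<omega>. ?D \<omega> $ i * ?D \<omega> $ j)" for i j
    by (simp add: inner_axis')
  have eq: "(u \<bullet> ?D \<omega>) * (v \<bullet> ?D \<omega>) = (\<Sum>i\<in>UNIV. \<Sum>j\<in>UNIV. v $ i * (u $ j * (?D \<omega> $ i * ?D \<omega> $ j)))" for \<omega>
    unfolding inner_vec_def sum_product by (subst sum.swap) (simp add: mult_ac)
  have "expectation (\<lambda>\<omega>. (u \<bullet> ?D \<omega>) * (v \<bullet> ?D \<omega>)) = (\<Sum>i\<in>UNIV. \<Sum>j\<in>UNIV. v $ i * (u $ j * expectation (\<lambda>\<omega>. ?D \<omega> $ i * ?D \<omega> $ j)))"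
    unfolding eq using int by (simp add: Bochner_Integration.integral_sum Bochner_Integration.integrable_sum)
  also have "\<dots> = (covariance_matrix Z *v u) \<bullet> v"
    by (simp add: covariance_matrix_def matrix_vector_mult_def inner_vec_def sum_distrib_left sum_distrib_right mult_ac)
  finally show ?thesis by simp
qed

lemma covariance_symmetric: "transpose (covariance_matrix Z) = covariance_matrix Z"
  by (simp add: covariance_matrix_def transpose_def vec_eq_iff mult.commute)

lemma covariance_nonneg:
  fixes Z :: "'a \<Rightarrow> real ^ 'n"
  assumes "Z \<in> borel_measurable M" "integrable M (\<lambda>\<omega>. (norm (Z \<omega>))\<^sup>2)"
  shows "0 \<le> (covariance_matrix Z *v u) \<bullet> u"
  unfolding covariance_inner[OF assms] by (intro integral_nonneg_AE AE_I2) simp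

lemma covariance_linear:
  fixes Z :: "'a \<Rightarrow> real ^ 'n" and A :: "real ^ 'n ^ 'n"
  assumes [measurable]: "Z \<in> borel_measurable M" and Z: "integrable M (\<lambda>\<omega>. (norm (Z \<omega>))\<^sup>2)"
    and AZ: "integrable M (\<lambda>\<omega>. (norm (A *v Z \<omega>))\<^sup>2)"
  shows "covariance_matrix (\<lambda>\<omega>. A *v Z \<omega>) *v u = A *v (covariance_matrix Z *v (transpose A *v u))"
proof -
  have E: "expectation (\<lambda>\<omega>. A *v Z \<omega>) = A *v expectation Z"
    by (rule integral_bounded_linear[OF _ square_integrable_vec(1)[OF assms(1,2)]]) (simp add: linear_linear)
  have "(covariance_matrix (\<lambda>\<omega>. A *v Z \<omega>) *v u) \<bullet> v = (A *v (covariance_matrix Z *v (transpose A *v u))) \<bullet> v" for v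
  proof -
    have tr: "w \<bullet> (A *v x) = (transpose A *v w) \<bullet> x" for w x
      by (metis dot_lmul_matrix transpose_matrix_vector)
    have "(covariance_matrix (\<lambda>\<omega>. A *v Z \<omega>) *v u) \<bullet> v =
        expectation (\<lambda>\<omega>. (u \<bullet> (A *v (Z \<omega> - expectation Z))) * (v \<bullet> (A *v (Z \<omega> - expectation Z))))"
      by (subst covariance_inner) (use AZ in \<open>auto simp: E matrix_vector_mult_diff_distrib\<close>)
    also have "\<dots> = (covariance_matrix Z *v (transpose A *v u)) \<bullet> (transpose A *v v)"
      unfolding tr by (rule covariance_inner[OF assms(1,2), symmetric])
    also have "\<dots> = (A *v (covariance_matrix Z *v (transpose A *v u))) \<bullet> v"
      by (metis inner_commute tr)
    finally show ?thesis .
  qed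
  then show ?thesis by (metis vector_eq_rdot)
qed

lemma covariance_add:
  fixes S N :: "'a \<Rightarrow> real ^ 'n"
  assumes indep: "indep_var borel S borel N"
    and S: "integrable M (\<lambda>\<omega>. (norm (S \<omega>))\<^sup>2)" and N: "integrable M (\<lambda>\<omega>. (norm (N \<omega>))\<^sup>2)"
  shows "covariance_matrix (\<lambda>\<omega>. S \<omega> + N \<omega>) = covariance_matrix S + covariance_matrix N"
proof -
  have [measurable]: "S \<in> borel_measurable M" "N \<in> borel_measurable M"
    using indep by (auto simp: indep_var_distribution_eq)
  note iS = square_integrable_vec[OF _ S] and iN = square_integrable_vec[OF _ N]
  have E: "expectation (\<lambda>\<omega>. S \<omega> + N \<omega>) = expectation S + expectation N" using iS iN by simp
  let ?s = "\<lambda>u \<omega>. u \<bullet> (S \<omega> - expectation S)" and ?n = "\<lambda>u \<omega>. u \<bullet> (N \<omega> - expectation N)"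
  have ind: "indep_var borel (?s u) borel (?n v)" for u v
    using indep_var_compose[OF indep, of "\<lambda>x. u \<bullet> (x - expectation S)" borel "\<lambda>x. v \<bullet> (x - expectation N)" borel]
    by (simp add: comp_def)
  have i: "integrable M (?s u)" "integrable M (?n u)" for u using iS(1) iN(1) by auto
  have z: "expectation (?s u) = 0" "expectation (?n u) = 0" for u
    using iS(1) iN(1) by (simp_all add: prob_space)
  have cross: "integrable M (\<lambda>\<omega>. ?s u \<omega> * ?n v \<omega>)" "expectation (\<lambda>\<omega>. ?s u \<omega> * ?n v \<omega>) = 0" for u v
    using indep_var_integrable[OF ind i] indep_var_lebesgue_integral[OF ind i] by (simp_all add: z)
  have "(covariance_matrix (\<lambda>\<omega>. S \<omega> + N \<omega>) *v u) \<bullet> v = ((covariance_matrix S + covariance_matrix N) *v u) \<bullet> v" for u v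
  proof -
    have "(covariance_matrix (\<lambda>\<omega>. S \<omega> + N \<omega>) *v u) \<bullet> v =
        expectation (\<lambda>\<omega>. (u \<bullet> (S \<omega> + N \<omega> - (expectation S + expectation N))) * (v \<bullet> (S \<omega> + N \<omega> - (expectation S + expectation N))))"
      unfolding E[symmetric] by (rule covariance_inner) (use S N in \<open>auto intro!: integrable_norm_square_add\<close>)
    also have "\<dots> = expectation (\<lambda>\<omega>. ?s u \<omega> * ?s v \<omega> + ?n u \<omega> * ?n v \<omega> + (?s u \<omega> * ?n v \<omega> + ?s v \<omega> * ?n u \<omega>))"
      by (intro Bochner_Integration.integral_cong) (simp_all add: inner_simps algebra_simps)
    also have "\<dots> = expectation (\<lambda>\<omega>. ?s u \<omega> * ?s v \<omega>) + expectation (\<lambda>\<omega>. ?n u \<omega> * ?n v \<omega>)"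
      using iS(2) iN(2) cross by simp
    also have "\<dots> = ((covariance_matrix S + covariance_matrix N) *v u) \<bullet> v"
      using covariance_inner[OF _ S] covariance_inner[OF _ N] by (simp add: matrix_vector_mult_add_rdistrib inner_add_left)
    finally show ?thesis .
  qed
  then show ?thesis by (metis matrix_eq vector_eq_rdot)
qed

end

section \<open>Quantization of the signal\<close>

lemma quantize_comp: "quantize \<P> S = (\<lambda>\<omega>. quantize \<P> (\<lambda>s. s) (S \<omega>))"
  by (rule ext) (simp add: quantize_def)

text \<open>Disjointness makes the description in \<open>quantize\<close> unique, so the preimage of
  a cell is the cell itself.\<close>

lemma measurable_quantize:
  assumes "finite \<P>" "partition_on (space S) \<P>" "\<P> \<subseteq> sets S"
  shows "quantize \<P> (\<lambda>s. s) \<in> S \<rightarrow>\<^sub>M count_space \<P>"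
proof -
  have eq: "quantize \<P> (\<lambda>s. s) s = A" if "A \<in> \<P>" "s \<in> A" for s A
    unfolding quantize_def
    using that assms(2) by (intro the_equality) (auto simp: partition_on_def disjoint_def)
  have cover: "\<exists>A\<in>\<P>. s \<in> A" if "s \<in> space S" for s
    using assms(2) that by (auto simp: partition_on_def)
  have vimage: "quantize \<P> (\<lambda>s. s) -` {A} \<inter> space S = A" if A: "A \<in> \<P>" for A
  proof (intro equalityI subsetI)
    fix s assume s: "s \<in> quantize \<P> (\<lambda>s. s) -` {A} \<inter> space S"
    then obtain B where B: "B \<in> \<P>" "s \<in> B" using cover[of s] by auto
    from eq[OF B] s B show "s \<in> A" by simp
  next
    fix s assume s: "s \<in> A"
    have "A \<in> sets S" using A assms(3) by (rule rev_subsetD)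
    then have "s \<in> space S" using s by (rule sets.sets_into_space[THEN subsetD])
    then show "s \<in> quantize \<P> (\<lambda>s. s) -` {A} \<inter> space S" using eq[OF A s] by simp
  qed
  show ?thesis
    unfolding measurable_count_space_eq2[OF assms(1)]
  proof (intro conjI ballI funcsetI)
    fix s assume "s \<in> space S"
    then obtain A where A: "A \<in> \<P>" "s \<in> A" using cover[of s] by auto
    from eq[OF A] A(1) show "quantize \<P> (\<lambda>s. s) s \<in> \<P>" by simp
  next
    fix A assume A: "A \<in> \<P>"
    have "A \<in> sets S" using A assms(3) by (rule rev_subsetD)
    then show "quantize \<P> (\<lambda>s. s) -` {A} \<inter> space S \<in> sets S" by (simp only: vimage[OF A])
  qed
qed

theorem theorem2:
  fixes P :: "'a measure"
    and S N X Y N' :: "'a \<Rightarrow> real ^ 'n::{finite,wellorder}"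
    and f :: "real ^ 'n::_ \<Rightarrow> real"
    and W :: "real ^ 'n::_ ^ 'n::_"
    and \<mu> :: "nat \<Rightarrow> real"
    and M :: nat
  assumes "prob_space P"
    and "1 \<le> M" and "M < CARD('n)"
    and "prob_space.indep_var P borel S borel N"
    and "integrable P (\<lambda>\<omega>. (norm (S \<omega>))\<^sup>2)"
    and "integrable P (\<lambda>\<omega>. (norm (N \<omega>))\<^sup>2)"
    and "information_space.finite_entropy P (exp 1) lborel N f"
    and "rank (prob_space.covariance_matrix P S) \<le> M"
    and "rank (prob_space.covariance_matrix P N) = CARD('n)"
    and "X = (\<lambda>\<omega>. S \<omega> + N \<omega>)"
    and "pca_matrix (prob_space.covariance_matrix P X) W"
    and "Y = (\<lambda>\<omega>. transpose W *v X \<omega>)"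
    and "N' = (\<lambda>\<omega>. transpose W *v N \<omega>)"
    and "prob_space.conditional_divergence P (- first_indices M) (first_indices M) N'
           \<le> prob_space.conditional_divergence P (- first_indices M) (first_indices M) Y"
    and "eigenvalues_decreasing (prob_space.covariance_matrix P N) \<mu>"
  shows "prob_space.relevant_information_loss P borel borel (subvector_lborel (first_indices M))
           S X (\<lambda>\<omega>. subvector (first_indices M) (Y \<omega>))
         \<le> ereal (1 / 2 * ln (\<Prod>i = M + 1..CARD('n). \<mu> 1 / \<mu> i))"
proof -
  interpret prob_space P by fact
  interpret information_space P "exp 1" by unfold_locales simp
  let ?F = "first_indices M :: 'n set"
  let ?CS = "covariance_matrix S" and ?CN = "covariance_matrix N" and ?CX = "covariance_matrix X"
  let ?CY = "covariance_matrix Y" and ?CN' = "covariance_matrix N'"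
  have M: "M \<le> CARD('n)" using assms(3) by simp
  have indep: "indep_var borel S borel N" by fact
  have [measurable]: "S \<in> borel_measurable P" "N \<in> borel_measurable P"
    using indep by (auto simp: indep_var_distribution_eq)
  have X[measurable]: "X \<in> borel_measurable P" unfolding assms(10) by measurable
  have [measurable]: "Y \<in> borel_measurable P" "N' \<in> borel_measurable P" unfolding assms(12,13) by measurable
  have f: "distributed P lborel N f" "\<And>x. 0 \<le> f x" and intf: "integrable lborel (\<lambda>x. f x * log (exp 1) (f x))"
    using assms(7) by (auto simp: finite_entropy_def)
  have [measurable]: "f \<in> borel_measurable borel" using f by (auto simp: distributed_def)
  have lnf: "integrable P (\<lambda>\<omega>. ln (f (N \<omega>)))"
    using intf distributed_integrable[OF f(1), of "\<lambda>x. ln (f x)"] f(2) by (simp add: log_def)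
  have W: "orthogonal_matrix W" using assms(11) by (simp add: pca_matrix_def)
  obtain l where l: "antimono l" "\<And>i. ?CX *v column i W = l i *\<^sub>R column i W"
    using assms(11) by (auto simp: pca_matrix_def)
  have X2: "integrable P (\<lambda>\<omega>. (norm (X \<omega>))\<^sup>2)"
    unfolding assms(10) by (rule integrable_norm_square_add) (use assms in auto)
  have oW: "orthogonal_transformation ((*v) (transpose W))"
    using W by (simp add: orthogonal_transformation_matrix orthogonal_matrix_transpose)
  have norm_W: "norm (transpose W *v x) = norm x" for x
    using oW by (rule orthogonal_transformation_norm)
  have CX: "?CX = ?CS + ?CN" unfolding assms(10) by (rule covariance_add[OF indep assms(5,6)])
  have CY_mult: "?CY *v u = transpose W *v (?CX *v (W *v u))" for u
    using covariance_linear[OF X X2, of "transpose W" u] X2 by (simp add: assms(12) norm_W)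
  have CN'_mult: "?CN' *v u = transpose W *v (?CN *v (W *v u))" for u
    using covariance_linear[of N "transpose W" u] assms(6) by (simp add: assms(13) norm_W)
  \<comment> \<open>\<open>I\<close> is the set of the last N - M components and \<open>J\<close>
    that of the first \<open>M\<close>, on which one conditions. The projections include the
    rotation, so the loss bound applies to \<open>S\<close> and \<open>N\<close> in the original
    coordinates.\<close>
  interpret A: orthogonal_split "- ?F" ?F W by unfold_locales (use W in auto)
  have proj_X: "A.proj K (S \<omega> + N \<omega>) = subvector K (Y \<omega>)" and proj_N: "A.proj K (N \<omega>) = subvector K (N' \<omega>)" for K \<omega>
    by (simp_all add: A.proj_def assms)

  obtain q where q: "orthonormal q" "\<And>i. ?CN *v q i = \<mu> (Suc (idx i)) *\<^sub>R q i"
    using symmetric_eigenbasis[OF covariance_symmetric assms(15)] by blast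
  have dec: "\<mu> (Suc j) \<le> \<mu> (Suc i)" if "i \<le> j" "j < CARD('n)" for i j
    using assms(15) that by (auto simp: eigenvalues_decreasing_def)
  have mu_pos: "0 < \<mu> (Suc (idx (i::'n)))" for i
  proof -
    have "inj ((*v) ?CN)" using assms(9) by (simp add: full_rank_injective)
    moreover have "q i \<noteq> 0" using q(1)[rule_format, of i i] by auto
    ultimately have "?CN *v q i \<noteq> ?CN *v 0" by (metis injD)
    then have "\<mu> (Suc (idx i)) \<noteq> 0" by (auto simp: q)
    moreover have "0 \<le> \<mu> (Suc (idx i))"
      using covariance_nonneg[of N "q i"] assms(6) q by simp
    ultimately show ?thesis by simp
  qed
  have mu_pos': "0 < \<mu> k" if "1 \<le> k" "k \<le> CARD('n)" for k
  proof -
    have "k - 1 \<in> idx ` (UNIV :: 'n set)" using bij_betw_idx[where ?'n = 'n] that by (auto simp: bij_betw_def)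
    then obtain i :: 'n where "k - 1 = idx i" by auto
    then have "Suc (idx i) = k" using that by simp
    then show ?thesis using mu_pos[of i] by simp
  qed
  \<comment> \<open>Supplies bounds on the quadratic form of \<open>?CN\<close>, for which the mean
    is arbitrary.\<close>
  interpret GN: gaussian_eigenbasis ?CN q "\<lambda>i. \<mu> (Suc (idx i))" 0
    by unfold_locales (rule q mu_pos)+

  have CN'_sym: "transpose ?CN' = ?CN'" by (rule covariance_symmetric)
  \<comment> \<open>Rotation carries eigenvectors to eigenvectors with the same \<mu>, so
    interlacing applies in the coordinates where the first \<open>M\<close> are singled out.\<close>
  define q' where "q' i = transpose W *v q i" for i
  have q': "orthonormal q'"
    using oW q(1) unfolding q'_def by (simp add: orthogonal_transformation_def)
  have q'_ev: "?CN' *v q' i = \<mu> (Suc (idx i)) *\<^sub>R q' i" for i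
    by (simp add: CN'_mult q'_def A.W_inverse q linear_scale[OF matrix_vector_mul_linear])
  obtain b where b: "orthonormal b" "\<And>i. \<not> idx i < M \<Longrightarrow> b i = axis i 1"
    "\<And>i j. idx i < M \<Longrightarrow> \<not> idx j < M \<Longrightarrow> b i $ j = 0"
    "\<And>i. idx i < M \<Longrightarrow> (?CN' *v b i) \<bullet> b i \<le> \<mu> (Suc (idx i))"
    using compression_eigenbasis[OF CN'_sym q' q'_ev dec M] by blast
  interpret GN': gaussian_split ?CN' q' "\<lambda>i. \<mu> (Suc (idx i))" "expectation N'" "- ?F" ?F
    by unfold_locales (rule q' q'_ev mu_pos orthogonal_matrix_id double_complement[symmetric])+
  have b_pos: "0 < (?CN' *v b i) \<bullet> b i" for i
    using b(1)[rule_format, of i i] by (intro GN'.quadratic_pos) auto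

  \<comment> \<open>\<open>?CX\<close> inherits positive definiteness from the noise, the signal
    part being nonnegative.\<close>
  have l_pos: "0 < l i" for i
  proof -
    let ?w = "column i W"
    have w: "?w \<bullet> ?w = 1" using orthonormal_columns[OF W] by simp
    then have "?w \<noteq> 0" by auto
    then have "0 < (?CN *v ?w) \<bullet> ?w" by (rule GN.quadratic_pos)
    moreover have "0 \<le> (?CS *v ?w) \<bullet> ?w" using covariance_nonneg[of S] assms(5) by simp
    moreover have "l i = (?CX *v ?w) \<bullet> ?w" using w by (simp add: l)
    ultimately show ?thesis by (simp add: CX matrix_vector_mult_add_rdistrib inner_add_left)
  qed
  have Wt_col: "transpose W *v column i W = axis i 1" for i
    using orthonormal_columns[OF W] by (simp add: vec_eq_iff transpose_mult_nth axis_def)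
  \<comment> \<open>In PCA coordinates the covariance is diagonal, as
    \<open>conditional_entropy_le\<close> requires.\<close>
  have CY_ev: "?CY *v axis i 1 = l i *\<^sub>R axis i 1" for i
    unfolding CY_mult by (simp add: matrix_vector_mult_basis l linear_scale[OF matrix_vector_mul_linear] Wt_col)
  have on_axis: "orthonormal (\<lambda>i::'n. axis i (1::real))" by (simp add: inner_axis_axis)
  interpret GY: gaussian_split ?CY "\<lambda>i. axis i 1" l "expectation Y" "- ?F" ?F
    by unfold_locales (rule on_axis CY_ev l_pos orthogonal_matrix_id double_complement[symmetric])+
  have l_le: "l i \<le> \<mu> 1" if "i \<in> - ?F" for i
  proof (rule weyl_low_rank[OF covariance_symmetric[of S] assms(8) orthonormal_columns[OF W] _ l(1)])
    show "(?CS + ?CN) *v column i W = l i *\<^sub>R column i W" for i using l by (simp add: CX)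
    show "(?CN *v x) \<bullet> x \<le> \<mu> 1 * (x \<bullet> x)" for x
      by (rule GN.quadratic_le) (use dec[of 0] in auto)
    show "M \<le> idx i" using that by (simp add: first_indices_idx)
  qed

  \<comment> \<open>The entropy ln (2 pi e v) / 2 of a normal variable with variance v.\<close>
  let ?h = "\<lambda>v :: real. ln (2 * pi * v) / 2 + 1 / 2"
  have mono: "?h v \<le> ?h w" if "0 < v" "v \<le> w" for v w
  proof -
    have "ln (2 * pi * v) \<le> ln (2 * pi * w)" using that by (subst ln_le_cancel_iff) auto
    then show ?thesis by simp
  qed
  let ?HY = "prob_space.conditional_entropy (gaussian_measure (expectation Y) ?CY) (exp 1)
       (subvector_lborel (- ?F)) (subvector_lborel ?F) (subvector (- ?F)) (subvector ?F)"
  let ?HN = "prob_space.conditional_entropy (gaussian_measure (expectation N') ?CN') (exp 1)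
       (subvector_lborel (- ?F)) (subvector_lborel ?F) (subvector (- ?F)) (subvector ?F)"
  have HY: "?HY \<le> (\<Sum>i\<in>- ?F. ?h (\<mu> 1))"
  proof -
    have "?HY \<le> (\<Sum>i\<in>- ?F. ?h (l i))" by (rule GY.conditional_entropy_le) simp
    also have "\<dots> \<le> (\<Sum>i\<in>- ?F. ?h (\<mu> 1))" by (rule sum_mono, rule mono[OF l_pos l_le])
    finally show ?thesis .
  qed
  \<comment> \<open>All N numbers \<mu> enter the joint entropy. Subtracting the first
    \<open>M\<close>, which dominate the variances along \<open>b\<close> by interlacing, leaves the
    last N - M.\<close>
  have HN: "(\<Sum>i\<in>- ?F. ?h (\<mu> (Suc (idx i)))) \<le> ?HN"
  proof -
    have "(\<Sum>i\<in>?F. ?h ((?CN' *v b i) \<bullet> b i)) \<le> (\<Sum>i\<in>?F. ?h (\<mu> (Suc (idx i))))"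
      by (rule sum_mono, rule mono[OF b_pos b(4)]) (simp add: first_indices_idx)
    moreover have "(\<Sum>i\<in>(UNIV :: 'n set). ?h (\<mu> (Suc (idx i)))) = (\<Sum>i\<in>- ?F. ?h (\<mu> (Suc (idx i)))) + (\<Sum>i\<in>?F. ?h (\<mu> (Suc (idx i))))"
      unfolding Compl_eq_Diff_UNIV by (rule sum.subset_diff) simp_all
    moreover have "(\<Sum>i\<in>(UNIV :: 'n set). ?h (\<mu> (Suc (idx i)))) - (\<Sum>i\<in>?F. ?h ((?CN' *v b i) \<bullet> b i)) \<le> ?HN"
    proof (rule GN'.conditional_entropy_ge[OF b(1)])
      show "b i = axis i 1" if "i \<in> - ?F" for i using that by (intro b(2)) (simp add: first_indices_idx)
      show "b i $ j = 0" if "i \<in> ?F" "j \<in> - ?F" for i j using that by (intro b(3)) (simp_all add: first_indices_idx)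
      show "0 < (?CN' *v b i) \<bullet> b i" for i by (rule b_pos)
    qed
    ultimately show ?thesis by linarith
  qed
  \<comment> \<open>Positions M, ..., N - 1 counted from 0 become the numbers M + 1, ..., N.\<close>
  have bij: "bij_betw (\<lambda>i. Suc (idx i)) (- ?F) {M + 1..CARD('n)}"
  proof -
    have a: "bij_betw Suc {M..<CARD('n)} {M + 1..CARD('n)}"
      by (auto simp: bij_betw_def image_Suc_atLeastLessThan atLeastLessThanSuc_atLeastAtMost)
    have b: "bij_betw idx (- ?F) {M..<CARD('n)}"
    proof -
      have "bij_betw idx (UNIV - ?F) ({..<CARD('n)} - {..<M})"
        by (rule bij_betw_DiffI[OF bij_betw_idx]) (use bij_betw_idx_less[OF M] M in \<open>auto simp: first_indices_idx\<close>)
      moreover have "{..<CARD('n)} - {..<M} = {M..<CARD('n)}" by auto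
      ultimately show ?thesis by (simp add: Compl_eq_Diff_UNIV)
    qed
    show ?thesis using bij_betw_trans[OF b a] by (simp only: comp_def)
  qed
  have "(\<Sum>i\<in>- ?F. ?h (\<mu> 1)) - (\<Sum>i\<in>- ?F. ?h (\<mu> (Suc (idx i)))) = (\<Sum>i\<in>- ?F. ln (\<mu> 1 / \<mu> (Suc (idx i))) / 2)"
  proof (subst sum_subtractf[symmetric], rule sum.cong[OF refl])
    fix i :: 'n
    have "0 < \<mu> 1" by (rule mu_pos') (use assms(2,3) in simp_all)
    then show "?h (\<mu> 1) - ?h (\<mu> (Suc (idx i))) = ln (\<mu> 1 / \<mu> (Suc (idx i))) / 2"
      using mu_pos[of i] by (simp add: ln_mult_pos ln_divide_pos diff_divide_distrib add_divide_distrib)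
  qed
  also have "\<dots> = (\<Sum>k = M + 1..CARD('n). ln (\<mu> 1 / \<mu> k) / 2)"
    by (rule sum.reindex_bij_betw[OF bij])
  also have "\<dots> = 1 / 2 * ln (\<Prod>k = M + 1..CARD('n). \<mu> 1 / \<mu> k)"
  proof -
    have "0 < \<mu> 1" by (rule mu_pos') (use assms(2,3) in simp_all)
    then have "ln (\<Prod>k = M + 1..CARD('n). \<mu> 1 / \<mu> k) = (\<Sum>k = M + 1..CARD('n). ln (\<mu> 1 / \<mu> k))"
      using mu_pos' by (intro ln_prod) (auto simp: less_imp_neq[THEN not_sym])
    then show ?thesis by (simp add: sum_divide_distrib)
  qed
  finally have gauss: "?HY - ?HN \<le> 1 / 2 * ln (\<Prod>k = M + 1..CARD('n). \<mu> 1 / \<mu> k)"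
    using HY HN by linarith
  \<comment> \<open>The comparison of divergences rearranged: each is a Gaussian minus an actual
    entropy, so the actual entropies of \<open>Y\<close> and the rotated noise differ by at most as
    much as the Gaussian ones.\<close>
  have div: "conditional_entropy (exp 1) (subvector_lborel (- ?F)) (subvector_lborel ?F) (\<lambda>\<omega>. subvector (- ?F) (Y \<omega>)) (\<lambda>\<omega>. subvector ?F (Y \<omega>)) -
      conditional_entropy (exp 1) (subvector_lborel (- ?F)) (subvector_lborel ?F) (\<lambda>\<omega>. subvector (- ?F) (N' \<omega>)) (\<lambda>\<omega>. subvector ?F (N' \<omega>)) \<le> ?HY - ?HN"
    using assms(14) by (simp add: conditional_divergence_def)
  show ?thesis
    unfolding relevant_information_loss_def
  proof (rule SUP_least)
    fix \<P> :: "(real ^ 'n::_) set set"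
    assume "\<P> \<in> {\<P>. finite \<P> \<and> partition_on (space borel) \<P> \<and> \<P> \<subseteq> sets borel}"
    then have \<P>: "finite \<P>" "partition_on (space borel) \<P>" "\<P> \<subseteq> sets borel" by auto
    have "mutual_information (exp 1) (count_space \<P>) borel (quantize \<P> S) X -
        mutual_information (exp 1) (count_space \<P>) (subvector_lborel ?F) (quantize \<P> S) (\<lambda>\<omega>. subvector ?F (Y \<omega>)) \<le>
      conditional_entropy (exp 1) (subvector_lborel (- ?F)) (subvector_lborel ?F) (\<lambda>\<omega>. subvector (- ?F) (Y \<omega>)) (\<lambda>\<omega>. subvector ?F (Y \<omega>)) -
      conditional_entropy (exp 1) (subvector_lborel (- ?F)) (subvector_lborel ?F) (\<lambda>\<omega>. subvector (- ?F) (N' \<omega>)) (\<lambda>\<omega>. subvector ?F (N' \<omega>))"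
      using A.information_loss_le[OF assms(1) indep f lnf assms(6) X2[unfolded assms(10)] \<P>(1) measurable_quantize[OF \<P>]]
      by (simp only: proj_X proj_N quantize_comp[of \<P> S] assms(10))
    then show "ereal (mutual_information (exp 1) (count_space \<P>) borel (quantize \<P> S) X -
        mutual_information (exp 1) (count_space \<P>) (subvector_lborel ?F) (quantize \<P> S) (\<lambda>\<omega>. subvector ?F (Y \<omega>)))
      \<le> ereal (1 / 2 * ln (\<Prod>i = M + 1..CARD('n). \<mu> 1 / \<mu> i))"
      using div gauss by simp
  qed
qed

end
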